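(* Let $\mathbf q\colon E\to M$ be a display differential bundle in a tangent category $(\mathbb X,\mathbb T)$, and let $R\colon TE\to Vq$ and $H\colon Fq\to TE$ be morphisms. The following are equivalent: (1) $(R,H)$ is a linear Ehresmann connection on $\mathbf q$; (2) $(K_R,H)$ is a Koszul connection on $\mathbf q$, where $K_R:=\{R\iota_q\}_q\colon TE\to E$; (3) $((p_M,R),(\mathrm{id}_{TM},H))$ is an Ehresmann connection on the morphism $(\mathrm{id}_M,q)\colon\mathbf q\to\mathbf 0_M$ in the tangent category $\mathsf{DB}(\mathbb X,\mathbb T)$. Furthermore, if $((R_\downarrow,R^\uparrow),(H_\downarrow,H^\uparrow))$ is an Ehresmann connection on $(\mathrm{id}_M,q)$ in $\mathsf{DB}(\mathbb X,\mathbb T)$, then necessarily $R_\downarrow=p_M$ and $H_\downarrow=\mathrm{id}_{TM}$.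
   Context: Composition is diagrammatic: $fg$ is $f$ followed by $g$; $\langle f,g\rangle$ denotes pairing into a (fibred) product, with projections $\pi_1,\pi_2$. A tangent category $(\mathbb X,\mathbb T)$ is a category $\mathbb X$ with an endofunctor $T$ and natural transformations $p_M\colon TM\to M$, $z_M\colon M\to TM$, $s_M\colon T_2M\to TM$, $l_M\colon TM\to T^2M$, $c_M\colon T^2M\to T^2M$, where the $n$-fold pullback $T_nM$ of $p_M$ along itself exists and is preserved by all $T^m$, such that: $(p_M,z_M,s_M)$ is an additive bundle (a commutative monoid in the category over $M$); $(z_M,l_M)\colon p_M\to Tp_M$ and $(\mathrm{id}_{TM},c_M)\colon Tp_M\to p_{TM}$ are additive bundle morphisms (commutative squares preserving zero and sum); $c_Mc_M=\mathrm{id}$, $l_Mc_M=l_M$, $l_M\,Tl_M=l_M\,l_{TM}$, $Tc_M\,c_{TM}\,Tc_M=c_{TM}\,Tc_M\,c_{TM}$, $l_{TM}\,Tc_M\,c_{TM}=c_M\,Tl_M$; and, with $\xi_M=\langle\pi_1l_M,\pi_2z_{TM}\rangle\,Ts_M\colon T_2M\to T^2M$, the square $\xi_M\,Tp_M=\pi_1p_Mz_M$ is a tangent pullback. A tangent pullback is a pullback preserved by $T^m$ for all $m\ge0$. A tangent display map is a morphism $q\colon E\to M$ such that for all $n\ge0$ and all $f\colon N\to T^nM$ the pullback of $T^nq$ along $f$ exists and is a tangent pullback. A differential bundle $\mathbf q\colon E\to M$ consists of $q\colon E\to M$, $z_q\colon M\to E$, $s_q\colon E_2\to E$, $l_q\colon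 E\to TE$ ($E_n$ the $n$-fold pullback of $q$ along itself, required to exist and be preserved by all $T^m$) such that $(q,z_q,s_q)$ is an additive bundle, $(z_M,l_q)\colon q\to Tq$ and $(z_q,l_q)\colon q\to p_E$ are additive bundle morphisms, $l_ql_E=l_q\,Tl_q$, and with $\xi_q=\langle\pi_1l_q,\pi_2z_E\rangle\,Ts_q\colon E_2\to TE$ the square $\xi_q\,Tq=\pi_1qz_M$ is a tangent pullback. It is display if $q$ is a tangent display map; convention: all differential bundles are assumed display. A morphism $(f,g)\colon\mathbf q\to\mathbf q'$ ($f$ on bases, $g$ on total spaces, $qf=gq'$) is linear if $g\,l_{q'}=l_q\,Tg$. $\mathbf p_E=(p_E,z_E,s_E,l_E)$ is the tangent bundle; $\mathbf 0_M=(\mathrm{id}_M,\mathrm{id}_M,\mathrm{id}_M,z_M)$ is the trivial bundle on $M$. For a morphism $f\colon N\to TE$ with $f\,Tq=f\,Tq\,p_Mz_M$, let $\tilde f\colon N\to E_2$ be the unique morphism with $\tilde f\xi_q=f$ and $\tilde f\pi_1q=f\,Tq\,p_M$; put $\{f\}_q:=\tilde f\pi_1\colon N\to E$. For a tangent display map $q\colon E\to M$: the vertical bundle $\mathbf q^V\colon Vq\to E$ is given by the tangent pullback $Vq$ of $Tq$ along $z_M$, with projections $\iota_q\colon Vq\to TE$ and $T^Vq\colon Vq\to M$ (so $\{R\iota_q\}_q$ is defined for every morphism $R\colon TE\to Vq$, because $\iota_q\,Tq=T^Vq\,z_M$); $q^V=\iota_qp_E$, and its zero $z_q^V$, sum $s^V_q$,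 lift $l_q^V$ are determined by $z_q^V\iota_q=z_E$, $s_q^V\iota_q=(\iota_q\times\iota_q)s_E$, $l_q^V\,T\iota_q=\iota_ql_E$. The Finsler bundle $\mathbf q^F\colon Fq\to E$ is given by the tangent pullback $Fq$ of $q$ along $p_M$, with projections $q^F\colon Fq\to E$ and $T^Fq\colon Fq\to TM$, its zero $z_q^F$, sum $s_q^F$, lift $l_q^F$ determined by $z_q^Fq^F=\mathrm{id}_E$, $z_q^F\,T^Fq=qz_M$; $s_q^Fq^F=\pi_1q^F$, $s_q^F\,T^Fq=(T^Fq\times T^Fq)s_M$; $l_q^F\,Tq^F=q^Fz_E$, $l_q^F\,T(T^Fq)=T^Fq\,l_M$. The horizontal descent $\pi_q\colon TE\to Fq$ is the unique morphism with $\pi_qq^F=p_E$ and $\pi_q\,T^Fq=Tq$. When $\mathbf q$ is a differential bundle, there are further differential bundles: $T\mathbf q\colon TE\to TM$ with projection $Tq$, zero $Tz_q$, sum $Ts_q$ and lift $l_{Tq}=Tl_q\,c_E$; $T^F\mathbf q\colon Fq\to TM$ (projection $T^Fq$), the pullback of $\mathbf q$ along $p_M$, with lift $l_{T^Fq}$ determined by $l_{T^Fq}\,Tq^F=q^Fl_q$, $l_{T^Fq}\,T(T^Fq)=T^Fq\,z_{TM}$; and $T^V\mathbf q\colon Vq\to M$ (projection $T^Vq$), the pullback of $T\mathbf q$ along $z_M$, with lift $l_{T^V\mathbf q}$ determined by $l_{T^V\mathbf q}\,T\iota_q=\iota_q\,Tl_q\,c_E$, $l_{T^V\mathbf q}\,T(T^Vq)=T^Vq\,z_M$.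 A vertical connection on $q$ is $R\colon TE\to Vq$ with $\iota_qR=\mathrm{id}_{Vq}$ and $R\colon\mathbf p_E\to\mathbf q^V$ linear over $E$ ($Rq^V=p_E$, $Rl_q^V=l_E\,TR$). A horizontal connection on $q$ is $H\colon Fq\to TE$ with $H\pi_q=\mathrm{id}_{Fq}$ and $H\colon\mathbf q^F\to\mathbf p_E$ linear over $E$ ($Hp_E=q^F$, $Hl_E=l_q^F\,TH$). An Ehresmann connection on $q$ is a pair $(R,H)$ of a vertical and a horizontal connection with $HR=q^Fz_q^V$ and $\langle R\iota_q,\pi_qH\rangle s_E=\mathrm{id}_{TE}$. These definitions make sense, in any tangent category, for any morphism $q$ for which the tangent pullbacks defining $Vq$ and $Fq$ exist. A linear Ehresmann connection on the differential bundle $\mathbf q$ is an Ehresmann connection $(R,H)$ on $q$ such that $(p_M,R)\colon T\mathbf q\to T^V\mathbf q$ is linear ($R\,l_{T^V\mathbf q}=Tl_q\,c_E\,TR$) and $(\mathrm{id}_{TM},H)\colon T^F\mathbf q\to T\mathbf q$ is linear ($H\,Tl_q\,c_E=l_{T^Fq}\,TH$). A vertical Koszul connection on $\mathbf q$ is $K\colon TE\to E$ with $l_qK=\mathrm{id}_E$, $(p_M,K)\colon T\mathbf q\to\mathbf q$ linear ($Kq=Tq\,p_M$, $Kl_q=Tl_q\,c_E\,TK$) and $(q,K)\colon\mathbf p_E\to\mathbf q$ linear ($Kq=p_Eq$, $Kl_q=l_E\,TK$). A horizontal Koszul connection on $\mathbf q$ is $H\colon Fq\to TE$ with $H\pi_q=\mathrm{id}_{Fq}$,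 $(\mathrm{id}_E,H)\colon\mathbf q^F\to\mathbf p_E$ linear, and $(\mathrm{id}_{TM},H)\colon T^F\mathbf q\to T\mathbf q$ linear. A Koszul connection on $\mathbf q$ is a pair $(K,H)$ of a vertical and a horizontal Koszul connection with $HK=q^F\,q\,z_q$ and $\langle\langle K,p_E\rangle\xi_q,\pi_qH\rangle s_E=\mathrm{id}_{TE}$. $\mathsf{DB}(\mathbb X,\mathbb T)$ is the tangent category whose objects are (display) differential bundles, morphisms are linear morphisms $(f,g)$, tangent functor $\mathbf q\mapsto T\mathbf q$, $(f,g)\mapsto(Tf,Tg)$, and structural transformations those of $(\mathbb X,\mathbb T)$ componentwise (e.g. the projection of $T\mathbf q$ is $(p_M,p_E)\colon T\mathbf q\to\mathbf q$). For the linear morphism $(\mathrm{id}_M,q)\colon\mathbf q\to\mathbf 0_M$ in $\mathsf{DB}(\mathbb X,\mathbb T)$, the tangent pullbacks defining the vertical and Finsler bundles exist there: the vertical bundle has total object $T^V\mathbf q$, inclusion $(z_M,\iota_q)\colon T^V\mathbf q\to T\mathbf q$ and projection $(\mathrm{id}_M,q^V)\colon T^V\mathbf q\to\mathbf q$; the Finsler bundle has total object $T^F\mathbf q$ and projection $(p_M,q^F)\colon T^F\mathbf q\to\mathbf q$; the horizontal descent is $(\mathrm{id}_{TM},\pi_q)\colon T\mathbf q\to T^F\mathbf q$. So an Ehresmann connection on $(\mathrm{id}_M,q)$ is a pair of morphisms $(R_\downarrow,R^\uparrow)\colon T\mathbf q\to T^V\mathbf q$ and $(H_\downarrow,H^\uparrow)\colon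 T^F\mathbf q\to T\mathbf q$ in $\mathsf{DB}(\mathbb X,\mathbb T)$ satisfying the Ehresmann connection axioms in that tangent category.
   Formalization: The implication (2) ⇒ (1) is stated only for R lying over E, i.e. R q^V = p_E, since for arbitrary R it is false (K_R forgets R q^V); (1) ⇒ (2), (1) ⇔ (3) and the final claim are for arbitrary morphisms. *)

theory Defs
  imports Main
begin

text \<open>
  The data of a tangent category.  Composition is diagrammatic.  As the sum
  \<open>s\<^sub>M : T\<^sub>2M \<rightarrow> TM\<close> refers to one particular fibre product of \<open>p\<^sub>M\<close> with itself, this fibre product
  (object \<open>tw M\<close>, projections \<open>tw1 M\<close> and \<open>tw2 M\<close>) is part of the data.
\<close>

record ('o, 'm) tcat =
  obj :: "'o set"
  arr :: "'m set"
  src :: "'m \<Rightarrow> 'o"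
  tgt :: "'m \<Rightarrow> 'o"
  ident :: "'o \<Rightarrow> 'm"
  comp :: "'m \<Rightarrow> 'm \<Rightarrow> 'm"  (infixl "\<cdot>\<index>" 70)
  tobj :: "'o \<Rightarrow> 'o"
  tarr :: "'m \<Rightarrow> 'm"
  tp :: "'o \<Rightarrow> 'm"
  tz :: "'o \<Rightarrow> 'm"
  tl :: "'o \<Rightarrow> 'm"
  tc :: "'o \<Rightarrow> 'm"
  tw :: "'o \<Rightarrow> 'o"
  tw1 :: "'o \<Rightarrow> 'm"
  tw2 :: "'o \<Rightarrow> 'm"
  ts :: "'o \<Rightarrow> 'm"

text \<open>
  The data of a (differential) bundle \<open>q : E \<rightarrow> M\<close>: projection, zero, the two projections
  \<open>E\<^sub>2 \<rightarrow> E\<close> of the chosen fibre product, sum and lift.  The objects \<open>M\<close>, \<open>E\<close>, \<open>E\<^sub>2\<close> are recovered as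
  codomains and domains.
\<close>

record 'm bundle_data =
  bproj :: 'm
  bzero :: 'm
  bp1 :: 'm
  bp2 :: 'm
  bsum :: 'm
  blift :: 'm

context
  fixes C :: "('o, 'm) tcat" (structure)
begin

definition hom :: "'o \<Rightarrow> 'o \<Rightarrow> 'm set" where
  "hom A B = {f \<in> arr C. src C f = A \<and> tgt C f = B}"

definition category :: bool where
  "category \<longleftrightarrow>
     (\<forall>f\<in>arr C. src C f \<in> obj C \<and> tgt C f \<in> obj C) \<and>
     (\<forall>A\<in>obj C. ident C A \<in> hom A A) \<and>
     (\<forall>f\<in>arr C. \<forall>g\<in>arr C. tgt C f = src C g \<longrightarrow> f \<cdot> g \<in> hom (src C f) (tgt C g)) \<and>
     (\<forall>f\<in>arr C. ident C (src C f) \<cdot> f = f \<and> f \<cdot> ident C (tgt C f) = f) \<and>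
     (\<forall>f\<in>arr C. \<forall>g\<in>arr C. \<forall>h\<in>arr C. tgt C f = src C g \<and> tgt C g = src C h \<longrightarrow>
        f \<cdot> g \<cdot> h = f \<cdot> (g \<cdot> h))"

definition endofunctor :: bool where
  "endofunctor \<longleftrightarrow>
     (\<forall>A\<in>obj C. tobj C A \<in> obj C) \<and>
     (\<forall>f\<in>arr C. tarr C f \<in> hom (tobj C (src C f)) (tobj C (tgt C f))) \<and>
     (\<forall>A\<in>obj C. tarr C (ident C A) = ident C (tobj C A)) \<and>
     (\<forall>f\<in>arr C. \<forall>g\<in>arr C. tgt C f = src C g \<longrightarrow> tarr C (f \<cdot> g) = tarr C f \<cdot> tarr C g)"

subsection \<open>Pullbacks\<close>

text \<open>\<open>a\<close> and \<open>b\<close> exhibit their common domain as a pullback of \<open>f\<close> and \<open>g\<close>: \<open>a f = b g\<close>.\<close>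

definition is_pullback :: "'m \<Rightarrow> 'm \<Rightarrow> 'm \<Rightarrow> 'm \<Rightarrow> bool" where
  "is_pullback f g a b \<longleftrightarrow>
     f \<in> arr C \<and> g \<in> arr C \<and> tgt C f = tgt C g \<and>
     a \<in> arr C \<and> b \<in> arr C \<and> src C a = src C b \<and> tgt C a = src C f \<and> tgt C b = src C g \<and>
     a \<cdot> f = b \<cdot> g \<and>
     (\<forall>X\<in>obj C. \<forall>x\<in>hom X (src C f). \<forall>y\<in>hom X (src C g). x \<cdot> f = y \<cdot> g \<longrightarrow>
        (\<exists>!h. h \<in> hom X (src C a) \<and> h \<cdot> a = x \<and> h \<cdot> b = y))"

definition tangent_pullback :: "'m \<Rightarrow> 'm \<Rightarrow> 'm \<Rightarrow> 'm \<Rightarrow> bool" where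
  "tangent_pullback f g a b \<longleftrightarrow>
     (\<forall>m. is_pullback ((tarr C ^^ m) f) ((tarr C ^^ m) g) ((tarr C ^^ m) a) ((tarr C ^^ m) b))"

text \<open>\<open>pair a b x y\<close> is \<open>\<langle>x, y\<rangle>\<close>, where \<open>a\<close>, \<open>b\<close> are the projections of the pullback mapped into.\<close>

definition pair :: "'m \<Rightarrow> 'm \<Rightarrow> 'm \<Rightarrow> 'm \<Rightarrow> 'm" where
  "pair a b x y = (THE h. h \<in> hom (src C x) (src C a) \<and> h \<cdot> a = x \<and> h \<cdot> b = y)"

text \<open>
  The \<open>n\<close>-fold pullback of \<open>q\<close> along itself, with projections \<open>\<pi> i\<close> for \<open>i < n\<close>.  The common composite
  \<open>r\<close> of the \<open>\<pi> i\<close> with \<open>q\<close> is made explicit in order to cover \<open>n = 0\<close>, where the \<open>0\<close>-fold pullback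
  is the codomain of \<open>q\<close>.
\<close>

definition fold_pullback :: "'m \<Rightarrow> nat \<Rightarrow> 'm \<Rightarrow> (nat \<Rightarrow> 'm) \<Rightarrow> bool" where
  "fold_pullback q n r \<pi> \<longleftrightarrow>
     q \<in> arr C \<and> r \<in> arr C \<and> tgt C r = tgt C q \<and>
     (\<forall>i<n. \<pi> i \<in> hom (src C r) (src C q) \<and> \<pi> i \<cdot> q = r) \<and>
     (\<forall>r'\<in>arr C. \<forall>x. tgt C r' = tgt C q \<and> (\<forall>i<n. x i \<in> hom (src C r') (src C q) \<and> x i \<cdot> q = r') \<longrightarrow>
        (\<exists>!h. h \<in> hom (src C r') (src C r) \<and> h \<cdot> r = r' \<and> (\<forall>i<n. h \<cdot> \<pi> i = x i)))"

definition has_tangent_fold_pullbacks :: "'m \<Rightarrow> bool" where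
  "has_tangent_fold_pullbacks q \<longleftrightarrow>
     (\<forall>n. \<exists>r \<pi>. \<forall>m. fold_pullback ((tarr C ^^ m) q) n ((tarr C ^^ m) r) (\<lambda>i. (tarr C ^^ m) (\<pi> i)))"

definition tangent_display :: "'m \<Rightarrow> bool" where
  "tangent_display q \<longleftrightarrow> q \<in> arr C \<and>
     (\<forall>n. \<forall>f\<in>arr C. tgt C f = (tobj C ^^ n) (tgt C q) \<longrightarrow>
        (\<exists>a b. tangent_pullback ((tarr C ^^ n) q) f a b))"

subsection \<open>Bundles\<close>

definition base :: "'m bundle_data \<Rightarrow> 'o" where
  "base Q = tgt C (bproj Q)"

definition total :: "'m bundle_data \<Rightarrow> 'o" where
  "total Q = src C (bproj Q)"

definition fibre2 :: "'m bundle_data \<Rightarrow> 'o" where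
  "fibre2 Q = src C (bp1 Q)"

definition fsum :: "'m bundle_data \<Rightarrow> 'm \<Rightarrow> 'm \<Rightarrow> 'm" where
  "fsum Q x y = pair (bp1 Q) (bp2 Q) x y \<cdot> bsum Q"

text \<open>
  Commutative monoids in the category over \<open>M\<close>; the laws are stated on generalised elements, in
  particular associativity on the three projections of any threefold fibre product.
\<close>

definition additive_bundle :: "'m bundle_data \<Rightarrow> bool" where
  "additive_bundle Q \<longleftrightarrow>
     is_pullback (bproj Q) (bproj Q) (bp1 Q) (bp2 Q) \<and>
     bzero Q \<in> hom (base Q) (total Q) \<and> bzero Q \<cdot> bproj Q = ident C (base Q) \<and>
     bsum Q \<in> hom (fibre2 Q) (total Q) \<and> bsum Q \<cdot> bproj Q = bp1 Q \<cdot> bproj Q \<and>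
     (\<forall>X\<in>obj C. \<forall>x\<in>hom X (total Q). fsum Q x (x \<cdot> bproj Q \<cdot> bzero Q) = x) \<and>
     (\<forall>X\<in>obj C. \<forall>x\<in>hom X (total Q). \<forall>y\<in>hom X (total Q).
        x \<cdot> bproj Q = y \<cdot> bproj Q \<longrightarrow> fsum Q x y = fsum Q y x) \<and>
     (\<forall>X\<in>obj C. \<forall>x\<in>hom X (total Q). \<forall>y\<in>hom X (total Q). \<forall>w\<in>hom X (total Q).
        x \<cdot> bproj Q = y \<cdot> bproj Q \<and> y \<cdot> bproj Q = w \<cdot> bproj Q \<longrightarrow>
        fsum Q (fsum Q x y) w = fsum Q x (fsum Q y w))"

definition additive_morphism :: "'m bundle_data \<Rightarrow> 'm bundle_data \<Rightarrow> 'm \<Rightarrow> 'm \<Rightarrow> bool" where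
  "additive_morphism Q Q' f g \<longleftrightarrow>
     f \<in> hom (base Q) (base Q') \<and> g \<in> hom (total Q) (total Q') \<and>
     bproj Q \<cdot> f = g \<cdot> bproj Q' \<and>
     bzero Q \<cdot> g = f \<cdot> bzero Q' \<and>
     bsum Q \<cdot> g = fsum Q' (bp1 Q \<cdot> g) (bp2 Q \<cdot> g)"

text \<open>
  The morphism \<open>(f, g)\<close>, with \<open>f\<close> on bases and \<open>g\<close> on total spaces, is linear from the bundle with
  projection \<open>q\<close> and lift \<open>l\<close> to the one with projection \<open>q'\<close> and lift \<open>l'\<close>.
\<close>

definition linear :: "'m \<Rightarrow> 'm \<Rightarrow> 'm \<Rightarrow> 'm \<Rightarrow> 'm \<Rightarrow> 'm \<Rightarrow> bool" where
  "linear q l q' l' f g \<longleftrightarrow>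
     f \<in> hom (tgt C q) (tgt C q') \<and> g \<in> hom (src C q) (src C q') \<and>
     q \<cdot> f = g \<cdot> q' \<and> g \<cdot> l' = l \<cdot> tarr C g"

definition tangent_bundle :: "'o \<Rightarrow> 'm bundle_data" where
  "tangent_bundle M = \<lparr>bproj = tp C M, bzero = tz C M, bp1 = tw1 C M, bp2 = tw2 C M,
     bsum = ts C M, blift = tl C M\<rparr>"

definition zero_bundle :: "'o \<Rightarrow> 'm bundle_data" where
  "zero_bundle M = \<lparr>bproj = ident C M, bzero = ident C M, bp1 = ident C M, bp2 = ident C M,
     bsum = ident C M, blift = tz C M\<rparr>"

definition T_bundle :: "'m bundle_data \<Rightarrow> 'm bundle_data" where
  "T_bundle Q = \<lparr>bproj = tarr C (bproj Q), bzero = tarr C (bzero Q),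
     bp1 = tarr C (bp1 Q), bp2 = tarr C (bp2 Q),
     bsum = tarr C (bsum Q), blift = tarr C (blift Q) \<cdot> tc C (total Q)\<rparr>"

definition xi :: "'m bundle_data \<Rightarrow> 'm" where
  "xi Q = fsum (T_bundle Q) (bp1 Q \<cdot> blift Q) (bp2 Q \<cdot> tz C (total Q))"

definition T2_arr :: "'m \<Rightarrow> 'm" where
  "T2_arr f = pair (tw1 C (tgt C f)) (tw2 C (tgt C f))
     (tw1 C (src C f) \<cdot> tarr C f) (tw2 C (src C f) \<cdot> tarr C f)"

subsection \<open>Tangent categories and differential bundles\<close>

definition tangent_category :: bool where
  "tangent_category \<longleftrightarrow>
     category \<and> endofunctor \<and>
     (\<forall>M\<in>obj C.
        tp C M \<in> hom (tobj C M) M \<and> tz C M \<in> hom M (tobj C M) \<and>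
        tl C M \<in> hom (tobj C M) (tobj C (tobj C M)) \<and>
        tc C M \<in> hom (tobj C (tobj C M)) (tobj C (tobj C M)) \<and>
        tw1 C M \<in> hom (tw C M) (tobj C M) \<and> tw2 C M \<in> hom (tw C M) (tobj C M) \<and>
        ts C M \<in> hom (tw C M) (tobj C M)) \<and>
     (\<forall>f\<in>arr C.
        tarr C f \<cdot> tp C (tgt C f) = tp C (src C f) \<cdot> f \<and>
        f \<cdot> tz C (tgt C f) = tz C (src C f) \<cdot> tarr C f \<and>
        tarr C f \<cdot> tl C (tgt C f) = tl C (src C f) \<cdot> tarr C (tarr C f) \<and>
        tarr C (tarr C f) \<cdot> tc C (tgt C f) = tc C (src C f) \<cdot> tarr C (tarr C f) \<and>
        T2_arr f \<cdot> ts C (tgt C f) = ts C (src C f) \<cdot> tarr C f) \<and>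
     (\<forall>M\<in>obj C.
        has_tangent_fold_pullbacks (tp C M) \<and>
        tangent_pullback (tp C M) (tp C M) (tw1 C M) (tw2 C M) \<and>
        additive_bundle (tangent_bundle M) \<and>
        additive_morphism (tangent_bundle M) (T_bundle (tangent_bundle M)) (tz C M) (tl C M) \<and>
        additive_morphism (T_bundle (tangent_bundle M)) (tangent_bundle (tobj C M))
          (ident C (tobj C M)) (tc C M) \<and>
        tc C M \<cdot> tc C M = ident C (tobj C (tobj C M)) \<and>
        tl C M \<cdot> tc C M = tl C M \<and>
        tl C M \<cdot> tarr C (tl C M) = tl C M \<cdot> tl C (tobj C M) \<and>
        tarr C (tc C M) \<cdot> tc C (tobj C M) \<cdot> tarr C (tc C M) =
          tc C (tobj C M) \<cdot> tarr C (tc C M) \<cdot> tc C (tobj C M) \<and>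
        tl C (tobj C M) \<cdot> tarr C (tc C M) \<cdot> tc C (tobj C M) = tc C M \<cdot> tarr C (tl C M) \<and>
        tangent_pullback (tarr C (tp C M)) (tz C M)
          (xi (tangent_bundle M)) (tw1 C M \<cdot> tp C M))"

definition differential_bundle :: "'m bundle_data \<Rightarrow> bool" where
  "differential_bundle Q \<longleftrightarrow>
     has_tangent_fold_pullbacks (bproj Q) \<and>
     tangent_pullback (bproj Q) (bproj Q) (bp1 Q) (bp2 Q) \<and>
     additive_bundle Q \<and>
     blift Q \<in> hom (total Q) (tobj C (total Q)) \<and>
     additive_morphism Q (T_bundle Q) (tz C (base Q)) (blift Q) \<and>
     additive_morphism Q (tangent_bundle (total Q)) (bzero Q) (blift Q) \<and>
     blift Q \<cdot> tl C (total Q) = blift Q \<cdot> tarr C (blift Q) \<and>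
     tangent_pullback (tarr C (bproj Q)) (tz C (base Q)) (xi Q) (bp1 Q \<cdot> bproj Q)"

definition display_bundle :: "'m bundle_data \<Rightarrow> bool" where
  "display_bundle Q \<longleftrightarrow> differential_bundle Q \<and> tangent_display (bproj Q)"

text \<open>
  \<open>brace Q f\<close> is \<open>{f}\<^sub>q\<close>.  It records only the first component of a vertical morphism \<open>f\<close>; the second
  one is \<open>f p\<^sub>E\<close>, and \<open>f\<close> is recovered from \<open>{f}\<^sub>q\<close> only if that composite is known.
\<close>

definition brace :: "'m bundle_data \<Rightarrow> 'm \<Rightarrow> 'm" where
  "brace Q f =
     (THE u. u \<in> hom (src C f) (fibre2 Q) \<and> u \<cdot> xi Q = f \<and>
        u \<cdot> bp1 Q \<cdot> bproj Q = f \<cdot> tarr C (bproj Q) \<cdot> tp C (base Q)) \<cdot> bp1 Q"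

text \<open>
  The lift and the bundle structure on the pullback of a differential bundle along
  \<open>f : N \<rightarrow> base Q\<close>, with projections \<open>a : P \<rightarrow> total Q\<close> and \<open>b : P \<rightarrow> N\<close>; \<open>b1\<close>, \<open>b2\<close> are the projections
  of the fibre product of \<open>b\<close> with itself.
\<close>

definition pb_lift :: "'m \<Rightarrow> 'm \<Rightarrow> 'm \<Rightarrow> 'm" where
  "pb_lift l a b = pair (tarr C a) (tarr C b) (a \<cdot> l) (b \<cdot> tz C (tgt C b))"

definition pb_bundle :: "'m bundle_data \<Rightarrow> 'm \<Rightarrow> 'm \<Rightarrow> 'm \<Rightarrow> 'm \<Rightarrow> 'm \<Rightarrow> 'm bundle_data" where
  "pb_bundle Q f a b b1 b2 =
     \<lparr>bproj = b,
      bzero = pair a b (f \<cdot> bzero Q) (ident C (tgt C b)),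
      bp1 = b1, bp2 = b2,
      bsum = pair a b (fsum Q (b1 \<cdot> a) (b2 \<cdot> a)) (b1 \<cdot> b),
      blift = pb_lift (blift Q) a b\<rparr>"

subsection \<open>Vertical and Finsler bundles of a morphism\<close>

text \<open>
  For \<open>q : E \<rightarrow> M\<close>, the vertical bundle is given by any tangent pullback with projections
  \<open>\<iota> : Vq \<rightarrow> TE\<close> and \<open>tV : Vq \<rightarrow> M\<close>, the Finsler bundle by any tangent pullback with
  projections \<open>qF : Fq \<rightarrow> E\<close> and \<open>tF : Fq \<rightarrow> TM\<close>.
\<close>

definition vertical_pullback :: "'m \<Rightarrow> 'm \<Rightarrow> 'm \<Rightarrow> bool" where
  "vertical_pullback q \<iota> tV \<longleftrightarrow> tangent_pullback (tarr C q) (tz C (tgt C q)) \<iota> tV"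

definition finsler_pullback :: "'m \<Rightarrow> 'm \<Rightarrow> 'm \<Rightarrow> bool" where
  "finsler_pullback q qF tF \<longleftrightarrow> tangent_pullback q (tp C (tgt C q)) qF tF"

definition vproj :: "'m \<Rightarrow> 'm \<Rightarrow> 'm" where
  "vproj q \<iota> = \<iota> \<cdot> tp C (src C q)"

text \<open>
  Zero and lift of the vertical bundle are determined by their composites with \<open>\<iota>\<close> and \<open>T\<iota>\<close>, which
  are monic as pullbacks of the split monomorphisms \<open>z\<^sub>M\<close> and \<open>Tz\<^sub>M\<close>.
\<close>

definition vzero :: "'m \<Rightarrow> 'm \<Rightarrow> 'm" where
  "vzero q \<iota> = (THE h. h \<in> hom (src C q) (src C \<iota>) \<and> h \<cdot> \<iota> = tz C (src C q))"

definition vlift :: "'m \<Rightarrow> 'm \<Rightarrow> 'm" where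
  "vlift q \<iota> = (THE h. h \<in> hom (src C \<iota>) (tobj C (src C \<iota>)) \<and> h \<cdot> tarr C \<iota> = \<iota> \<cdot> tl C (src C q))"

definition flift :: "'m \<Rightarrow> 'm \<Rightarrow> 'm \<Rightarrow> 'm" where
  "flift q qF tF = pair (tarr C qF) (tarr C tF) (qF \<cdot> tz C (src C q)) (tF \<cdot> tl C (tgt C q))"

definition hdescent :: "'m \<Rightarrow> 'm \<Rightarrow> 'm \<Rightarrow> 'm" where
  "hdescent q qF tF = pair qF tF (tp C (src C q)) (tarr C q)"

subsection \<open>Ehresmann connections\<close>

definition vertical_connection :: "'m \<Rightarrow> 'm \<Rightarrow> 'm \<Rightarrow> 'm \<Rightarrow> bool" where
  "vertical_connection q \<iota> tV R \<longleftrightarrow>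
     vertical_pullback q \<iota> tV \<and>
     R \<in> hom (tobj C (src C q)) (src C \<iota>) \<and>
     \<iota> \<cdot> R = ident C (src C \<iota>) \<and>
     linear (tp C (src C q)) (tl C (src C q)) (vproj q \<iota>) (vlift q \<iota>) (ident C (src C q)) R"

definition horizontal_connection :: "'m \<Rightarrow> 'm \<Rightarrow> 'm \<Rightarrow> 'm \<Rightarrow> bool" where
  "horizontal_connection q qF tF H \<longleftrightarrow>
     finsler_pullback q qF tF \<and>
     H \<in> hom (src C qF) (tobj C (src C q)) \<and>
     H \<cdot> hdescent q qF tF = ident C (src C qF) \<and>
     linear qF (flift q qF tF) (tp C (src C q)) (tl C (src C q)) (ident C (src C q)) H"

text \<open>
  The morphism \<open>u\<close> below is the pairing \<open>\<langle>R \<iota>, \<pi>\<^sub>q H\<rangle> : TE \<rightarrow> T\<^sub>2E\<close>; its existence is asserted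
  explicitly so that the condition is never about an undefined pairing.
\<close>

definition ehresmann_connection :: "'m \<Rightarrow> 'm \<Rightarrow> 'm \<Rightarrow> 'm \<Rightarrow> 'm \<Rightarrow> 'm \<Rightarrow> 'm \<Rightarrow> bool" where
  "ehresmann_connection q \<iota> tV qF tF R H \<longleftrightarrow>
     vertical_connection q \<iota> tV R \<and> horizontal_connection q qF tF H \<and>
     H \<cdot> R = qF \<cdot> vzero q \<iota> \<and>
     (\<exists>u \<in> hom (tobj C (src C q)) (tw C (src C q)).
        u \<cdot> tw1 C (src C q) = R \<cdot> \<iota> \<and> u \<cdot> tw2 C (src C q) = hdescent q qF tF \<cdot> H \<and>
        u \<cdot> ts C (src C q) = ident C (tobj C (src C q)))"

subsection \<open>Linear Ehresmann connections and Koszul connections on a differential bundle\<close>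

definition linear_ehresmann_connection ::
    "'m bundle_data \<Rightarrow> 'm \<Rightarrow> 'm \<Rightarrow> 'm \<Rightarrow> 'm \<Rightarrow> 'm \<Rightarrow> 'm \<Rightarrow> bool" where
  "linear_ehresmann_connection Q \<iota> tV qF tF R H \<longleftrightarrow>
     ehresmann_connection (bproj Q) \<iota> tV qF tF R H \<and>
     linear (bproj (T_bundle Q)) (blift (T_bundle Q)) tV (pb_lift (blift (T_bundle Q)) \<iota> tV)
       (tp C (base Q)) R \<and>
     linear tF (pb_lift (blift Q) qF tF) (bproj (T_bundle Q)) (blift (T_bundle Q))
       (ident C (tobj C (base Q))) H"

definition vertical_koszul :: "'m bundle_data \<Rightarrow> 'm \<Rightarrow> bool" where
  "vertical_koszul Q K \<longleftrightarrow>
     K \<in> hom (tobj C (total Q)) (total Q) \<and>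
     blift Q \<cdot> K = ident C (total Q) \<and>
     linear (bproj (T_bundle Q)) (blift (T_bundle Q)) (bproj Q) (blift Q) (tp C (base Q)) K \<and>
     linear (tp C (total Q)) (tl C (total Q)) (bproj Q) (blift Q) (bproj Q) K"

definition horizontal_koszul :: "'m bundle_data \<Rightarrow> 'm \<Rightarrow> 'm \<Rightarrow> 'm \<Rightarrow> bool" where
  "horizontal_koszul Q qF tF H \<longleftrightarrow>
     finsler_pullback (bproj Q) qF tF \<and>
     H \<in> hom (src C qF) (tobj C (total Q)) \<and>
     H \<cdot> hdescent (bproj Q) qF tF = ident C (src C qF) \<and>
     linear qF (flift (bproj Q) qF tF) (tp C (total Q)) (tl C (total Q)) (ident C (total Q)) H \<and>
     linear tF (pb_lift (blift Q) qF tF) (bproj (T_bundle Q)) (blift (T_bundle Q))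
       (ident C (tobj C (base Q))) H"

definition koszul_connection :: "'m bundle_data \<Rightarrow> 'm \<Rightarrow> 'm \<Rightarrow> 'm \<Rightarrow> 'm \<Rightarrow> bool" where
  "koszul_connection Q qF tF K H \<longleftrightarrow>
     vertical_koszul Q K \<and> horizontal_koszul Q qF tF H \<and>
     H \<cdot> K = qF \<cdot> bproj Q \<cdot> bzero Q \<and>
     fsum (tangent_bundle (total Q))
       (pair (bp1 Q) (bp2 Q) K (tp C (total Q)) \<cdot> xi Q) (hdescent (bproj Q) qF tF \<cdot> H) =
       ident C (tobj C (total Q))"

end

subsection \<open>The tangent category of display differential bundles\<close>

record 'm bmor =
  mdom :: "'m bundle_data"
  mcod :: "'m bundle_data"
  mbase :: 'm
  mtotal :: 'm

abbreviation BMor :: "'m bundle_data \<Rightarrow> 'm bundle_data \<Rightarrow> 'm \<Rightarrow> 'm \<Rightarrow> 'm bmor" where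
  "BMor Q Q' f g \<equiv> \<lparr>mdom = Q, mcod = Q', mbase = f, mtotal = g\<rparr>"

text \<open>
  The fibre product of two copies of the projection \<open>TQ \<rightarrow> Q\<close>: the functor \<open>T\<^sub>2\<close> applied to \<open>Q\<close>, with
  lift \<open>T\<^sub>2E \<rightarrow> T(T\<^sub>2E)\<close> given componentwise by the lift of \<open>TQ\<close>.
\<close>

definition T2_bundle :: "('o, 'm) tcat \<Rightarrow> 'm bundle_data \<Rightarrow> 'm bundle_data" where
  "T2_bundle C Q =
     \<lparr>bproj = T2_arr C (bproj Q), bzero = T2_arr C (bzero Q),
      bp1 = T2_arr C (bp1 Q), bp2 = T2_arr C (bp2 Q), bsum = T2_arr C (bsum Q),
      blift = pair C (tarr C (tw1 C (total C Q))) (tarr C (tw2 C (total C Q)))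
        (tw1 C (total C Q) \<cdot>\<^bsub>C\<^esub> blift (T_bundle C Q))
        (tw2 C (total C Q) \<cdot>\<^bsub>C\<^esub> blift (T_bundle C Q))\<rparr>"

definition DB :: "('o, 'm) tcat \<Rightarrow> ('m bundle_data, 'm bmor) tcat" where
  "DB C = \<lparr>
     obj = {Q. display_bundle C Q},
     arr = {\<phi>. display_bundle C (mdom \<phi>) \<and> display_bundle C (mcod \<phi>) \<and>
       linear C (bproj (mdom \<phi>)) (blift (mdom \<phi>)) (bproj (mcod \<phi>)) (blift (mcod \<phi>))
         (mbase \<phi>) (mtotal \<phi>)},
     src = mdom,
     tgt = mcod,
     ident = (\<lambda>Q. BMor Q Q (ident C (base C Q)) (ident C (total C Q))),
     comp = (\<lambda>\<phi> \<psi>. BMor (mdom \<phi>) (mcod \<psi>)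
       (mbase \<phi> \<cdot>\<^bsub>C\<^esub> mbase \<psi>) (mtotal \<phi> \<cdot>\<^bsub>C\<^esub> mtotal \<psi>)),
     tobj = T_bundle C,
     tarr = (\<lambda>\<phi>. BMor (T_bundle C (mdom \<phi>)) (T_bundle C (mcod \<phi>))
       (tarr C (mbase \<phi>)) (tarr C (mtotal \<phi>))),
     tp = (\<lambda>Q. BMor (T_bundle C Q) Q (tp C (base C Q)) (tp C (total C Q))),
     tz = (\<lambda>Q. BMor Q (T_bundle C Q) (tz C (base C Q)) (tz C (total C Q))),
     tl = (\<lambda>Q. BMor (T_bundle C Q) (T_bundle C (T_bundle C Q))
       (tl C (base C Q)) (tl C (total C Q))),
     tc = (\<lambda>Q. BMor (T_bundle C (T_bundle C Q)) (T_bundle C (T_bundle C Q))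
       (tc C (base C Q)) (tc C (total C Q))),
     tw = T2_bundle C,
     tw1 = (\<lambda>Q. BMor (T2_bundle C Q) (T_bundle C Q) (tw1 C (base C Q)) (tw1 C (total C Q))),
     tw2 = (\<lambda>Q. BMor (T2_bundle C Q) (T_bundle C Q) (tw2 C (base C Q)) (tw2 C (total C Q))),
     ts = (\<lambda>Q. BMor (T2_bundle C Q) (T_bundle C Q) (ts C (base C Q)) (ts C (total C Q)))\<rparr>"

definition TV_bundle :: "('o, 'm) tcat \<Rightarrow> 'm bundle_data \<Rightarrow> 'm \<Rightarrow> 'm \<Rightarrow> 'm \<Rightarrow> 'm \<Rightarrow> 'm bundle_data" where
  "TV_bundle C Q \<iota> tV v1 v2 = pb_bundle C (T_bundle C Q) (tz C (base C Q)) \<iota> tV v1 v2"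

definition TF_bundle :: "('o, 'm) tcat \<Rightarrow> 'm bundle_data \<Rightarrow> 'm \<Rightarrow> 'm \<Rightarrow> 'm \<Rightarrow> 'm \<Rightarrow> 'm bundle_data" where
  "TF_bundle C Q qF tF f1 f2 = pb_bundle C Q (tp C (base C Q)) qF tF f1 f2"

text \<open>
  Ehresmann connections in \<open>DB C\<close> on the morphism \<open>(id\<^sub>M, q)\<close> from \<open>Q\<close> to the trivial bundle, with
  respect to the vertical and Finsler pullbacks in \<open>DB C\<close> whose apexes are the bundles
  \<open>TV_bundle\<close> and \<open>TF_bundle\<close>.
\<close>

definition DB_ehresmann_connection ::
    "('o, 'm) tcat \<Rightarrow> 'm bundle_data \<Rightarrow> 'm \<Rightarrow> 'm \<Rightarrow> 'm \<Rightarrow> 'm \<Rightarrow> 'm \<Rightarrow> 'm \<Rightarrow> 'm \<Rightarrow> 'm \<Rightarrow>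
       'm bmor \<Rightarrow> 'm bmor \<Rightarrow> bool" where
  "DB_ehresmann_connection C Q \<iota> tV v1 v2 qF tF f1 f2 \<rho> \<eta> \<longleftrightarrow>
     (let M = base C Q; Z = zero_bundle C M;
          V = TV_bundle C Q \<iota> tV v1 v2; F = TF_bundle C Q qF tF f1 f2
      in ehresmann_connection (DB C)
           (BMor Q Z (ident C M) (bproj Q))
           (BMor V (T_bundle C Q) (tz C M) \<iota>)
           (BMor V Z (ident C M) tV)
           (BMor F Q (tp C M) qF)
           (BMor F (T_bundle C Z) (ident C (tobj C M)) tF)
           \<rho> \<eta>)"

end

theory Submission
  imports Defs
begin

text \<open>
  The universal property of a differential bundle says that every vector on \<open>E\<close> that is vertical, i.e. lies
  over a zero vector of \<open>M\<close>, is of the form \<open>\<langle>k, e\<rangle> \<xi>\<close> for unique \<open>k\<close> and \<open>e\<close> in the same fibre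
  (\<open>vert_ex\<close>, \<open>vert_inj\<close>).  So a morphism \<open>R : T E \<rightarrow> V q\<close> over \<open>E\<close> is the same as a morphism \<open>K : T E \<rightarrow> E\<close> over
  \<open>M\<close>, by \<open>R \<iota> = \<langle>K, p\<rangle> \<xi>\<close>.  The lifts of \<open>p\<^sub>E\<close> and \<open>T q\<close> act on vertical vectors by simple formulas
  (\<open>vert_tl\<close>, \<open>vert_lift\<close>), and these translate each linearity condition on \<open>R\<close> to the corresponding one on
  \<open>K\<close>.  That \<open>R\<close> fixes all vertical vectors corresponds to \<open>l K = id\<close>, which only says that it
  fixes those at zero.  The gap is closed by the fact that linear morphisms are additive
  (\<open>linear_additive\<close>): as \<open>\<langle>k, e\<rangle> \<xi>\<close> is the sum over \<open>T M\<close> of the vector \<open>k l\<close> and the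
  zero vector at \<open>e\<close>, it is sent to \<open>k l K + 0 = k\<close> by \<open>K\<close> (\<open>K_vert\<close>).  The remaining axioms translate directly.

  The axioms for an Ehresmann connection in the tangent category of differential bundles consist
  of a part on total spaces, which is the same as in \<open>C\<close>, the linearity of \<open>R\<close> and \<open>H\<close>, and a part on
  bases, which determines the base components.  To see this, the
  pullbacks in that category are computed componentwise (\<open>DB_tangent_pullbackI\<close>), and the bundles
  that occur are shown to be display differential bundles: \<open>T q\<close>, the pullbacks of \<open>q\<close> and \<open>T q\<close>, the
  trivial bundle, and \<open>T\<^sub>2 q\<close>.  The last one is delicate, as it is not clear from the construction
  that \<open>T\<^sub>2 q : T\<^sub>2 E \<rightarrow> T\<^sub>2 M\<close> is a tangent display map.  Here the connection itself helps.  By \<open>K\<close> and \<open>H\<close> the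
  tangent bundle splits, \<open>T E\<close> is the fibre product of \<open>E\<close> and \<open>F q\<close> over \<open>M\<close> (\<open>koszul_decomposition\<close>), so
  \<open>\<pi>\<^sub>q : T E \<rightarrow> F q\<close> is a pullback of \<open>q\<close>; and \<open>T\<^sub>2 q\<close> is composed of a pullback of \<open>\<pi>\<^sub>q\<close> and a pullback of \<open>T q\<close>
  (\<open>T2_display\<close>).
\<close>

section \<open>Categories and pullbacks\<close>

locale cat =
  fixes C :: "('o, 'm) tcat" (structure)
  assumes cat: "category C"
begin

lemma hom_iff: "f \<in> hom C A B \<longleftrightarrow> f \<in> arr C \<and> src C f = A \<and> tgt C f = B"
  by (simp add: hom_def)

lemma obj_simps [simp]: "f \<in> arr C \<Longrightarrow> src C f \<in> obj C" "f \<in> arr C \<Longrightarrow> tgt C f \<in> obj C"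
  using cat by (auto simp: category_def)

lemma ident_simps [simp]:
  assumes "A \<in> obj C"
  shows "ident C A \<in> arr C" "src C (ident C A) = A" "tgt C (ident C A) = A"
  using cat assms by (auto simp: category_def hom_def)

lemma comp_simps [simp]:
  assumes "f \<in> arr C" "g \<in> arr C" "tgt C f = src C g"
  shows "f \<cdot> g \<in> arr C" "src C (f \<cdot> g) = src C f" "tgt C (f \<cdot> g) = tgt C g"
  using cat assms by (auto simp: category_def hom_def)

lemma ident_comp [simp]:
  "f \<in> arr C \<Longrightarrow> src C f = A \<Longrightarrow> ident C A \<cdot> f = f"
  "f \<in> arr C \<Longrightarrow> tgt C f = B \<Longrightarrow> f \<cdot> ident C B = f"
  using cat by (auto simp: category_def)

lemma assoc [simp]:
  assumes "f \<in> arr C" "g \<in> arr C" "h \<in> arr C" "tgt C f = src C g" "tgt C g = src C h"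
  shows "f \<cdot> g \<cdot> h = f \<cdot> (g \<cdot> h)"
  using cat assms by (simp add: category_def)

text \<open>Composites are kept in right-associated form; this carries an equation between composites to
  the start of a longer composite.\<close>

lemma reassoc:
  assumes "x \<cdot> y = z" "x \<in> arr C" "y \<in> arr C" "tgt C x = src C y" "w \<in> arr C" "tgt C y = src C w"
  shows "x \<cdot> (y \<cdot> w) = z \<cdot> w"
  using assms assoc by metis

lemma reassoc2:
  assumes "x \<cdot> y = x' \<cdot> y'" "x \<in> arr C" "y \<in> arr C" "tgt C x = src C y"
    "x' \<in> arr C" "y' \<in> arr C" "tgt C x' = src C y'" "w \<in> arr C" "tgt C y = src C w"
  shows "x \<cdot> (y \<cdot> w) = x' \<cdot> (y' \<cdot> w)"
  using assms assoc by (metis comp_simps(3))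

lemma pb_simps:
  assumes "is_pullback C f g a b"
  shows "f \<in> arr C" "g \<in> arr C" "a \<in> arr C" "b \<in> arr C"
    "tgt C g = tgt C f" "src C b = src C a" "tgt C a = src C f" "tgt C b = src C g"
  using assms by (auto simp: is_pullback_def)

lemma pb_comm: "is_pullback C f g a b \<Longrightarrow> a \<cdot> f = b \<cdot> g"
  by (auto simp: is_pullback_def)

lemma pb_ex1:
  assumes "is_pullback C f g a b" "x \<in> arr C" "y \<in> arr C" "src C y = src C x"
    "tgt C x = src C f" "tgt C y = src C g" "x \<cdot> f = y \<cdot> g"
  shows "\<exists>!h. h \<in> hom C (src C x) (src C a) \<and> h \<cdot> a = x \<and> h \<cdot> b = y"
proof -
  have "\<forall>X\<in>obj C. \<forall>x\<in>hom C X (src C f). \<forall>y\<in>hom C X (src C g). x \<cdot> f = y \<cdot> g \<longrightarrow>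
        (\<exists>!h. h \<in> hom C X (src C a) \<and> h \<cdot> a = x \<and> h \<cdot> b = y)"
    using assms(1) unfolding is_pullback_def by blast
  moreover have "x \<in> hom C (src C x) (src C f)" "y \<in> hom C (src C x) (src C g)"
    using assms by (auto simp: hom_def)
  ultimately show ?thesis using assms(2,7) obj_simps(1) by blast
qed

lemma pair_props:
  assumes "is_pullback C f g a b" "x \<in> arr C" "y \<in> arr C" "src C y = src C x"
    "tgt C x = src C f" "tgt C y = src C g" "x \<cdot> f = y \<cdot> g"
  shows "pair C a b x y \<in> arr C" "src C (pair C a b x y) = src C x"
    "tgt C (pair C a b x y) = src C a"
    "pair C a b x y \<cdot> a = x" "pair C a b x y \<cdot> b = y"
proof -
  let ?h = "pair C a b x y"
  have "?h \<in> hom C (src C x) (src C a) \<and> ?h \<cdot> a = x \<and> ?h \<cdot> b = y"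
    unfolding pair_def by (rule theI') (rule pb_ex1[OF assms])
  then show "?h \<in> arr C" "src C ?h = src C x" "tgt C ?h = src C a" "?h \<cdot> a = x" "?h \<cdot> b = y"
    by (auto simp: hom_def)
qed

lemma pb_eqI:
  assumes "is_pullback C f g a b" "h \<in> arr C" "k \<in> arr C" "src C h = src C k"
    "tgt C h = src C a" "tgt C k = src C a" "h \<cdot> a = k \<cdot> a" "h \<cdot> b = k \<cdot> b"
  shows "h = k"
proof -
  note [simp] = pb_simps[OF assms(1)]
  let ?P = "\<lambda>u. u \<in> hom C (src C (k \<cdot> a)) (src C a) \<and> u \<cdot> a = k \<cdot> a \<and> u \<cdot> b = k \<cdot> b"
  have "\<exists>!u. ?P u"
    by (rule pb_ex1[OF assms(1)]) (simp_all add: assms(3,6) pb_comm[OF assms(1)])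
  moreover have "?P h" "?P k" by (simp_all add: hom_iff assms)
  ultimately show ?thesis by blast
qed

lemma pair_eqI:
  assumes "is_pullback C f g a b" "h \<in> arr C" "src C h = src C x" "tgt C h = src C a"
    "h \<cdot> a = x" "h \<cdot> b = y"
  shows "pair C a b x y = h"
proof -
  note [simp] = pb_simps[OF assms(1)]
  note h = assms(2,4)
  have *: "x \<in> arr C" "y \<in> arr C" "src C y = src C x" "tgt C x = src C f" "tgt C y = src C g"
    unfolding assms(5,6)[symmetric] using h by simp_all
  have **: "x \<cdot> f = y \<cdot> g"
    unfolding assms(5,6)[symmetric] using h pb_comm[OF assms(1)] by simp
  note P = pair_props[OF assms(1) * **]
  show ?thesis
    by (rule pb_eqI[OF assms(1)]) (use P assms in simp_all)
qed

lemma comp_pair: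
  assumes "is_pullback C f g a b" "x \<in> arr C" "y \<in> arr C" "src C y = src C x"
    "tgt C x = src C f" "tgt C y = src C g" "x \<cdot> f = y \<cdot> g" "u \<in> arr C" "tgt C u = src C x"
  shows "u \<cdot> pair C a b x y = pair C a b (u \<cdot> x) (u \<cdot> y)"
proof -
  note P = pair_props[OF assms(1-7)] and [simp] = pb_simps[OF assms(1)]
  show ?thesis
    by (rule pair_eqI[OF assms(1), symmetric]) (use P assms in simp_all)
qed

lemma pullbackI:
  assumes "f \<in> arr C" "g \<in> arr C" "a \<in> arr C" "b \<in> arr C"
    "tgt C f = tgt C g" "src C a = src C b" "tgt C a = src C f" "tgt C b = src C g" "a \<cdot> f = b \<cdot> g"
    and ex: "\<And>x y. x \<in> arr C \<Longrightarrow> y \<in> arr C \<Longrightarrow> src C y = src C x \<Longrightarrow> tgt C x = src C f \<Longrightarrow>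
      tgt C y = src C g \<Longrightarrow> x \<cdot> f = y \<cdot> g \<Longrightarrow>
      \<exists>h\<in>arr C. src C h = src C x \<and> tgt C h = src C a \<and> h \<cdot> a = x \<and> h \<cdot> b = y"
    and un: "\<And>h k. h \<in> arr C \<Longrightarrow> k \<in> arr C \<Longrightarrow> src C h = src C k \<Longrightarrow> tgt C h = src C a \<Longrightarrow>
      tgt C k = src C a \<Longrightarrow> h \<cdot> a = k \<cdot> a \<Longrightarrow> h \<cdot> b = k \<cdot> b \<Longrightarrow> h = k"
  shows "is_pullback C f g a b"
proof -
  have "\<exists>!h. h \<in> hom C X (src C a) \<and> h \<cdot> a = x \<and> h \<cdot> b = y"
    if hyp: "x \<in> hom C X (src C f)" "y \<in> hom C X (src C g)" "x \<cdot> f = y \<cdot> g" for X x y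
  proof -
    have x: "x \<in> arr C" "y \<in> arr C" "src C y = src C x" "tgt C x = src C f" "tgt C y = src C g"
      and X: "X = src C x"
      using hyp by (auto simp: hom_iff)
    obtain h where h0: "h \<in> arr C"
        "src C h = src C x \<and> tgt C h = src C a \<and> h \<cdot> a = x \<and> h \<cdot> b = y"
      using ex[OF x hyp(3)] by (rule bexE)
    note h = h0(1) conjunct1[OF h0(2)] conjunct1[OF conjunct2[OF h0(2)]]
      conjunct1[OF conjunct2[OF conjunct2[OF h0(2)]]] conjunct2[OF conjunct2[OF conjunct2[OF h0(2)]]]
    show ?thesis
    proof (rule ex1I[of _ h])
      show "h \<in> hom C X (src C a) \<and> h \<cdot> a = x \<and> h \<cdot> b = y"
        unfolding hom_iff X using h by blast
      fix k assume "k \<in> hom C X (src C a) \<and> k \<cdot> a = x \<and> k \<cdot> b = y"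
      then have k: "k \<in> arr C" "src C k = src C h" "tgt C k = src C a" "k \<cdot> a = h \<cdot> a" "k \<cdot> b = h \<cdot> b"
        unfolding hom_iff X h(2,4,5) by blast+
      show "k = h" by (rule un[OF k(1) h(1) k(2,3) h(3) k(4,5)])
    qed
  qed
  with assms(1-9) show ?thesis
    by (auto simp: is_pullback_def)
qed

lemma pb_sym:
  assumes "is_pullback C f g a b"
  shows "is_pullback C g f b a"
proof (rule pullbackI)
  note [simp] = pb_simps[OF assms]
  fix x y assume *: "x \<in> arr C" "y \<in> arr C" "src C y = src C x" "tgt C x = src C g"
    "tgt C y = src C f" "x \<cdot> g = y \<cdot> f"
  have "y \<cdot> f = x \<cdot> g" using * by simp
  note P = pair_props[OF assms *(2) *(1) *(3)[symmetric] *(5) *(4) this]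
  show "\<exists>h\<in>arr C. src C h = src C x \<and> tgt C h = src C b \<and> h \<cdot> b = x \<and> h \<cdot> a = y"
    by (rule bexI[of _ "pair C a b y x"]) (use P * in simp_all)
qed (use pb_simps[OF assms] pb_comm[OF assms] pb_eqI[OF assms] in simp_all)

text \<open>The pasting law: two pullback squares side by side make a pullback rectangle, and conversely a
  square that completes a pullback square to a pullback rectangle is itself a pullback.\<close>

lemma pb_paste:
  assumes 1: "is_pullback C f g a b" and 2: "is_pullback C b h c d"
  shows "is_pullback C f (h \<cdot> g) (c \<cdot> a) d"
proof (rule pullbackI)
  note [simp] = pb_simps[OF 1] pb_simps[OF 2]
  note [simp] = reassoc2[OF pb_comm[OF 1]] reassoc2[OF pb_comm[OF 2]]
  show "(c \<cdot> a) \<cdot> f = d \<cdot> (h \<cdot> g)" using pb_comm[OF 1] pb_comm[OF 2] by simp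
  fix x y assume *[simp]: "x \<in> arr C" "y \<in> arr C" "src C y = src C x" "tgt C x = src C f"
    "tgt C y = src C (h \<cdot> g)" "x \<cdot> f = y \<cdot> (h \<cdot> g)"
  note P[simp] = pair_props[OF 1, of x "y \<cdot> h", simplified]
  note R[simp] = pair_props[OF 2, of "pair C a b x (y \<cdot> h)" y, simplified]
  show "\<exists>k\<in>arr C. src C k = src C x \<and> tgt C k = src C (c \<cdot> a) \<and> k \<cdot> (c \<cdot> a) = x \<and> k \<cdot> d = y"
    by (rule bexI[of _ "pair C c d (pair C a b x (y \<cdot> h)) y"])
      (simp_all add: reassoc[OF R(4)])
next
  note [simp] = pb_simps[OF 1] pb_simps[OF 2]
  fix k k' assume *: "k \<in> arr C" "k' \<in> arr C" "src C k = src C k'" "tgt C k = src C (c \<cdot> a)"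
    "tgt C k' = src C (c \<cdot> a)" "k \<cdot> (c \<cdot> a) = k' \<cdot> (c \<cdot> a)" "k \<cdot> d = k' \<cdot> d"
  have kc: "k \<cdot> c = k' \<cdot> c"
  proof (rule pb_eqI[OF 1])
    have "k \<cdot> (d \<cdot> h) = k' \<cdot> (d \<cdot> h)"
      by (rule reassoc2[OF *(7)]) (use * in simp_all)
    then show "(k \<cdot> c) \<cdot> b = (k' \<cdot> c) \<cdot> b" using * pb_comm[OF 2] by simp
  qed (use * in simp_all)
  show "k = k'"
    by (rule pb_eqI[OF 2]) (use * kc in simp_all)
qed (use pb_simps[OF 1] pb_simps[OF 2] in simp_all)

lemma pb_cancel:
  assumes 1: "is_pullback C f g a b" and 2: "is_pullback C f (h \<cdot> g) e d"
    and h: "h \<in> arr C" "tgt C h = src C g"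
    and c: "c \<in> arr C" "src C c = src C e" "tgt C c = src C a" "c \<cdot> a = e" "c \<cdot> b = d \<cdot> h"
  shows "is_pullback C b h c d"
proof (rule pullbackI)
  note [simp] = pb_simps[OF 1] pb_simps[OF 2] h c
  note [simp] = reassoc[OF c(4)] reassoc2[OF c(5)]
  have [simp]: "tgt C d = src C h" using pb_simps(8)[OF 2] by simp
  fix x y assume *[simp]: "x \<in> arr C" "y \<in> arr C" "src C y = src C x" "tgt C x = src C b"
    "tgt C y = src C h" "x \<cdot> b = y \<cdot> h"
  have "x \<cdot> (a \<cdot> f) = x \<cdot> b \<cdot> g" by (simp add: pb_comm[OF 1] del: *(6))
  then have **: "x \<cdot> (a \<cdot> f) = y \<cdot> (h \<cdot> g)" by simp
  note P[simp] = pair_props[OF 2, of "x \<cdot> a" y, simplified, OF **]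
  show "\<exists>k\<in>arr C. src C k = src C x \<and> tgt C k = src C c \<and> k \<cdot> c = x \<and> k \<cdot> d = y"
  proof (rule bexI[of _ "pair C e d (x \<cdot> a) y"])
    let ?k = "pair C e d (x \<cdot> a) y"
    have "?k \<cdot> c = x"
      by (rule pb_eqI[OF 1]) (simp_all add: reassoc[OF P(5)])
    then show "src C ?k = src C x \<and> tgt C ?k = src C c \<and> ?k \<cdot> c = x \<and> ?k \<cdot> d = y" by simp
  qed simp
next
  note [simp] = pb_simps[OF 1] pb_simps[OF 2] h c
  fix k k' assume *: "k \<in> arr C" "k' \<in> arr C" "src C k = src C k'" "tgt C k = src C c"
    "tgt C k' = src C c" "k \<cdot> c = k' \<cdot> c" "k \<cdot> d = k' \<cdot> d"
  have kca: "k \<cdot> (c \<cdot> a) = k' \<cdot> (c \<cdot> a)"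
    by (rule reassoc2[OF *(6)]) (use * in simp_all)
  show "k = k'"
    by (rule pb_eqI[OF 2]) (use * kca in simp_all)
qed (use pb_simps[OF 1] pb_simps[OF 2] h c in simp_all)

text \<open>Pasting with such a square replaces two corners of a pullback by isomorphic objects.\<close>

lemma pb_iso:
  assumes [simp]: "f \<in> arr C" "g \<in> arr C" "a \<in> arr C" "b \<in> arr C"
    "tgt C f = tgt C g" "src C a = src C b" "tgt C a = src C f" "tgt C b = src C g"
    and comm: "a \<cdot> f = b \<cdot> g"
    and [simp]: "a' \<in> arr C" "src C a' = tgt C a" "tgt C a' = src C a"
      "a \<cdot> a' = ident C (src C a)" "a' \<cdot> a = ident C (tgt C a)"
    and [simp]: "g' \<in> arr C" "src C g' = tgt C g" "tgt C g' = src C g" "g \<cdot> g' = ident C (src C g)"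
  shows "is_pullback C f g a b"
proof (rule pullbackI)
  fix x y assume *[simp]: "x \<in> arr C" "y \<in> arr C" "src C y = src C x" "tgt C x = src C f"
    "tgt C y = src C g" "x \<cdot> f = y \<cdot> g"
  note [simp] = reassoc[OF assms(14)] reassoc2[OF *(6)]
  have bb: "b = a \<cdot> f \<cdot> g'" by (simp add: comm)
  have "x \<cdot> (a' \<cdot> b) = y" unfolding bb by simp
  then show "\<exists>k\<in>arr C. src C k = src C x \<and> tgt C k = src C a \<and> k \<cdot> a = x \<and> k \<cdot> b = y"
    by (intro bexI[of _ "x \<cdot> a'"]) simp_all
next
  fix h k assume *: "h \<in> arr C" "k \<in> arr C" "src C h = src C k" "tgt C h = src C a"
    "tgt C k = src C a" "h \<cdot> a = k \<cdot> a"
  have "h \<cdot> (a \<cdot> a') = k \<cdot> (a \<cdot> a')"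
    by (rule reassoc2[OF *(6)]) (use * in simp_all)
  with * show "h = k" by simp
qed (use assms in simp_all)

lemma pb_along_ident:
  assumes "f \<in> arr C"
  shows "is_pullback C f (ident C (tgt C f)) (ident C (src C f)) f"
  by (rule pb_iso[where a' = "ident C (src C f)" and g' = "ident C (tgt C f)"]) (use assms in simp_all)

end

section \<open>Fibrewise addition\<close>

lemma T_bundle_sel [simp]:
  "bproj (T_bundle C Q) = tarr C (bproj Q)" "bzero (T_bundle C Q) = tarr C (bzero Q)"
  "bp1 (T_bundle C Q) = tarr C (bp1 Q)" "bp2 (T_bundle C Q) = tarr C (bp2 Q)"
  "bsum (T_bundle C Q) = tarr C (bsum Q)"
  "blift (T_bundle C Q) = comp C (tarr C (blift Q)) (tc C (total C Q))"
  by (simp_all add: T_bundle_def)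

lemma tangent_bundle_sel [simp]:
  "bproj (tangent_bundle C M) = tp C M" "bzero (tangent_bundle C M) = tz C M"
  "bp1 (tangent_bundle C M) = tw1 C M" "bp2 (tangent_bundle C M) = tw2 C M"
  "bsum (tangent_bundle C M) = ts C M" "blift (tangent_bundle C M) = tl C M"
  by (simp_all add: tangent_bundle_def)

text \<open>The part of the structure of an additive bundle that gives meaning to \<open>fsum\<close>.  It is separated from
  the monoid laws because \<open>T Q\<close> is known to have it before its laws have been proved.\<close>

definition fibred_magma :: "('o, 'm) tcat \<Rightarrow> 'm bundle_data \<Rightarrow> bool" where
  "fibred_magma C Q \<longleftrightarrow>
     is_pullback C (bproj Q) (bproj Q) (bp1 Q) (bp2 Q) \<and>
     bsum Q \<in> hom C (fibre2 C Q) (total C Q) \<and>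
     comp C (bsum Q) (bproj Q) = comp C (bp1 Q) (bproj Q)"

lemma (in cat) fibred_magma_simps:
  assumes "fibred_magma C Q"
  shows "bproj Q \<in> arr C" "src C (bproj Q) = total C Q" "tgt C (bproj Q) = base C Q"
    "bp1 Q \<in> arr C" "src C (bp1 Q) = fibre2 C Q" "tgt C (bp1 Q) = total C Q"
    "bp2 Q \<in> arr C" "src C (bp2 Q) = fibre2 C Q" "tgt C (bp2 Q) = total C Q"
    "bsum Q \<in> arr C" "src C (bsum Q) = fibre2 C Q" "tgt C (bsum Q) = total C Q"
    "bsum Q \<cdot> bproj Q = bp1 Q \<cdot> bproj Q" "bp2 Q \<cdot> bproj Q = bp1 Q \<cdot> bproj Q"
    "total C Q \<in> obj C" "base C Q \<in> obj C" "fibre2 C Q \<in> obj C"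
  using assms unfolding fibred_magma_def total_def base_def fibre2_def hom_iff
  by (auto dest: pb_simps pb_comm)

lemma (in cat) fibred_magma_pullback:
  "fibred_magma C Q \<Longrightarrow> is_pullback C (bproj Q) (bproj Q) (bp1 Q) (bp2 Q)"
  by (simp add: fibred_magma_def)

lemma (in cat) fsum_simps:
  assumes "fibred_magma C Q"
    and "x \<in> arr C" "y \<in> arr C" "src C y = src C x" "tgt C x = total C Q" "tgt C y = total C Q"
    and "x \<cdot> bproj Q = y \<cdot> bproj Q"
  shows "fsum C Q x y \<in> arr C" "src C (fsum C Q x y) = src C x" "tgt C (fsum C Q x y) = total C Q"
    "fsum C Q x y \<cdot> bproj Q = x \<cdot> bproj Q"
proof -
  note [simp] = fibred_magma_simps[OF assms(1)] assms(2-6)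
  note P [simp] = pair_props[OF fibred_magma_pullback[OF assms(1)], of x y, simplified, OF assms(7)]
  show "fsum C Q x y \<in> arr C" "src C (fsum C Q x y) = src C x" "tgt C (fsum C Q x y) = total C Q"
    "fsum C Q x y \<cdot> bproj Q = x \<cdot> bproj Q"
    by (simp_all add: fsum_def reassoc[OF P(4)])
qed

lemma (in cat) comp_fsum:
  assumes "fibred_magma C Q"
    and "x \<in> arr C" "y \<in> arr C" "src C y = src C x" "tgt C x = total C Q" "tgt C y = total C Q"
    and "x \<cdot> bproj Q = y \<cdot> bproj Q" and "u \<in> arr C" "tgt C u = src C x"
  shows "u \<cdot> fsum C Q x y = fsum C Q (u \<cdot> x) (u \<cdot> y)"
proof -
  note [simp] = fibred_magma_simps[OF assms(1)] assms(2-6) assms(8,9)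
  note [simp] = pair_props[OF fibred_magma_pullback[OF assms(1)], of x y, simplified, OF assms(7)]
  show ?thesis
    by (simp add: fsum_def comp_pair[OF fibred_magma_pullback[OF assms(1)], symmetric] assms(7))
qed

lemma (in cat) fsum_comp:
  assumes am: "additive_morphism C Q Q' f g" and Q: "fibred_magma C Q" and Q': "fibred_magma C Q'"
    and "x \<in> arr C" "y \<in> arr C" "src C y = src C x" "tgt C x = total C Q" "tgt C y = total C Q"
    and "x \<cdot> bproj Q = y \<cdot> bproj Q"
  shows "fsum C Q x y \<cdot> g = fsum C Q' (x \<cdot> g) (y \<cdot> g)"
proof -
  note [simp] = fibred_magma_simps[OF Q] fibred_magma_simps[OF Q'] assms(4-8)
  have [simp]: "f \<in> arr C" "src C f = base C Q" "tgt C f = base C Q'"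
    "g \<in> arr C" "src C g = total C Q" "tgt C g = total C Q'"
    using am by (simp_all add: additive_morphism_def hom_iff)
  have sq: "g \<cdot> bproj Q' = bproj Q \<cdot> f" and s: "bsum Q \<cdot> g = fsum C Q' (bp1 Q \<cdot> g) (bp2 Q \<cdot> g)"
    using am by (simp_all add: additive_morphism_def)
  note P [simp] = pair_props[OF fibred_magma_pullback[OF Q], of x y, simplified, OF assms(9)]
  have "bp1 Q \<cdot> (g \<cdot> bproj Q') = bp2 Q \<cdot> (g \<cdot> bproj Q')"
    by (simp add: sq reassoc[OF fibred_magma_simps(14)[OF Q]])
  then have "pair C (bp1 Q) (bp2 Q) x y \<cdot> fsum C Q' (bp1 Q \<cdot> g) (bp2 Q \<cdot> g) =
    fsum C Q' (pair C (bp1 Q) (bp2 Q) x y \<cdot> (bp1 Q \<cdot> g)) (pair C (bp1 Q) (bp2 Q) x y \<cdot> (bp2 Q \<cdot> g))"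
    by (intro comp_fsum[OF Q']) simp_all
  also have "\<dots> = fsum C Q' (x \<cdot> g) (y \<cdot> g)"
    by (simp add: reassoc[OF P(4)] reassoc[OF P(5)])
  finally show ?thesis by (simp add: fsum_def[of C Q] s)
qed

lemma (in cat) additive_bundle_magma: "additive_bundle C Q \<Longrightarrow> fibred_magma C Q"
  by (simp add: additive_bundle_def fibred_magma_def)

lemma (in cat) additive_bundle_zero:
  assumes "additive_bundle C Q"
  shows "bzero Q \<in> arr C" "src C (bzero Q) = base C Q" "tgt C (bzero Q) = total C Q"
    "bzero Q \<cdot> bproj Q = ident C (base C Q)"
  using assms by (simp_all add: additive_bundle_def hom_iff)

lemma (in cat) fsum_laws:
  assumes "additive_bundle C Q" "x \<in> arr C" "tgt C x = total C Q"
  shows fsum_zero_right: "fsum C Q x (x \<cdot> (bproj Q \<cdot> bzero Q)) = x"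
    and fsum_commute: "y \<in> arr C \<Longrightarrow> src C y = src C x \<Longrightarrow> tgt C y = total C Q \<Longrightarrow>
      x \<cdot> bproj Q = y \<cdot> bproj Q \<Longrightarrow> fsum C Q x y = fsum C Q y x"
    and fsum_assoc: "y \<in> arr C \<Longrightarrow> src C y = src C x \<Longrightarrow> tgt C y = total C Q \<Longrightarrow>
      w \<in> arr C \<Longrightarrow> src C w = src C x \<Longrightarrow> tgt C w = total C Q \<Longrightarrow>
      x \<cdot> bproj Q = y \<cdot> bproj Q \<Longrightarrow> y \<cdot> bproj Q = w \<cdot> bproj Q \<Longrightarrow>
      fsum C Q (fsum C Q x y) w = fsum C Q x (fsum C Q y w)"
proof -
  note [simp] = fibred_magma_simps[OF additive_bundle_magma[OF assms(1)]]
    additive_bundle_zero[OF assms(1)] assms(2,3)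
  note A = assms(1)[unfolded additive_bundle_def]
  have x: "x \<in> hom C (src C x) (total C Q)" and X: "src C x \<in> obj C" by (simp_all add: hom_iff)
  have "fsum C Q x (x \<cdot> bproj Q \<cdot> bzero Q) = x" using A x X by blast
  then show "fsum C Q x (x \<cdot> (bproj Q \<cdot> bzero Q)) = x" by simp
  show "fsum C Q x y = fsum C Q y x"
    if "y \<in> arr C" "src C y = src C x" "tgt C y = total C Q" "x \<cdot> bproj Q = y \<cdot> bproj Q"
  proof -
    have "y \<in> hom C (src C x) (total C Q)" using that by (simp add: hom_iff)
    then show ?thesis using A x X that by blast
  qed
  show "fsum C Q (fsum C Q x y) w = fsum C Q x (fsum C Q y w)"
    if "y \<in> arr C" "src C y = src C x" "tgt C y = total C Q"
      "w \<in> arr C" "src C w = src C x" "tgt C w = total C Q"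
      "x \<cdot> bproj Q = y \<cdot> bproj Q" "y \<cdot> bproj Q = w \<cdot> bproj Q"
  proof -
    have "y \<in> hom C (src C x) (total C Q)" "w \<in> hom C (src C x) (total C Q)"
      using that by (simp_all add: hom_iff)
    then show ?thesis using A x X that by blast
  qed
qed

lemma (in cat) fsum_zero_left:
  assumes "additive_bundle C Q" "x \<in> arr C" "tgt C x = total C Q"
  shows "fsum C Q (x \<cdot> (bproj Q \<cdot> bzero Q)) x = x"
proof -
  note [simp] = fibred_magma_simps[OF additive_bundle_magma[OF assms(1)]]
    additive_bundle_zero[OF assms(1)] assms(2,3)
  show ?thesis
    using fsum_commute[OF assms, of "x \<cdot> (bproj Q \<cdot> bzero Q)"] fsum_zero_right[OF assms] by simp
qed

section \<open>Tangent pullbacks and tangent display maps\<close>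

locale tangent_cat =
  fixes C :: "('o, 'm) tcat" (structure)
  assumes tangent: "tangent_category C"

sublocale tangent_cat \<subseteq> cat
  using tangent by (unfold_locales) (simp add: tangent_category_def)

context tangent_cat
begin

abbreviation T :: "'m \<Rightarrow> 'm" where "T \<equiv> tarr C"
abbreviation Tm :: "nat \<Rightarrow> 'm \<Rightarrow> 'm" where "Tm m \<equiv> tarr C ^^ m"

lemma endo: "endofunctor C"
  using tangent by (simp add: tangent_category_def)

lemma tobj_obj [simp]: "A \<in> obj C \<Longrightarrow> tobj C A \<in> obj C"
  using endo by (simp add: endofunctor_def)

lemma T_simps [simp]:
  assumes "f \<in> arr C"
  shows "T f \<in> arr C" "src C (T f) = tobj C (src C f)" "tgt C (T f) = tobj C (tgt C f)"
  using endo assms by (simp_all add: endofunctor_def hom_iff)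

lemma T_ident [simp]: "A \<in> obj C \<Longrightarrow> T (ident C A) = ident C (tobj C A)"
  using endo by (simp add: endofunctor_def)

lemma T_comp [simp]: "f \<in> arr C \<Longrightarrow> g \<in> arr C \<Longrightarrow> tgt C f = src C g \<Longrightarrow> T (f \<cdot> g) = T f \<cdot> T g"
  using endo by (simp add: endofunctor_def)

lemma Tm_obj [simp]: "A \<in> obj C \<Longrightarrow> (tobj C ^^ m) A \<in> obj C"
  by (induction m) simp_all

lemma Tm_simps [simp]:
  assumes "f \<in> arr C"
  shows "Tm m f \<in> arr C" "src C (Tm m f) = (tobj C ^^ m) (src C f)"
    "tgt C (Tm m f) = (tobj C ^^ m) (tgt C f)"
  using assms by (induction m) simp_all

lemma Tm_ident [simp]: "A \<in> obj C \<Longrightarrow> Tm m (ident C A) = ident C ((tobj C ^^ m) A)"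
  by (induction m) simp_all

lemma Tm_comp [simp]: "f \<in> arr C \<Longrightarrow> g \<in> arr C \<Longrightarrow> tgt C f = src C g \<Longrightarrow> Tm m (f \<cdot> g) = Tm m f \<cdot> Tm m g"
  by (induction m) simp_all

lemma Tm_Tm: "Tm m (Tm n f) = Tm (n + m) f"
  by (metis add.commute comp_apply funpow_add)

lemma tpb_pullback:
  assumes "tangent_pullback C f g a b"
  shows "is_pullback C f g a b"
proof -
  have "is_pullback C (Tm 0 f) (Tm 0 g) (Tm 0 a) (Tm 0 b)"
    using assms unfolding tangent_pullback_def by blast
  then show ?thesis by simp
qed

lemmas tpb_simps = pb_simps[OF tpb_pullback]
lemmas tpb_comm = pb_comm[OF tpb_pullback]

lemma tpb_Tm:
  assumes "tangent_pullback C f g a b"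
  shows "tangent_pullback C (Tm n f) (Tm n g) (Tm n a) (Tm n b)"
  using assms unfolding tangent_pullback_def Tm_Tm by blast

lemma tpb_T:
  assumes "tangent_pullback C f g a b"
  shows "tangent_pullback C (T f) (T g) (T a) (T b)"
  using tpb_Tm[OF assms, of 1] by simp

lemma tpb_sym:
  assumes "tangent_pullback C f g a b"
  shows "tangent_pullback C g f b a"
  using assms unfolding tangent_pullback_def by (blast intro: pb_sym)

lemma tpb_paste:
  assumes 1: "tangent_pullback C f g a b" and 2: "tangent_pullback C b h c d"
  shows "tangent_pullback C f (h \<cdot> g) (c \<cdot> a) d"
  unfolding tangent_pullback_def
proof
  fix m
  note [simp] = tpb_simps[OF 1] tpb_simps[OF 2]
  have "is_pullback C (Tm m f) (Tm m h \<cdot> Tm m g) (Tm m c \<cdot> Tm m a) (Tm m d)"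
    using pb_paste assms unfolding tangent_pullback_def by blast
  then show "is_pullback C (Tm m f) (Tm m (h \<cdot> g)) (Tm m (c \<cdot> a)) (Tm m d)" by simp
qed

text \<open>The same with the squares stacked along the other side.\<close>

lemma tpb_paste':
  assumes 1: "tangent_pullback C f g a b" and 2: "tangent_pullback C h a c d"
  shows "tangent_pullback C (h \<cdot> f) g c (d \<cdot> b)"
  using tpb_sym[OF tpb_paste[OF tpb_sym[OF 1] tpb_sym[OF 2]]] .

lemma tpb_cancel:
  assumes 1: "tangent_pullback C f g a b" and 2: "tangent_pullback C f (h \<cdot> g) e d"
    and h: "h \<in> arr C" "tgt C h = src C g"
    and c: "c \<in> arr C" "src C c = src C e" "tgt C c = src C a" "c \<cdot> a = e" "c \<cdot> b = d \<cdot> h"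
  shows "tangent_pullback C b h c d"
  unfolding tangent_pullback_def
proof
  fix m
  note [simp] = tpb_simps[OF 1] tpb_simps(1-7)[OF 2] h c(1-3)
  have [simp]: "tgt C d = src C h" using tpb_simps(8)[OF 2] by simp
  have 2: "is_pullback C (Tm m f) (Tm m h \<cdot> Tm m g) (Tm m e) (Tm m d)"
    using 2[unfolded tangent_pullback_def, rule_format, of m] by simp
  show "is_pullback C (Tm m b) (Tm m h) (Tm m c) (Tm m d)"
    by (rule pb_cancel[OF 1[unfolded tangent_pullback_def, rule_format] 2])
      (simp_all add: Tm_comp[symmetric] c(4,5) del: Tm_comp)
qed

lemma tpb_iso:
  assumes [simp]: "f \<in> arr C" "g \<in> arr C" "a \<in> arr C" "b \<in> arr C"
    "tgt C f = tgt C g" "src C a = src C b" "tgt C a = src C f" "tgt C b = src C g"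
    and comm: "a \<cdot> f = b \<cdot> g"
    and [simp]: "a' \<in> arr C" "src C a' = tgt C a" "tgt C a' = src C a"
      "a \<cdot> a' = ident C (src C a)" "a' \<cdot> a = ident C (tgt C a)"
    and [simp]: "g' \<in> arr C" "src C g' = tgt C g" "tgt C g' = src C g" "g \<cdot> g' = ident C (src C g)"
  shows "tangent_pullback C f g a b"
  unfolding tangent_pullback_def
proof
  fix m
  have "Tm m a \<cdot> Tm m f = Tm m b \<cdot> Tm m g" "Tm m a \<cdot> Tm m a' = ident C ((tobj C ^^ m) (src C a))"
    "Tm m a' \<cdot> Tm m a = ident C ((tobj C ^^ m) (tgt C a))"
    "Tm m g \<cdot> Tm m g' = ident C ((tobj C ^^ m) (src C g))"
    using comm by (simp_all add: Tm_comp[symmetric] del: Tm_comp)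
  then show "is_pullback C (Tm m f) (Tm m g) (Tm m a) (Tm m b)"
    by (intro pb_iso[where a' = "Tm m a'" and g' = "Tm m g'"]) simp_all
qed

lemma tpb_along_ident:
  assumes "f \<in> arr C"
  shows "tangent_pullback C f (ident C (tgt C f)) (ident C (src C f)) f"
  unfolding tangent_pullback_def
  using pb_along_ident[of "Tm _ f"] assms by simp

lemma tpb_of_ident:
  assumes "g \<in> arr C"
  shows "tangent_pullback C (ident C (tgt C g)) g g (ident C (src C g))"
  by (rule tpb_sym[OF tpb_along_ident[OF assms]])

lemma display_arr: "tangent_display C q \<Longrightarrow> q \<in> arr C"
  by (simp add: tangent_display_def)

lemma displayD:
  assumes "tangent_display C q" "f \<in> arr C" "tgt C f = (tobj C ^^ n) (tgt C q)"
  obtains a b where "tangent_pullback C (Tm n q) f a b"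
  using assms unfolding tangent_display_def by blast

text \<open>By pasting, a pullback of \<open>T\<^sup>n b\<close> along \<open>g\<close> is a pullback of \<open>T\<^sup>n q\<close> along the composite of \<open>g\<close> with
  \<open>T\<^sup>n f\<close>.\<close>

lemma display_pullback:
  assumes q: "tangent_display C q" and pb: "tangent_pullback C q f a b"
  shows "tangent_display C b"
  unfolding tangent_display_def
proof (intro conjI allI ballI impI)
  note [simp] = tpb_simps[OF pb]
  show "b \<in> arr C" by simp
  fix n g assume [simp]: "g \<in> arr C" "tgt C g = (tobj C ^^ n) (tgt C b)"
  obtain e d where ed: "tangent_pullback C (Tm n q) (g \<cdot> Tm n f) e d"
    by (rule displayD[OF q, of "g \<cdot> Tm n f" n]) simp_all
  note [simp] = tpb_simps(1-7)[OF ed]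
  have [simp]: "tgt C d = src C g" using tpb_simps(8)[OF ed] by simp
  note pbn = tpb_pullback[OF tpb_Tm[OF pb, of n]]
  note P = pair_props[OF pbn, of e "d \<cdot> g", simplified]
  have comm: "e \<cdot> Tm n q = d \<cdot> (g \<cdot> Tm n f)" using tpb_comm[OF ed] by simp
  have "tangent_pullback C (Tm n b) g (pair C (Tm n a) (Tm n b) e (d \<cdot> g)) d"
    by (rule tpb_cancel[OF tpb_Tm[OF pb, of n] ed]) (use P[OF comm] in simp_all)
  then show "\<exists>a b'. tangent_pullback C (Tm n b) g a b'" by blast
qed

lemma display_ident: "A \<in> obj C \<Longrightarrow> tangent_display C (ident C A)"
  unfolding tangent_display_def using tpb_of_ident by (metis Tm_ident ident_simps(1) ident_simps(3))

text \<open>The condition on \<open>T q\<close> at stage \<open>n\<close> is the condition on \<open>q\<close> at stage \<open>n + 1\<close>.\<close>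

lemma display_T:
  assumes "tangent_display C q"
  shows "tangent_display C (T q)"
  unfolding tangent_display_def
proof (intro conjI allI ballI impI)
  note [simp] = display_arr[OF assms]
  show "T q \<in> arr C" by simp
  fix n f assume "f \<in> arr C" "tgt C f = (tobj C ^^ n) (tgt C (T q))"
  then show "\<exists>a b. tangent_pullback C (Tm n (T q)) f a b"
    using displayD[OF assms, of f "Suc n"] by (simp add: funpow_swap1) metis
qed

lemma display_comp:
  assumes q: "tangent_display C q" and r: "tangent_display C r" and c: "tgt C q = src C r"
  shows "tangent_display C (q \<cdot> r)"
  unfolding tangent_display_def
proof (intro conjI allI ballI impI)
  note [simp] = display_arr[OF q] display_arr[OF r] c
  show "q \<cdot> r \<in> arr C" by simp
  fix n f assume [simp]: "f \<in> arr C" "tgt C f = (tobj C ^^ n) (tgt C (q \<cdot> r))"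
  obtain a b where 1: "tangent_pullback C (Tm n r) f a b"
    by (rule displayD[OF r, of f n]) simp_all
  note [simp] = tpb_simps[OF 1]
  obtain a' b' where 2: "tangent_pullback C (Tm n q) a a' b'"
    by (rule displayD[OF q, of a n]) simp_all
  show "\<exists>a b. tangent_pullback C (Tm n (q \<cdot> r)) f a b"
    using tpb_paste'[OF 1 2] by auto
qed

text \<open>The \<open>(n + 1)\<close>-fold fibre product is the pullback of \<open>q\<close> along the common composite of the \<open>n\<close>-fold one.\<close>

lemma display_fold_pullbacks:
  assumes q: "tangent_display C q"
  shows "has_tangent_fold_pullbacks C q"
  unfolding has_tangent_fold_pullbacks_def
proof
  fix n
  note [simp] = display_arr[OF q]
  show "\<exists>r \<pi>. \<forall>m. fold_pullback C (Tm m q) n (Tm m r) (\<lambda>i. Tm m (\<pi> i))"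
  proof (induction n)
    case 0
    have "fold_pullback C (Tm m q) 0 (Tm m (ident C (tgt C q))) \<pi>" for m \<pi>
      unfolding fold_pullback_def
    proof (intro conjI ballI allI impI)
      fix r' and x :: "nat \<Rightarrow> 'm" assume r: "r' \<in> arr C" "tgt C r' = tgt C (Tm m q) \<and>
        (\<forall>i<0. x i \<in> hom C (src C r') (src C (Tm m q)) \<and> x i \<cdot> Tm m q = r')"
      show "\<exists>!h. h \<in> hom C (src C r') (src C (Tm m (ident C (tgt C q)))) \<and>
        h \<cdot> Tm m (ident C (tgt C q)) = r' \<and> (\<forall>i<0. h \<cdot> \<pi> i = x i)"
        by (rule ex1I[of _ r']) (use r in \<open>auto simp: hom_iff\<close>)
    qed simp_all
    then show ?case by blast
  next
    case (Suc n)
    then obtain r \<pi> where IH: "\<And>m. fold_pullback C (Tm m q) n (Tm m r) (\<lambda>i. Tm m (\<pi> i))" by blast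
    have [simp]: "r \<in> arr C" "tgt C r = tgt C q"
      using IH[of 0] by (simp_all add: fold_pullback_def)
    have \<pi>: "\<And>i. i < n \<Longrightarrow> \<pi> i \<in> arr C \<and> src C (\<pi> i) = src C r \<and> tgt C (\<pi> i) = src C q \<and> \<pi> i \<cdot> q = r"
      using IH[of 0] by (simp add: fold_pullback_def hom_iff)
    obtain a b where ab: "tangent_pullback C q r a b"
      by (rule displayD[OF q, of r 0]) simp_all
    note [simp] = tpb_simps[OF ab]
    \<comment> \<open>the new factor comes last\<close>
    let ?\<pi> = "\<lambda>i. if i < n then b \<cdot> \<pi> i else a"
    have fp: "fold_pullback C (Tm m q) (Suc n) (Tm m (b \<cdot> r)) (\<lambda>i. Tm m (?\<pi> i))" for m
      unfolding fold_pullback_def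
    proof (intro conjI ballI allI impI)
      note abm = tpb_pullback[OF tpb_Tm[OF ab, of m]]
      show "Tm m q \<in> arr C" "Tm m (b \<cdot> r) \<in> arr C" "tgt C (Tm m (b \<cdot> r)) = tgt C (Tm m q)" by simp_all
      fix i assume "i < Suc n"
      then show "Tm m (?\<pi> i) \<in> hom C (src C (Tm m (b \<cdot> r))) (src C (Tm m q))"
        using \<pi>[of i] by (simp add: hom_iff)
      show "Tm m (?\<pi> i) \<cdot> Tm m q = Tm m (b \<cdot> r)"
        using \<pi>[of i] tpb_comm[OF ab] by (simp add: Tm_comp[symmetric] del: Tm_comp)
    next
      note abm = tpb_pullback[OF tpb_Tm[OF ab, of m]]
      fix r' and x :: "nat \<Rightarrow> 'm"
      assume r: "r' \<in> arr C" and "tgt C r' = tgt C (Tm m q) \<and>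
        (\<forall>i<Suc n. x i \<in> hom C (src C r') (src C (Tm m q)) \<and> x i \<cdot> Tm m q = r')"
      then have r': "tgt C r' = tgt C (Tm m q)" and
        x: "\<And>i. i < Suc n \<Longrightarrow> x i \<in> hom C (src C r') (src C (Tm m q)) \<and> x i \<cdot> Tm m q = r'"
        by blast+
      have "\<exists>!h. h \<in> hom C (src C r') (src C (Tm m r)) \<and> h \<cdot> Tm m r = r' \<and> (\<forall>i<n. h \<cdot> Tm m (\<pi> i) = x i)"
      proof -
        have "\<forall>r'\<in>arr C. \<forall>x. tgt C r' = tgt C (Tm m q) \<and>
          (\<forall>i<n. x i \<in> hom C (src C r') (src C (Tm m q)) \<and> x i \<cdot> Tm m q = r') \<longrightarrow>
          (\<exists>!h. h \<in> hom C (src C r') (src C (Tm m r)) \<and> h \<cdot> Tm m r = r' \<and>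
            (\<forall>i<n. h \<cdot> Tm m (\<pi> i) = x i))"
          using IH[of m] unfolding fold_pullback_def by (elim conjE)
        moreover have "\<forall>i<n. x i \<in> hom C (src C r') (src C (Tm m q)) \<and> x i \<cdot> Tm m q = r'"
          using x by (intro allI impI) (rule x, simp)
        ultimately show ?thesis using r r' by blast
      qed
      then obtain h where h: "h \<in> hom C (src C r') (src C (Tm m r))" "h \<cdot> Tm m r = r'"
          "\<forall>i<n. h \<cdot> Tm m (\<pi> i) = x i"
        and hu: "\<And>k. k \<in> hom C (src C r') (src C (Tm m r)) \<Longrightarrow> k \<cdot> Tm m r = r' \<Longrightarrow>
          \<forall>i<n. k \<cdot> Tm m (\<pi> i) = x i \<Longrightarrow> k = h"
        by blast
      have h': "h \<in> arr C" "src C h = src C r'" "tgt C h = (tobj C ^^ m) (src C r)"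
        and x': "x n \<in> arr C" "src C (x n) = src C r'" "tgt C (x n) = (tobj C ^^ m) (src C q)"
          "x n \<cdot> Tm m q = r'"
        using h(1) x[of n] by (simp_all add: hom_iff)
      have comm: "x n \<cdot> Tm m q = h \<cdot> Tm m r" using x' h(2) by simp
      let ?k = "pair C (Tm m a) (Tm m b) (x n) h"
      have P: "?k \<in> arr C" "src C ?k = src C r'" "tgt C ?k = (tobj C ^^ m) (src C a)"
        "?k \<cdot> Tm m a = x n" "?k \<cdot> Tm m b = h"
        using pair_props[OF abm x'(1) h'(1) _ _ _ comm] h'(2,3) x'(2,3) by simp_all
      have L: "k \<cdot> Tm m (b \<cdot> \<pi> i) = (k \<cdot> Tm m b) \<cdot> Tm m (\<pi> i)"
        if "i < n" "k \<in> arr C" "tgt C k = (tobj C ^^ m) (src C a)" for i k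
        using \<pi>[OF that(1)] that by simp
      show "\<exists>!k. k \<in> hom C (src C r') (src C (Tm m (b \<cdot> r))) \<and> k \<cdot> Tm m (b \<cdot> r) = r' \<and>
          (\<forall>i<Suc n. k \<cdot> Tm m (?\<pi> i) = x i)"
      proof (rule ex1I[of _ ?k])
        have "?k \<cdot> Tm m (b \<cdot> r) = r'"
          using reassoc[OF P(5)] P h(2) by simp
        then show "?k \<in> hom C (src C r') (src C (Tm m (b \<cdot> r))) \<and> ?k \<cdot> Tm m (b \<cdot> r) = r' \<and>
          (\<forall>i<Suc n. ?k \<cdot> Tm m (?\<pi> i) = x i)"
          using P h(3) L by (auto simp: hom_iff less_Suc_eq simp del: Tm_comp)
        fix k assume k: "k \<in> hom C (src C r') (src C (Tm m (b \<cdot> r))) \<and> k \<cdot> Tm m (b \<cdot> r) = r' \<and>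
          (\<forall>i<Suc n. k \<cdot> Tm m (?\<pi> i) = x i)"
        then have k': "k \<in> arr C" "src C k = src C r'" "tgt C k = (tobj C ^^ m) (src C a)"
          by (simp_all add: hom_iff)
        have "k \<cdot> Tm m b = h"
        proof (rule hu)
          show "k \<cdot> Tm m b \<in> hom C (src C r') (src C (Tm m r))" using k' by (simp add: hom_iff)
          show "(k \<cdot> Tm m b) \<cdot> Tm m r = r'" using k k' by simp
          show "\<forall>i<n. (k \<cdot> Tm m b) \<cdot> Tm m (\<pi> i) = x i"
            using k k' L[of _ k] by (metis less_SucI)
        qed
        moreover have "k \<cdot> Tm m a = x n" using k by (metis less_irrefl lessI)
        ultimately show "k = ?k"
          using pair_eqI[OF abm k'(1), of "x n" h] k' x' by simp
      qed
    qed
    show ?case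
      by (rule exI[of _ "b \<cdot> r"], rule exI[of _ ?\<pi>], rule allI, rule fp)
  qed
qed

section \<open>The structural transformations\<close>

lemma str_simps [simp]:
  assumes "M \<in> obj C"
  shows "tp C M \<in> arr C" "src C (tp C M) = tobj C M" "tgt C (tp C M) = M"
    "tz C M \<in> arr C" "src C (tz C M) = M" "tgt C (tz C M) = tobj C M"
    "tl C M \<in> arr C" "src C (tl C M) = tobj C M" "tgt C (tl C M) = tobj C (tobj C M)"
    "tc C M \<in> arr C" "src C (tc C M) = tobj C (tobj C M)" "tgt C (tc C M) = tobj C (tobj C M)"
    "tw1 C M \<in> arr C" "src C (tw1 C M) = tw C M" "tgt C (tw1 C M) = tobj C M"
    "tw2 C M \<in> arr C" "src C (tw2 C M) = tw C M" "tgt C (tw2 C M) = tobj C M"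
    "ts C M \<in> arr C" "src C (ts C M) = tw C M" "tgt C (ts C M) = tobj C M"
  using tangent assms by (simp_all add: tangent_category_def hom_iff)

lemma tw_obj [simp]: "M \<in> obj C \<Longrightarrow> tw C M \<in> obj C"
  using obj_simps(1)[of "ts C M"] by simp

text \<open>Used from left to right, the naturality squares move \<open>p\<close>, \<open>z\<close>, \<open>l\<close> and \<open>c\<close> to the left.  Together with the
  laws of a tangent category this normalises composites.\<close>

lemma nat_p: "f \<in> arr C \<Longrightarrow> tgt C f = B \<Longrightarrow> T f \<cdot> tp C B = tp C (src C f) \<cdot> f"
  and nat_z: "f \<in> arr C \<Longrightarrow> tgt C f = B \<Longrightarrow> f \<cdot> tz C B = tz C (src C f) \<cdot> T f"
  and nat_l: "f \<in> arr C \<Longrightarrow> tgt C f = B \<Longrightarrow> T f \<cdot> tl C B = tl C (src C f) \<cdot> T (T f)"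
  and nat_c: "f \<in> arr C \<Longrightarrow> tgt C f = B \<Longrightarrow> T (T f) \<cdot> tc C B = tc C (src C f) \<cdot> T (T f)"
  and nat_s: "f \<in> arr C \<Longrightarrow> tgt C f = B \<Longrightarrow> T2_arr C f \<cdot> ts C B = ts C (src C f) \<cdot> T f"
  using tangent by (auto simp add: tangent_category_def)

lemma nat_p': "f \<in> arr C \<Longrightarrow> tgt C f = B \<Longrightarrow> w \<in> arr C \<Longrightarrow> src C w = B \<Longrightarrow>
    T f \<cdot> (tp C B \<cdot> w) = tp C (src C f) \<cdot> (f \<cdot> w)"
  by (rule reassoc2[OF nat_p]) auto

lemma nat_z': "f \<in> arr C \<Longrightarrow> tgt C f = B \<Longrightarrow> w \<in> arr C \<Longrightarrow> src C w = tobj C B \<Longrightarrow>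
    f \<cdot> (tz C B \<cdot> w) = tz C (src C f) \<cdot> (T f \<cdot> w)"
  by (rule reassoc2[OF nat_z]) auto

lemma nat_l': "f \<in> arr C \<Longrightarrow> tgt C f = B \<Longrightarrow> w \<in> arr C \<Longrightarrow> src C w = tobj C (tobj C B) \<Longrightarrow>
    T f \<cdot> (tl C B \<cdot> w) = tl C (src C f) \<cdot> (T (T f) \<cdot> w)"
  by (rule reassoc2[OF nat_l]) auto

lemma nat_c': "f \<in> arr C \<Longrightarrow> tgt C f = B \<Longrightarrow> w \<in> arr C \<Longrightarrow> src C w = tobj C (tobj C B) \<Longrightarrow>
    T (T f) \<cdot> (tc C B \<cdot> w) = tc C (src C f) \<cdot> (T (T f) \<cdot> w)"
  by (rule reassoc2[OF nat_c]) auto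

lemmas nats = nat_p nat_z nat_l nat_c nat_p' nat_z' nat_l' nat_c'

lemma tangent_bundle_base [simp]:
  assumes "M \<in> obj C"
  shows "base C (tangent_bundle C M) = M" "total C (tangent_bundle C M) = tobj C M"
    "fibre2 C (tangent_bundle C M) = tw C M"
  using assms by (simp_all add: base_def total_def fibre2_def)

lemma T_bundle_base:
  assumes "fibred_magma C Q"
  shows "base C (T_bundle C Q) = tobj C (base C Q)" "total C (T_bundle C Q) = tobj C (total C Q)"
    "fibre2 C (T_bundle C Q) = tobj C (fibre2 C Q)"
  using fibred_magma_simps[OF assms] by (simp_all add: base_def total_def fibre2_def)

lemma tangent_bundle_tpb:
  "M \<in> obj C \<Longrightarrow> tangent_pullback C (tp C M) (tp C M) (tw1 C M) (tw2 C M)"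
  using tangent by (simp add: tangent_category_def)

lemma tangent_bundle_additive: "M \<in> obj C \<Longrightarrow> additive_bundle C (tangent_bundle C M)"
  using tangent by (simp add: tangent_category_def)

lemma tangent_bundle_magma: "M \<in> obj C \<Longrightarrow> fibred_magma C (tangent_bundle C M)"
  by (simp add: additive_bundle_magma tangent_bundle_additive)

text \<open>A morphism is additive as soon as the sums are related by some map between the fibre
  products lying over it; this is how naturality yields additivity.\<close>

lemma additive_morphismI:
  assumes Q: "fibred_magma C Q" and Q': "fibred_magma C Q'"
    and f: "f \<in> arr C" "src C f = base C Q" "tgt C f = base C Q'"
    and g: "g \<in> arr C" "src C g = total C Q" "tgt C g = total C Q'"
    and "bproj Q \<cdot> f = g \<cdot> bproj Q'" "bzero Q \<cdot> g = f \<cdot> bzero Q'"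
    and k: "k \<in> arr C" "src C k = fibre2 C Q" "tgt C k = fibre2 C Q'"
      "k \<cdot> bp1 Q' = bp1 Q \<cdot> g" "k \<cdot> bp2 Q' = bp2 Q \<cdot> g" "bsum Q \<cdot> g = k \<cdot> bsum Q'"
  shows "additive_morphism C Q Q' f g"
proof -
  note [simp] = fibred_magma_simps[OF Q] fibred_magma_simps[OF Q'] f g k(1-5)
  have "fsum C Q' (bp1 Q \<cdot> g) (bp2 Q \<cdot> g) = k \<cdot> bsum Q'"
    unfolding fsum_def by (subst pair_eqI[OF fibred_magma_pullback[OF Q'], of k]) simp_all
  then show ?thesis
    using assms by (simp add: additive_morphism_def hom_iff)
qed

lemma additive_morphism_simps:
  assumes "additive_morphism C Q Q' f g"
  shows "f \<in> arr C" "src C f = base C Q" "tgt C f = base C Q'"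
    "g \<in> arr C" "src C g = total C Q" "tgt C g = total C Q'"
    "g \<cdot> bproj Q' = bproj Q \<cdot> f" "bzero Q \<cdot> g = f \<cdot> bzero Q'"
    "bsum Q \<cdot> g = fsum C Q' (bp1 Q \<cdot> g) (bp2 Q \<cdot> g)"
  using assms by (simp_all add: additive_morphism_def hom_iff)

lemma additive_morphism_comp:
  assumes 1: "additive_morphism C Q Q' f g" and 2: "additive_morphism C Q' Q'' f' g'"
    and Q: "fibred_magma C Q" and Q': "fibred_magma C Q'" and Q'': "fibred_magma C Q''"
    and z: "bzero Q \<in> arr C" "tgt C (bzero Q) = total C Q"
      "bzero Q' \<in> arr C" "src C (bzero Q') = base C Q'" "tgt C (bzero Q') = total C Q'"
      "bzero Q'' \<in> arr C" "src C (bzero Q'') = base C Q''"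
  shows "additive_morphism C Q Q'' (f \<cdot> f') (g \<cdot> g')"
proof -
  note a1 = additive_morphism_simps[OF 1] and a2 = additive_morphism_simps[OF 2]
  note [simp] = fibred_magma_simps[OF Q] fibred_magma_simps[OF Q'] fibred_magma_simps[OF Q'']
    a1(1-6) a2(1-6) z
  note [simp] = a1(7) a2(7) reassoc2[OF a1(7)] reassoc2[OF a2(7)]
  have b: "bp1 Q \<cdot> (bproj Q \<cdot> f) = bp2 Q \<cdot> (bproj Q \<cdot> f)"
    by (simp add: reassoc[OF fibred_magma_simps(14)[OF Q]])
  have "bsum Q \<cdot> (g \<cdot> g') = fsum C Q' (bp1 Q \<cdot> g) (bp2 Q \<cdot> g) \<cdot> g'"
    using reassoc[OF a1(9), of g'] by simp
  also have "\<dots> = fsum C Q'' (bp1 Q \<cdot> (g \<cdot> g')) (bp2 Q \<cdot> (g \<cdot> g'))"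
    using fsum_comp[OF 2 Q' Q'', of "bp1 Q \<cdot> g" "bp2 Q \<cdot> g"] b by simp
  finally have s: "bsum Q \<cdot> (g \<cdot> g') = fsum C Q'' (bp1 Q \<cdot> (g \<cdot> g')) (bp2 Q \<cdot> (g \<cdot> g'))" .
  have "bzero Q \<cdot> (g \<cdot> g') = f \<cdot> (f' \<cdot> bzero Q'')"
    using reassoc2[OF a1(8), of g'] a2(8) by simp
  then show ?thesis
    by (simp add: additive_morphism_def hom_iff s)
qed

lemma law_add_l: "M \<in> obj C \<Longrightarrow>
    additive_morphism C (tangent_bundle C M) (T_bundle C (tangent_bundle C M)) (tz C M) (tl C M)"
  and law_add_c: "M \<in> obj C \<Longrightarrow>
    additive_morphism C (T_bundle C (tangent_bundle C M)) (tangent_bundle C (tobj C M))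
      (ident C (tobj C M)) (tc C M)"
  using tangent by (simp_all add: tangent_category_def)

lemma law_zp [simp]: "M \<in> obj C \<Longrightarrow> tz C M \<cdot> tp C M = ident C M"
  using additive_bundle_zero(4)[OF tangent_bundle_additive] by simp

lemma law_cc [simp]: "M \<in> obj C \<Longrightarrow> tc C M \<cdot> tc C M = ident C (tobj C (tobj C M))"
  and law_lc [simp]: "M \<in> obj C \<Longrightarrow> tl C M \<cdot> tc C M = tl C M"
  and law_ll [simp]: "M \<in> obj C \<Longrightarrow> tl C M \<cdot> T (tl C M) = tl C M \<cdot> tl C (tobj C M)"
  and law_lcc: "M \<in> obj C \<Longrightarrow>
    tl C (tobj C M) \<cdot> T (tc C M) \<cdot> tc C (tobj C M) = tc C M \<cdot> T (tl C M)"
  using tangent by (simp_all add: tangent_category_def)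

lemma law_cp [simp]: "M \<in> obj C \<Longrightarrow> tc C M \<cdot> tp C (tobj C M) = T (tp C M)"
  using additive_morphism_simps(7)[OF law_add_c, of M] by (simp add: base_def total_def)

lemma law_Tzc [simp]: "M \<in> obj C \<Longrightarrow> T (tz C M) \<cdot> tc C M = tz C (tobj C M)"
  using additive_morphism_simps(8)[OF law_add_c, of M] by simp

lemma law_cc' [simp]: "M \<in> obj C \<Longrightarrow> w \<in> arr C \<Longrightarrow> src C w = tobj C (tobj C M) \<Longrightarrow>
    tc C M \<cdot> (tc C M \<cdot> w) = w"
  using reassoc[OF law_cc[of M]] by simp

lemma law_cTp [simp]: "M \<in> obj C \<Longrightarrow> tc C M \<cdot> T (tp C M) = tp C (tobj C M)"
  using law_cc'[of M "tp C (tobj C M)"] by (simp del: law_cc')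

lemma law_zc [simp]: "M \<in> obj C \<Longrightarrow> tz C (tobj C M) \<cdot> tc C M = T (tz C M)"
  by (simp add: law_Tzc[symmetric] del: law_Tzc)

lemma law_lTp [simp]: "M \<in> obj C \<Longrightarrow> tl C M \<cdot> T (tp C M) = tp C M \<cdot> tz C M"
  using additive_morphism_simps(7)[OF law_add_l, of M] by simp

lemma law_lp [simp]:
  assumes [simp]: "M \<in> obj C"
  shows "tl C M \<cdot> tp C (tobj C M) = tp C M \<cdot> tz C M"
proof -
  have "tl C M \<cdot> tp C (tobj C M) = tl C M \<cdot> (tc C M \<cdot> tp C (tobj C M))"
    using reassoc[OF law_lc[of M], of "tp C (tobj C M)"] by (simp del: law_cp)
  then show ?thesis by simp
qed

lemma law_zl [simp]:
  assumes [simp]: "M \<in> obj C"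
  shows "tz C M \<cdot> tl C M = tz C M \<cdot> T (tz C M)"
  using additive_morphism_simps(8)[OF law_add_l[OF assms]] by simp

text \<open>The same laws inside a longer composite.\<close>

lemma laws_comp [simp]:
  assumes M: "M \<in> obj C" and w: "w \<in> arr C"
  shows "src C w = M \<Longrightarrow> tz C M \<cdot> (tp C M \<cdot> w) = w"
    "src C w = tobj C (tobj C M) \<Longrightarrow> tl C M \<cdot> (tc C M \<cdot> w) = tl C M \<cdot> w"
    "src C w = tobj C M \<Longrightarrow> tc C M \<cdot> (tp C (tobj C M) \<cdot> w) = T (tp C M) \<cdot> w"
    "src C w = tobj C M \<Longrightarrow> tc C M \<cdot> (T (tp C M) \<cdot> w) = tp C (tobj C M) \<cdot> w"
    "src C w = tobj C (tobj C M) \<Longrightarrow> T (tz C M) \<cdot> (tc C M \<cdot> w) = tz C (tobj C M) \<cdot> w"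
    "src C w = tobj C (tobj C M) \<Longrightarrow> tz C (tobj C M) \<cdot> (tc C M \<cdot> w) = T (tz C M) \<cdot> w"
    "src C w = tobj C M \<Longrightarrow> tl C M \<cdot> (T (tp C M) \<cdot> w) = tp C M \<cdot> (tz C M \<cdot> w)"
    "src C w = tobj C M \<Longrightarrow> tl C M \<cdot> (tp C (tobj C M) \<cdot> w) = tp C M \<cdot> (tz C M \<cdot> w)"
    "src C w = tobj C (tobj C (tobj C M)) \<Longrightarrow>
      tl C M \<cdot> (T (tl C M) \<cdot> w) = tl C M \<cdot> (tl C (tobj C M) \<cdot> w)"
  using M w reassoc[OF law_zp, of M w] reassoc[OF law_lc, of M w] reassoc[OF law_cp, of M w]
    reassoc[OF law_cTp, of M w] reassoc[OF law_Tzc, of M w] reassoc[OF law_zc, of M w]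
    reassoc[OF law_lTp, of M w] reassoc[OF law_lp, of M w] reassoc[OF law_ll, of M w]
  by simp_all

text \<open>The coherence between \<open>l\<close> and \<open>c\<close>, with the two outer flips moved to the opposite sides.\<close>

lemma law_clTc:
  assumes [simp]: "M \<in> obj C"
  shows "tc C M \<cdot> (tl C (tobj C M) \<cdot> T (tc C M)) = T (tl C M) \<cdot> tc C (tobj C M)"
proof -
  have "tc C M \<cdot> (tl C (tobj C M) \<cdot> T (tc C M)) =
      tc C M \<cdot> ((tl C (tobj C M) \<cdot> T (tc C M) \<cdot> tc C (tobj C M)) \<cdot> tc C (tobj C M))"
    by simp
  also have "\<dots> = T (tl C M) \<cdot> tc C (tobj C M)"
    unfolding law_lcc[OF assms] by simp
  finally show ?thesis .
qed

end

section \<open>Functors that preserve tangent pullbacks\<close>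

text \<open>Bundle structures are carried over by \<open>T\<close> and by the fibre product functor \<open>T\<^sub>2\<close> for the same reasons, so
  the argument is given once, for a functor \<open>S\<close> that preserves tangent pullbacks.\<close>

locale pullback_functor = tangent_cat +
  fixes S :: "'b \<Rightarrow> 'b" and So :: "'a \<Rightarrow> 'a"
  assumes S_obj [simp]: "A \<in> obj C \<Longrightarrow> So A \<in> obj C"
    and S_simps [simp]: "f \<in> arr C \<Longrightarrow> S f \<in> arr C" "f \<in> arr C \<Longrightarrow> src C (S f) = So (src C f)"
      "f \<in> arr C \<Longrightarrow> tgt C (S f) = So (tgt C f)"
    and S_ident [simp]: "A \<in> obj C \<Longrightarrow> S (ident C A) = ident C (So A)"
    and S_comp [simp]: "f \<in> arr C \<Longrightarrow> g \<in> arr C \<Longrightarrow> tgt C f = src C g \<Longrightarrow> S (f \<cdot> g) = S f \<cdot> S g"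
    and S_tpb: "tangent_pullback C f g a b \<Longrightarrow> tangent_pullback C (S f) (S g) (S a) (S b)"
begin

text \<open>The lift is left open, because it is not the image of the lift of \<open>Q\<close>: that image ends in \<open>S (T E)\<close>
  and not in \<open>T (S E)\<close>.\<close>

definition image_bundle :: "'b \<Rightarrow> 'b bundle_data \<Rightarrow> 'b bundle_data" where
  "image_bundle L Q = \<lparr>bproj = S (bproj Q), bzero = S (bzero Q), bp1 = S (bp1 Q), bp2 = S (bp2 Q),
     bsum = S (bsum Q), blift = L\<rparr>"

lemma image_sel [simp]:
  "bproj (image_bundle L Q) = S (bproj Q)" "bzero (image_bundle L Q) = S (bzero Q)"
  "bp1 (image_bundle L Q) = S (bp1 Q)" "bp2 (image_bundle L Q) = S (bp2 Q)"
  "bsum (image_bundle L Q) = S (bsum Q)" "blift (image_bundle L Q) = L"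
  by (simp_all add: image_bundle_def)

lemma image_base:
  assumes "fibred_magma C Q"
  shows "base C (image_bundle L Q) = So (base C Q)" "total C (image_bundle L Q) = So (total C Q)"
    "fibre2 C (image_bundle L Q) = So (fibre2 C Q)"
  using fibred_magma_simps[OF assms] by (simp_all add: base_def total_def fibre2_def)

lemma image_magma:
  assumes Q: "fibred_magma C Q" and pb: "tangent_pullback C (bproj Q) (bproj Q) (bp1 Q) (bp2 Q)"
  shows "fibred_magma C (image_bundle L Q)"
proof -
  note [simp] = fibred_magma_simps[OF Q] image_base[OF Q]
  have "S (bsum Q) \<cdot> S (bproj Q) = S (bp1 Q) \<cdot> S (bproj Q)"
    using fibred_magma_simps(13)[OF Q] by (simp add: S_comp[symmetric] del: S_comp)
  then show ?thesis
    using tpb_pullback[OF S_tpb[OF pb]] by (simp add: fibred_magma_def hom_iff)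
qed

lemma S_pair:
  assumes pb: "tangent_pullback C f g a b" and "x \<in> arr C" "y \<in> arr C" "src C y = src C x"
    "tgt C x = src C f" "tgt C y = src C g" "x \<cdot> f = y \<cdot> g"
  shows "S (pair C a b x y) = pair C (S a) (S b) (S x) (S y)"
proof -
  note [simp] = tpb_simps[OF pb] assms(2-6)
  note [simp] = pair_props[OF tpb_pullback[OF pb] assms(2-7)]
  show ?thesis
    by (rule pair_eqI[OF tpb_pullback[OF S_tpb[OF pb]], symmetric])
      (simp_all add: S_comp[symmetric] del: S_comp)
qed

lemma S_fsum:
  assumes Q: "fibred_magma C Q" and pb: "tangent_pullback C (bproj Q) (bproj Q) (bp1 Q) (bp2 Q)"
    and "x \<in> arr C" "y \<in> arr C" "src C y = src C x" "tgt C x = total C Q" "tgt C y = total C Q"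
    and "x \<cdot> bproj Q = y \<cdot> bproj Q"
  shows "S (fsum C Q x y) = fsum C (image_bundle L Q) (S x) (S y)"
proof -
  note [simp] = fibred_magma_simps[OF Q] assms(3-7)
  note [simp] = pair_props[OF tpb_pullback[OF pb], of x y, simplified, OF assms(8)]
  show ?thesis
    by (simp add: fsum_def S_pair[OF pb] assms(8))
qed

lemma image_additive_morphism:
  assumes am: "additive_morphism C Q Q' f g" and Q: "fibred_magma C Q" and Q': "fibred_magma C Q'"
    and pb: "tangent_pullback C (bproj Q') (bproj Q') (bp1 Q') (bp2 Q')"
    and z: "bzero Q \<in> arr C" "tgt C (bzero Q) = total C Q"
      "bzero Q' \<in> arr C" "src C (bzero Q') = base C Q'"
  shows "additive_morphism C (image_bundle L Q) (image_bundle L' Q') (S f) (S g)"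
proof -
  note a = additive_morphism_simps[OF am]
  note [simp] = fibred_magma_simps[OF Q] fibred_magma_simps[OF Q'] image_base[OF Q] image_base[OF Q']
    a(1-6) z
  have b: "bp1 Q \<cdot> g \<cdot> bproj Q' = bp2 Q \<cdot> g \<cdot> bproj Q'"
    by (simp add: a(7) reassoc[OF fibred_magma_simps(14)[OF Q]])
  have "S (bproj Q) \<cdot> S f = S g \<cdot> S (bproj Q')" "S (bzero Q) \<cdot> S g = S f \<cdot> S (bzero Q')"
    using a(7,8) by (simp_all add: S_comp[symmetric] del: S_comp)
  moreover have "S (bsum Q) \<cdot> S g = fsum C (image_bundle L' Q') (S (bp1 Q) \<cdot> S g) (S (bp2 Q) \<cdot> S g)"
    using S_fsum[OF Q' pb, of "bp1 Q \<cdot> g" "bp2 Q \<cdot> g" L'] b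
    by (simp add: S_comp[symmetric] a(9) del: S_comp)
  ultimately show ?thesis by (simp add: additive_morphism_def hom_iff)
qed

text \<open>The monoid laws are equations between morphisms out of the universal fibre products
  \<open>E\<close>, \<open>E\<^sub>2\<close>, \<open>E\<^sub>3\<close>; these fibre products are preserved, so the laws can be transported.\<close>

lemma image_additive:
  assumes Q: "additive_bundle C Q" and d: "tangent_display C (bproj Q)"
    and pb: "tangent_pullback C (bproj Q) (bproj Q) (bp1 Q) (bp2 Q)"
  shows "additive_bundle C (image_bundle L Q)"
proof -
  let ?B = "image_bundle L Q"
  note mg = additive_bundle_magma[OF Q]
  note mgB = image_magma[OF mg pb, of L]
  note [simp] = fibred_magma_simps[OF mg] image_base[OF mg] additive_bundle_zero[OF Q]
  note [simp] = fibred_magma_simps[OF mgB, simplified]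
  note pbB = fibred_magma_pullback[OF mgB, simplified]
  note Sf = S_fsum[OF mg pb, where L = L]
  note cf = comp_fsum[OF mgB, simplified]
  show ?thesis
    unfolding additive_bundle_def
  proof (intro conjI ballI impI)
    show "is_pullback C (bproj ?B) (bproj ?B) (bp1 ?B) (bp2 ?B)" using pbB by simp
    show "bzero ?B \<in> hom C (base C ?B) (total C ?B)" by (simp add: hom_iff)
    show "bzero ?B \<cdot> bproj ?B = ident C (base C ?B)" by (simp add: S_comp[symmetric] del: S_comp)
    show "bsum ?B \<in> hom C (fibre2 C ?B) (total C ?B)" by (simp add: hom_iff)
    show "bsum ?B \<cdot> bproj ?B = bp1 ?B \<cdot> bproj ?B" by simp
  next
    fix X x assume "x \<in> hom C X (total C ?B)"
    then have [simp]: "x \<in> arr C" "tgt C x = So (total C Q)" by (simp_all add: hom_iff)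
    have [simp]: "S (bproj Q) \<cdot> (S (bzero Q) \<cdot> S (bproj Q)) = S (bproj Q)"
      by (simp add: S_comp[symmetric] del: S_comp)
    have "fsum C ?B (ident C (So (total C Q))) (S (bproj Q) \<cdot> S (bzero Q)) =
        S (fsum C Q (ident C (total C Q)) (bproj Q \<cdot> bzero Q))"
      using Sf[of "ident C (total C Q)" "bproj Q \<cdot> bzero Q"] by simp
    also have "\<dots> = ident C (So (total C Q))"
      using fsum_zero_right[OF Q, of "ident C (total C Q)"] by simp
    finally have "x \<cdot> fsum C ?B (ident C (So (total C Q))) (S (bproj Q) \<cdot> S (bzero Q)) = x" by simp
    then show "fsum C ?B x (x \<cdot> bproj ?B \<cdot> bzero ?B) = x"
      by (simp add: cf)
  next
    fix X x y assume "x \<in> hom C X (total C ?B)" "y \<in> hom C X (total C ?B)"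
      and xy: "x \<cdot> bproj ?B = y \<cdot> bproj ?B"
    then have [simp]: "x \<in> arr C" "tgt C x = So (total C Q)" "src C x = X"
      "y \<in> arr C" "tgt C y = So (total C Q)" "src C y = X" by (simp_all add: hom_iff)
    let ?h = "pair C (S (bp1 Q)) (S (bp2 Q)) x y"
    note h [simp] = pair_props[OF pbB, of x y, simplified, OF xy[simplified]]
    have "fsum C ?B (S (bp1 Q)) (S (bp2 Q)) = fsum C ?B (S (bp2 Q)) (S (bp1 Q))"
      using fsum_commute[OF Q, of "bp1 Q" "bp2 Q"] Sf[of "bp1 Q" "bp2 Q"] Sf[of "bp2 Q" "bp1 Q"] by simp
    then have "?h \<cdot> fsum C ?B (S (bp1 Q)) (S (bp2 Q)) = ?h \<cdot> fsum C ?B (S (bp2 Q)) (S (bp1 Q))" by simp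
    then show "fsum C ?B x y = fsum C ?B y x"
      by (simp add: cf)
  next
    fix X x y w assume "x \<in> hom C X (total C ?B)" "y \<in> hom C X (total C ?B)" "w \<in> hom C X (total C ?B)"
      and eq: "x \<cdot> bproj ?B = y \<cdot> bproj ?B \<and> y \<cdot> bproj ?B = w \<cdot> bproj ?B"
    then have [simp]: "x \<in> arr C" "tgt C x = So (total C Q)" "src C x = X"
      "y \<in> arr C" "tgt C y = So (total C Q)" "src C y = X"
      "w \<in> arr C" "tgt C w = So (total C Q)" "src C w = X" by (simp_all add: hom_iff)
    note xy = conjunct1[OF eq, simplified] and yw = conjunct2[OF eq, simplified]
    \<comment> \<open>the fibre product \<open>E\<^sub>3\<close>, as the pullback of \<open>q\<close> along \<open>E\<^sub>2 \<rightarrow> M\<close>\<close>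
    obtain a b where ab: "tangent_pullback C (bproj Q) (bp1 Q \<cdot> bproj Q) a b"
      by (rule displayD[OF d, of "bp1 Q \<cdot> bproj Q" 0]) simp_all
    note [simp] = tpb_simps[OF ab, simplified]
    note abS = tpb_pullback[OF S_tpb[OF ab], simplified]
    note abc = tpb_comm[OF ab]
    let ?h = "pair C (S (bp1 Q)) (S (bp2 Q)) x y"
    note h [simp] = pair_props[OF pbB, of x y, simplified, OF xy]
    have "w \<cdot> S (bproj Q) = ?h \<cdot> (S (bp1 Q) \<cdot> S (bproj Q))"
      using reassoc[OF h(4), of "S (bproj Q)"] xy yw by simp
    note k [simp] = pair_props[OF abS, of w ?h, simplified, OF this]
    let ?k = "pair C (S a) (S b) w ?h"
    have ba: "b \<cdot> (bp1 Q \<cdot> bproj Q) = a \<cdot> bproj Q" using abc by simp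
    have Sba: "S b \<cdot> (S (bp1 Q) \<cdot> S (bproj Q)) = S a \<cdot> S (bproj Q)"
      using arg_cong[OF ba, of S] by simp
    let ?x = "b \<cdot> bp1 Q" and ?y = "b \<cdot> bp2 Q"
    note fx = fsum_simps[OF mg, of ?x ?y, simplified]
      fsum_simps[OF mg, of ?y a, simplified, OF ba]
    note fs = fsum_simps[OF mgB, simplified]
    have "fsum C Q (fsum C Q ?x ?y) a = fsum C Q ?x (fsum C Q ?y a)"
      by (rule fsum_assoc[OF Q]) (simp_all add: abc)
    then have "S (fsum C Q (fsum C Q ?x ?y) a) = S (fsum C Q ?x (fsum C Q ?y a))" by simp
    then have "fsum C ?B (fsum C ?B (S b \<cdot> S (bp1 Q)) (S b \<cdot> S (bp2 Q))) (S a) =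
        fsum C ?B (S b \<cdot> S (bp1 Q)) (fsum C ?B (S b \<cdot> S (bp2 Q)) (S a))"
      using fx ba Sf[of ?x ?y] Sf[of ?y a] Sf[of "fsum C Q ?x ?y" a] Sf[of ?x "fsum C Q ?y a"] by simp
    then have "?k \<cdot> fsum C ?B (fsum C ?B (S b \<cdot> S (bp1 Q)) (S b \<cdot> S (bp2 Q))) (S a) =
        ?k \<cdot> fsum C ?B (S b \<cdot> S (bp1 Q)) (fsum C ?B (S b \<cdot> S (bp2 Q)) (S a))" by simp
    then show "fsum C ?B (fsum C ?B x y) w = fsum C ?B x (fsum C ?B y w)"
      by (simp add: cf fs Sba reassoc[OF k(5)])
  qed
qed

end

sublocale tangent_cat \<subseteq> T: pullback_functor C "tarr C" "tobj C"
  by unfold_locales (simp_all add: tpb_T)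

context tangent_cat
begin

lemma T_bundle_image: "T_bundle C Q = T.image_bundle (T (blift Q) \<cdot> tc C (total C Q)) Q"
  by (simp add: T_bundle_def T.image_bundle_def)

lemma T_bundle_magma:
  assumes Q: "fibred_magma C Q" and pb: "tangent_pullback C (bproj Q) (bproj Q) (bp1 Q) (bp2 Q)"
  shows "fibred_magma C (T_bundle C Q)"
  using T.image_magma[OF assms] by (simp add: T_bundle_image)

end

section \<open>Differential bundles\<close>

context tangent_cat
begin

lemma differential_additive: "differential_bundle C Q \<Longrightarrow> additive_bundle C Q"
  and differential_tpb:
    "differential_bundle C Q \<Longrightarrow> tangent_pullback C (bproj Q) (bproj Q) (bp1 Q) (bp2 Q)"
  and lift_additive_T: "differential_bundle C Q \<Longrightarrow>
    additive_morphism C Q (T_bundle C Q) (tz C (base C Q)) (blift Q)"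
  and lift_additive_tangent: "differential_bundle C Q \<Longrightarrow>
    additive_morphism C Q (tangent_bundle C (total C Q)) (bzero Q) (blift Q)"
  and differential_universal: "differential_bundle C Q \<Longrightarrow>
    tangent_pullback C (tarr C (bproj Q)) (tz C (base C Q)) (xi C Q) (bp1 Q \<cdot> bproj Q)"
  by (simp_all add: differential_bundle_def)

lemma differential_magma: "differential_bundle C Q \<Longrightarrow> fibred_magma C Q"
  by (simp add: additive_bundle_magma differential_additive)

lemma differential_T_magma: "differential_bundle C Q \<Longrightarrow> fibred_magma C (T_bundle C Q)"
  by (simp add: T_bundle_magma differential_magma differential_tpb)

lemma differential_simps:
  assumes Q: "differential_bundle C Q"
  shows "blift Q \<in> arr C" "src C (blift Q) = total C Q" "tgt C (blift Q) = tobj C (total C Q)"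
    "blift Q \<cdot> T (bproj Q) = tz C (total C Q) \<cdot> T (bproj Q)"
    "blift Q \<cdot> tp C (total C Q) = bproj Q \<cdot> bzero Q"
    "bzero Q \<cdot> blift Q = tz C (base C Q) \<cdot> T (bzero Q)"
    "blift Q \<cdot> T (blift Q) = blift Q \<cdot> tl C (total C Q)"
proof -
  note [simp] = fibred_magma_simps[OF differential_magma[OF Q]]
  show "blift Q \<in> arr C" "src C (blift Q) = total C Q" "tgt C (blift Q) = tobj C (total C Q)"
    "blift Q \<cdot> T (blift Q) = blift Q \<cdot> tl C (total C Q)"
    using Q by (simp_all add: differential_bundle_def hom_iff)
  show "blift Q \<cdot> T (bproj Q) = tz C (total C Q) \<cdot> T (bproj Q)"
    using additive_morphism_simps(7)[OF lift_additive_T[OF Q]] by (simp add: nats)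
  show "blift Q \<cdot> tp C (total C Q) = bproj Q \<cdot> bzero Q"
    using additive_morphism_simps(7)[OF lift_additive_tangent[OF Q]] by simp
  show "bzero Q \<cdot> blift Q = tz C (base C Q) \<cdot> T (bzero Q)"
    using additive_morphism_simps(8)[OF lift_additive_T[OF Q]] by simp
qed

end

section \<open>Images of differential bundles\<close>

text \<open>The lift \<open>S l : S E \<rightarrow> S (T E)\<close> becomes a lift by means of an isomorphism \<open>\<alpha> : S T \<rightarrow> T S\<close> that is
  compatible with the tangent structure.  For \<open>S = T\<close> it is the flip \<open>c\<close>.\<close>

locale bundle_functor = pullback_functor +
  fixes \<alpha> \<beta> :: "'a \<Rightarrow> 'b"
  assumes \<alpha>_simps [simp]: "A \<in> obj C \<Longrightarrow> \<alpha> A \<in> arr C" "A \<in> obj C \<Longrightarrow> src C (\<alpha> A) = So (tobj C A)"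
      "A \<in> obj C \<Longrightarrow> tgt C (\<alpha> A) = tobj C (So A)"
    and \<beta>_simps [simp]: "A \<in> obj C \<Longrightarrow> \<beta> A \<in> arr C" "A \<in> obj C \<Longrightarrow> src C (\<beta> A) = tobj C (So A)"
      "A \<in> obj C \<Longrightarrow> tgt C (\<beta> A) = So (tobj C A)"
    and \<alpha>\<beta> [simp]: "A \<in> obj C \<Longrightarrow> \<alpha> A \<cdot> \<beta> A = ident C (So (tobj C A))"
      "A \<in> obj C \<Longrightarrow> \<beta> A \<cdot> \<alpha> A = ident C (tobj C (So A))"
    and \<alpha>_nat: "f \<in> arr C \<Longrightarrow> S (T f) \<cdot> \<alpha> (tgt C f) = \<alpha> (src C f) \<cdot> T (S f)"
    and \<alpha>_z: "A \<in> obj C \<Longrightarrow> S (tz C A) \<cdot> \<alpha> A = tz C (So A)"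
    and \<alpha>_l: "A \<in> obj C \<Longrightarrow> \<alpha> A \<cdot> tl C (So A) = S (tl C A) \<cdot> (\<alpha> (tobj C A) \<cdot> T (\<alpha> A))"
    and \<alpha>_additive: "A \<in> obj C \<Longrightarrow> additive_morphism C (image_bundle L (tangent_bundle C A))
      (tangent_bundle C (So A)) (ident C (So A)) (\<alpha> A)"
begin

lemma \<alpha>_nat': "f \<in> arr C \<Longrightarrow> tgt C f = B \<Longrightarrow> w \<in> arr C \<Longrightarrow> src C w = tobj C (So B) \<Longrightarrow>
    S (T f) \<cdot> (\<alpha> B \<cdot> w) = \<alpha> (src C f) \<cdot> (T (S f) \<cdot> w)"
  by (rule reassoc2) (auto simp: \<alpha>_nat)

lemma \<alpha>_nat_eq: "f \<in> arr C \<Longrightarrow> tgt C f = B \<Longrightarrow> S (T f) \<cdot> \<alpha> B = \<alpha> (src C f) \<cdot> T (S f)"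
  using \<alpha>_nat by blast

definition S_bundle :: "'b bundle_data \<Rightarrow> 'b bundle_data" where
  "S_bundle Q = image_bundle (S (blift Q) \<cdot> \<alpha> (total C Q)) Q"

lemma \<alpha>_bundle_additive:
  assumes Q: "additive_bundle C Q" and pb: "tangent_pullback C (bproj Q) (bproj Q) (bp1 Q) (bp2 Q)"
  shows "additive_morphism C (image_bundle L (T_bundle C Q)) (T_bundle C (image_bundle L' Q))
    (\<alpha> (base C Q)) (\<alpha> (total C Q))"
proof -
  note mg = additive_bundle_magma[OF Q]
  note mT = T_bundle_magma[OF mg pb]
  note mi = image_magma[OF mg pb, of L']
  note [simp] = fibred_magma_simps[OF mg] additive_bundle_zero[OF Q] T_bundle_base[OF mg]
    image_base[OF mg] image_base[OF mT] T_bundle_base[OF mi]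
  show ?thesis
    by (rule additive_morphismI[where k = "\<alpha> (fibre2 C Q)"])
      (use image_magma[OF mT, of L] tpb_T[OF pb] T_bundle_magma[OF mi] S_tpb[OF pb]
       in \<open>simp_all add: \<alpha>_nat_eq\<close>)
qed

text \<open>The axioms for \<open>S Q\<close> are the images under \<open>S\<close> of the axioms for \<open>Q\<close>, composed with \<open>\<alpha>\<close>.  The universal
  square of \<open>S Q\<close> is the image of that of \<open>Q\<close> pasted with the naturality square of \<open>\<alpha>\<close> at \<open>q\<close>, which is a
  pullback because \<open>\<alpha>\<close> is invertible.\<close>

theorem S_bundle_differential:
  assumes Q: "differential_bundle C Q"
    and d: "tangent_display C (bproj Q)" and dS: "tangent_display C (S (bproj Q))"
  shows "differential_bundle C (S_bundle Q)"
proof -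
  note aQ = differential_additive[OF Q] and pb = differential_tpb[OF Q]
  note mg = differential_magma[OF Q] and mT = differential_T_magma[OF Q]
  let ?l = "S (blift Q) \<cdot> \<alpha> (total C Q)"
  let ?B = "image_bundle ?l Q"
  have B: "S_bundle Q = ?B" by (simp add: S_bundle_def)
  note mi = image_magma[OF mg pb, of ?l]
  note [simp] = fibred_magma_simps[OF mg] additive_bundle_zero[OF aQ] T_bundle_base[OF mg]
    image_base[OF mg] image_base[OF mT] T_bundle_base[OF mi] differential_simps[OF Q]
  note mTi = T_bundle_magma[OF mi, simplified, OF S_tpb[OF pb]]
  have pbT: "tangent_pullback C (T (bproj Q)) (T (bproj Q)) (T (bp1 Q)) (T (bp2 Q))"
    using tpb_T[OF pb] .
  note miT = image_magma[OF mT, simplified, OF pbT]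
  note a\<alpha> = \<alpha>_bundle_additive[OF aQ pb]
  have [simp]: "S (bzero Q) \<cdot> S (bproj Q) = ident C (So (base C Q))"
    by (simp add: S_comp[symmetric] del: S_comp)
  show ?thesis
    unfolding differential_bundle_def B
  proof (intro conjI)
    show "has_tangent_fold_pullbacks C (bproj ?B)"
      by (simp add: display_fold_pullbacks[OF dS])
    show "tangent_pullback C (bproj ?B) (bproj ?B)
        (bp1 ?B) (bp2 ?B)"
      by (simp add: S_tpb[OF pb])
    show "additive_bundle C ?B" by (rule image_additive[OF aQ d pb])
    show "blift ?B \<in>
        hom C (total C ?B) (tobj C (total C ?B))"
      by (simp add: hom_iff)
    show "additive_morphism C ?B (T_bundle C ?B)
        (tz C (base C ?B)) (blift ?B)"
    proof -
      have "additive_morphism C ?B (image_bundle ?l (T_bundle C Q))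
          (S (tz C (base C Q))) (S (blift Q))"
        by (rule image_additive_morphism[OF lift_additive_T[OF Q] mg mT]) (use pbT in simp_all)
      from additive_morphism_comp[OF this a\<alpha> mi miT mTi] show ?thesis
        by (simp add: \<alpha>_z)
    qed
    show "additive_morphism C ?B (tangent_bundle C (total C ?B))
        (bzero ?B) (blift ?B)"
    proof -
      note mt = tangent_bundle_magma[of "total C Q", simplified]
      have pt: "tangent_pullback C (tp C (total C Q)) (tp C (total C Q)) (tw1 C (total C Q)) (tw2 C (total C Q))"
        by (simp add: tangent_bundle_tpb)
      note mit = image_magma[OF mt, simplified, OF pt]
      note [simp] = image_base[OF mt]
      have "additive_morphism C ?B (image_bundle ?l (tangent_bundle C (total C Q)))
          (S (bzero Q)) (S (blift Q))"
        by (rule image_additive_morphism[OF lift_additive_tangent[OF Q] mg mt]) (use pt in simp_all)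
      from additive_morphism_comp[OF this \<alpha>_additive mi mit tangent_bundle_magma] show ?thesis
        by simp
    qed
    show "blift ?B \<cdot> tl C (total C ?B) =
        blift ?B \<cdot> T (blift ?B)"
    proof -
      have "S (blift Q) \<cdot> S (tl C (total C Q)) = S (blift Q) \<cdot> S (T (blift Q))"
        by (simp add: S_comp[symmetric] del: S_comp)
      from reassoc2[OF this] show ?thesis by (simp add: \<alpha>_l \<alpha>_nat')
    qed
    show "tangent_pullback C (T (bproj ?B)) (tz C (base C ?B))
        (xi C ?B) (bp1 ?B \<cdot> bproj ?B)"
    proof -
      let ?E = "total C Q" and ?M = "base C Q"
      have c: "bp1 Q \<cdot> (tz C ?E \<cdot> T (bproj Q)) = bp2 Q \<cdot> (tz C ?E \<cdot> T (bproj Q))"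
        by (simp add: nats T_comp[symmetric] del: T_comp)
      have "xi C ?B = S (xi C Q) \<cdot> \<alpha> ?E"
      proof -
        have "S (xi C Q) = fsum C (image_bundle undefined (T_bundle C Q))
            (S (bp1 Q) \<cdot> S (blift Q)) (S (bp2 Q) \<cdot> S (tz C ?E))"
          unfolding xi_def
          using S_fsum[OF mT, simplified, OF pbT, of "bp1 Q \<cdot> blift Q" "bp2 Q \<cdot> tz C ?E" undefined] c
          by simp
        moreover have "S (bp1 Q) \<cdot> (S (tz C ?E) \<cdot> S (T (bproj Q))) =
            S (bp2 Q) \<cdot> (S (tz C ?E) \<cdot> S (T (bproj Q)))"
          using arg_cong[OF c, of S] by simp
        moreover have "S (blift Q) \<cdot> S (T (bproj Q)) = S (tz C ?E) \<cdot> S (T (bproj Q))"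
          by (simp add: S_comp[symmetric] del: S_comp)
        ultimately show ?thesis
          using fsum_comp[OF a\<alpha> miT mTi, of "S (bp1 Q) \<cdot> S (blift Q)" "S (bp2 Q) \<cdot> S (tz C ?E)"]
          by (simp add: xi_def \<alpha>_z)
      qed
      moreover have "tangent_pullback C (T (S (bproj Q))) (\<alpha> ?M) (\<alpha> ?E) (S (T (bproj Q)))"
        by (rule tpb_iso[where a' = "\<beta> ?E" and g' = "\<beta> ?M"]) (simp_all add: \<alpha>_nat_eq)
      from tpb_paste[OF this S_tpb[OF differential_universal[OF Q]]]
      have "tangent_pullback C (T (S (bproj Q))) (S (tz C ?M) \<cdot> \<alpha> ?M) (S (xi C Q) \<cdot> \<alpha> ?E)
          (S (bp1 Q \<cdot> bproj Q))" .
      ultimately show ?thesis by (simp add: \<alpha>_z)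
    qed
  qed
qed

end

sublocale tangent_cat \<subseteq> T: bundle_functor C "tarr C" "tobj C" "tc C" "tc C"
proof unfold_locales
  fix A L assume [simp]: "A \<in> obj C"
  show "additive_morphism C (T.image_bundle L (tangent_bundle C A))
      (tangent_bundle C (tobj C A)) (ident C (tobj C A)) (tc C A)"
    using law_add_c[of A] tangent_bundle_magma[of A]
    by (simp add: additive_morphism_def T_bundle_base T.image_base fsum_def)
  show "tc C A \<cdot> tl C (tobj C A) = T (tl C A) \<cdot> (tc C (tobj C A) \<cdot> T (tc C A))"
  proof -
    have "T (tl C A) \<cdot> (tc C (tobj C A) \<cdot> T (tc C A)) = (T (tl C A) \<cdot> tc C (tobj C A)) \<cdot> T (tc C A)"
      by simp
    also have "\<dots> = tc C A \<cdot> (tl C (tobj C A) \<cdot> (T (tc C A) \<cdot> T (tc C A)))"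
      by (simp add: law_clTc[symmetric])
    also have "\<dots> = tc C A \<cdot> tl C (tobj C A)"
      by (simp add: T_comp[symmetric] del: T_comp)
    finally show ?thesis by simp
  qed
qed (simp_all add: nats)

context tangent_cat
begin

lemma T_bundle_display:
  assumes "display_bundle C Q"
  shows "display_bundle C (T_bundle C Q)"
proof -
  have Q: "differential_bundle C Q" "tangent_display C (bproj Q)"
    using assms by (simp_all add: display_bundle_def)
  have "T_bundle C Q = T.S_bundle Q" by (simp add: T_bundle_image T.S_bundle_def)
  then have "differential_bundle C (T_bundle C Q)"
    using T.S_bundle_differential[OF Q display_T[OF Q(2)]] by (simp only:)
  then show ?thesis
    using display_T[OF Q(2)] by (simp add: display_bundle_def)
qed

end

section \<open>Trivial bundles and pullbacks of differential bundles\<close>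

lemma zero_bundle_sel [simp]:
  "bproj (zero_bundle C M) = ident C M" "bzero (zero_bundle C M) = ident C M"
  "bp1 (zero_bundle C M) = ident C M" "bp2 (zero_bundle C M) = ident C M"
  "bsum (zero_bundle C M) = ident C M" "blift (zero_bundle C M) = tz C M"
  by (simp_all add: zero_bundle_def)

lemma pb_bundle_sel [simp]:
  "bproj (pb_bundle C Q f a b b1 b2) = b"
  "bzero (pb_bundle C Q f a b b1 b2) = pair C a b (comp C f (bzero Q)) (ident C (tgt C b))"
  "bp1 (pb_bundle C Q f a b b1 b2) = b1" "bp2 (pb_bundle C Q f a b b1 b2) = b2"
  "bsum (pb_bundle C Q f a b b1 b2) = pair C a b (fsum C Q (comp C b1 a) (comp C b2 a)) (comp C b1 b)"
  "blift (pb_bundle C Q f a b b1 b2) = pb_lift C (blift Q) a b"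
  by (simp_all add: pb_bundle_def)

context tangent_cat
begin

lemma T2_simps [simp]:
  assumes [simp]: "f \<in> arr C"
  shows "T2_arr C f \<in> arr C" "src C (T2_arr C f) = tw C (src C f)" "tgt C (T2_arr C f) = tw C (tgt C f)"
    "T2_arr C f \<cdot> tw1 C (tgt C f) = tw1 C (src C f) \<cdot> T f"
    "T2_arr C f \<cdot> tw2 C (tgt C f) = tw2 C (src C f) \<cdot> T f"
proof -
  have A: "src C f \<in> obj C" and B: "tgt C f \<in> obj C" by simp_all
  note c = pb_comm[OF tpb_pullback[OF tangent_bundle_tpb[OF A]]]
  have "(tw1 C (src C f) \<cdot> T f) \<cdot> tp C (tgt C f) = (tw2 C (src C f) \<cdot> T f) \<cdot> tp C (tgt C f)"
    using reassoc2[OF c, of f] by (simp add: nat_p)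
  note P = pair_props[OF tpb_pullback[OF tangent_bundle_tpb[OF B]] _ _ _ _ _ this]
  show "T2_arr C f \<in> arr C" "src C (T2_arr C f) = tw C (src C f)" "tgt C (T2_arr C f) = tw C (tgt C f)"
    "T2_arr C f \<cdot> tw1 C (tgt C f) = tw1 C (src C f) \<cdot> T f"
    "T2_arr C f \<cdot> tw2 C (tgt C f) = tw2 C (src C f) \<cdot> T f"
    unfolding T2_arr_def using P by simp_all
qed

lemma xi_simps:
  assumes Q: "differential_bundle C Q"
  shows "xi C Q \<in> arr C" "src C (xi C Q) = fibre2 C Q" "tgt C (xi C Q) = tobj C (total C Q)"
  using tpb_simps(3,6,7)[OF differential_universal[OF Q]]
    fibred_magma_simps[OF differential_magma[OF Q]] by simp_all

lemma T_tangent_additive: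
  assumes [simp]: "f \<in> arr C"
  shows "additive_morphism C (tangent_bundle C (src C f)) (tangent_bundle C (tgt C f)) f (T f)"
  by (rule additive_morphismI[where k = "T2_arr C f"])
    (simp_all add: tangent_bundle_magma nats nat_s)

lemma tpb_ident: "M \<in> obj C \<Longrightarrow> tangent_pullback C (ident C M) (ident C M) (ident C M) (ident C M)"
  using tpb_along_ident[of "ident C M"] by simp

text \<open>All sums are trivial here; that the lift \<open>z\<close> is additive into the tangent bundle says \<open>0 + 0 = 0\<close>.\<close>

lemma zero_bundle_display:
  assumes [simp]: "M \<in> obj C"
  shows "display_bundle C (zero_bundle C M)"
proof -
  let ?Z = "zero_bundle C M"
  have [simp]: "base C ?Z = M" "total C ?Z = M" "fibre2 C ?Z = M"
    by (simp_all add: base_def total_def fibre2_def)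
  note i = tpb_ident[of M, simplified]
  have [simp]: "fsum C ?Z x x = x" if "x \<in> arr C" "tgt C x = M" for x
    using pair_eqI[OF tpb_pullback[OF i], of x x x] that by (simp add: fsum_def)
  have fsT: "fsum C (T_bundle C ?Z) x x = x" if "x \<in> arr C" "tgt C x = tobj C M" for x
    using pair_eqI[OF tpb_pullback[OF tpb_T[OF i]], of x x x] that by (simp add: fsum_def)
  have ft: "fsum C (tangent_bundle C M) (tz C M) (tz C M) = tz C M"
    using fsum_zero_right[OF tangent_bundle_additive, of M "tz C M"] by simp
  have ad: "additive_bundle C ?Z"
    unfolding additive_bundle_def using tpb_pullback[OF i]
    by (auto simp add: hom_iff)
  note x = fsT[of "tz C M", simplified]
  have "tangent_pullback C (ident C (tobj C M)) (tz C M) (tz C M) (ident C M)"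
    using tpb_of_ident[of "tz C M"] by simp
  then have "differential_bundle C ?Z"
    unfolding differential_bundle_def
    using i ad display_fold_pullbacks[OF display_ident[of M]]
    by (simp add: additive_morphism_def hom_iff xi_def x ft T_bundle_base[OF additive_bundle_magma[OF ad]])
  then show ?thesis by (simp add: display_bundle_def display_ident)
qed

lemma pb_lift_simps:
  assumes Q: "differential_bundle C Q" and A: "tangent_pullback C (bproj Q) f a b"
  shows "pb_lift C (blift Q) a b \<in> arr C" "src C (pb_lift C (blift Q) a b) = src C a"
    "tgt C (pb_lift C (blift Q) a b) = tobj C (src C a)"
    "pb_lift C (blift Q) a b \<cdot> T a = a \<cdot> blift Q"
    "pb_lift C (blift Q) a b \<cdot> T b = b \<cdot> tz C (src C f)"
proof -
  note [simp] = fibred_magma_simps[OF differential_magma[OF Q]] differential_simps[OF Q] tpb_simps[OF A]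
  have a: "a \<cdot> bproj Q = b \<cdot> f" using tpb_comm[OF A] .
  have [simp]: "T a \<cdot> T (bproj Q) = T b \<cdot> T f" by (simp add: T_comp[symmetric] a del: T_comp)
  have zT: "a \<cdot> (tz C (total C Q) \<cdot> T (bproj Q)) = b \<cdot> (tz C (src C f) \<cdot> T f)"
    by (simp add: nats)
  note l = pair_props[OF tpb_pullback[OF tpb_T[OF A]], of "a \<cdot> blift Q" "b \<cdot> tz C (src C f)", simplified, OF zT]
  show "pb_lift C (blift Q) a b \<in> arr C" "src C (pb_lift C (blift Q) a b) = src C a"
    "tgt C (pb_lift C (blift Q) a b) = tobj C (src C a)"
    "pb_lift C (blift Q) a b \<cdot> T a = a \<cdot> blift Q"
    "pb_lift C (blift Q) a b \<cdot> T b = b \<cdot> tz C (src C f)"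
    using l by (simp_all add: pb_lift_def)
qed

text \<open>A morphism into the pullback is determined by its components in \<open>E\<close> and in \<open>N\<close>.  In \<open>E\<close> every axiom
  becomes the one for \<open>Q\<close>, in \<open>N\<close> a triviality.  For the universal square, \<open>P\<^sub>2\<close> is the pullback of \<open>E\<^sub>2\<close>
  along \<open>f\<close>, hence the pullback of \<open>T q\<close> along \<open>f z = z T f\<close>; as \<open>T P\<close> is the pullback of \<open>T q\<close> along \<open>T f\<close>,
  the remaining square is a pullback.\<close>

lemma pb_bundle_display:
  assumes D: "display_bundle C Q" and A: "tangent_pullback C (bproj Q) f a b"
    and B: "tangent_pullback C b b b1 b2"
  shows "display_bundle C (pb_bundle C Q f a b b1 b2)"
proof -
  have Q: "differential_bundle C Q" and dq: "tangent_display C (bproj Q)"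
    using D by (simp_all add: display_bundle_def)
  note db = display_pullback[OF dq A]
  note aQ = differential_additive[OF Q] and pb = differential_tpb[OF Q]
  note mg = differential_magma[OF Q] and mT = differential_T_magma[OF Q]
  let ?P = "pb_bundle C Q f a b b1 b2" and ?N = "src C f" and ?X = "src C a"
  note [simp] = fibred_magma_simps[OF mg] additive_bundle_zero[OF aQ] T_bundle_base[OF mg]
    differential_simps[OF Q]
  note [simp] = tpb_simps[OF A] tpb_simps[OF B]
  have b [simp]: "b2 \<cdot> b = b1 \<cdot> b" and a [simp]: "a \<cdot> bproj Q = b \<cdot> f"
    using tpb_comm[OF A] tpb_comm[OF B] by simp_all
  have aT [simp]: "T a \<cdot> T (bproj Q) = T b \<cdot> T f" and bT [simp]: "T b2 \<cdot> T b = T b1 \<cdot> T b"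
    by (simp_all add: T_comp[symmetric] del: T_comp)
  note [simp] = reassoc2[OF a] reassoc2[OF b]
  have [simp]: "base C ?P = ?N" "total C ?P = ?X" "fibre2 C ?P = src C b1"
    by (simp_all add: base_def total_def fibre2_def)
  note Ap = tpb_pullback[OF A]
  note z [simp] = pair_props[OF Ap, of "f \<cdot> bzero Q" "ident C ?N", simplified]
  note s0 [simp] = fsum_simps[OF mg, of "b1 \<cdot> a" "b2 \<cdot> a", simplified]
  note s [simp] = pair_props[OF Ap, of "fsum C Q (b1 \<cdot> a) (b2 \<cdot> a)" "b1 \<cdot> b", simplified]
  let ?l = "pb_lift C (blift Q) a b" and ?z = "pair C a b (f \<cdot> bzero Q) (ident C ?N)"
    and ?s = "pair C a b (fsum C Q (b1 \<cdot> a) (b2 \<cdot> a)) (b1 \<cdot> b)"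
  note ATp = tpb_pullback[OF tpb_T[OF A]]
  note l [simp] = pb_lift_simps[OF Q A]
  have mP: "fibred_magma C ?P"
    using tpb_pullback[OF B] by (simp add: fibred_magma_def hom_iff)
  have BP: "tangent_pullback C (bproj ?P) (bproj ?P) (bp1 ?P) (bp2 ?P)" using B by simp
  note mTP = T_bundle_magma[OF mP BP]
  note [simp] = T_bundle_base[OF mP]
  have amP: "additive_morphism C ?P Q f a"
    by (simp add: additive_morphism_def hom_iff)
  note fs = fsum_simps[OF mP, simplified]
  have fsa: "fsum C ?P x y \<cdot> a = fsum C Q (x \<cdot> a) (y \<cdot> a)"
    if "x \<in> arr C" "y \<in> arr C" "src C y = src C x" "tgt C x = ?X" "tgt C y = ?X" "x \<cdot> b = y \<cdot> b" for x y
    using fsum_comp[OF amP mP mg, of x y] that by simp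
  have fq: "x \<cdot> (b \<cdot> f) = y \<cdot> (b \<cdot> f)"
    if "x \<cdot> b = y \<cdot> b" "x \<in> arr C" "y \<in> arr C" "tgt C x = ?X" "tgt C y = ?X" for x y
    by (rule reassoc2[OF that(1)]) (use that in simp_all)
  have adP: "additive_bundle C ?P"
    unfolding additive_bundle_def
  proof (intro conjI ballI impI)
    show "is_pullback C (bproj ?P) (bproj ?P) (bp1 ?P) (bp2 ?P)" using tpb_pullback[OF B] by simp
  next
    fix X x assume "x \<in> hom C X (total C ?P)"
    then have x [simp]: "x \<in> arr C" "tgt C x = ?X" by (simp_all add: hom_iff)
    show "fsum C ?P x (x \<cdot> bproj ?P \<cdot> bzero ?P) = x"
    proof (rule pb_eqI[OF Ap])
      show "fsum C ?P x (x \<cdot> bproj ?P \<cdot> bzero ?P) \<cdot> a = x \<cdot> a"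
        using fsum_zero_right[OF aQ, of "x \<cdot> a"]
        by (simp add: fsa)
    qed (simp_all add: fs)
  next
    fix X x y assume "x \<in> hom C X (total C ?P)" "y \<in> hom C X (total C ?P)"
      and "x \<cdot> bproj ?P = y \<cdot> bproj ?P"
    then have x: "x \<in> arr C" "tgt C x = ?X" "y \<in> arr C" "tgt C y = ?X" "src C y = src C x"
      "x \<cdot> b = y \<cdot> b" by (simp_all add: hom_iff)
    note [simp] = x(1-5)
    show "fsum C ?P x y = fsum C ?P y x"
    proof (rule pb_eqI[OF Ap])
      show "fsum C ?P x y \<cdot> a = fsum C ?P y x \<cdot> a"
        using fsum_commute[OF aQ, of "x \<cdot> a" "y \<cdot> a"] fq[OF x(6)]
        by (simp add: fsa x(6))
    qed (simp_all add: fs x(6))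
  next
    fix X x y w assume "x \<in> hom C X (total C ?P)" "y \<in> hom C X (total C ?P)" "w \<in> hom C X (total C ?P)"
      and "x \<cdot> bproj ?P = y \<cdot> bproj ?P \<and> y \<cdot> bproj ?P = w \<cdot> bproj ?P"
    then have x: "x \<in> arr C" "tgt C x = ?X" "y \<in> arr C" "tgt C y = ?X" "src C y = src C x"
      "w \<in> arr C" "tgt C w = ?X" "src C w = src C x" "x \<cdot> b = w \<cdot> b" "y \<cdot> b = w \<cdot> b"
      by (simp_all add: hom_iff)
    note [simp] = x(1-8)
    show "fsum C ?P (fsum C ?P x y) w = fsum C ?P x (fsum C ?P y w)"
    proof (rule pb_eqI[OF Ap])
      show "fsum C ?P (fsum C ?P x y) w \<cdot> a = fsum C ?P x (fsum C ?P y w) \<cdot> a"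
        using fsum_assoc[OF aQ, of "x \<cdot> a" "y \<cdot> a" "w \<cdot> a"] fq[OF x(9)] fq[OF x(10)]
        by (simp add: fsa fs x(9,10))
    qed (simp_all add: fs x(9,10))
  qed (simp_all add: hom_iff)
  have amT: "additive_morphism C (T_bundle C ?P) (T_bundle C Q) (T f) (T a)"
    unfolding T_bundle_image by (rule T.image_additive_morphism[OF amP mP mg pb]) simp_all
  have e: "additive_morphism C ?P (T_bundle C ?P) (tz C ?N) ?l"
  proof -
    note f1 = fsum_simps[OF mTP, of "b1 \<cdot> ?l" "b2 \<cdot> ?l", simplified]
    have "?z \<cdot> ?l = tz C ?N \<cdot> T ?z"
    proof (rule pb_eqI[OF ATp])
      have "T ?z \<cdot> T a = T f \<cdot> T (bzero Q)"
        "T ?z \<cdot> T b = ident C (tobj C ?N)"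
        by (simp_all add: T_comp[symmetric] del: T_comp)
      then show "(?z \<cdot> ?l) \<cdot> T a =
          (tz C ?N \<cdot> T ?z) \<cdot> T a"
        "(?z \<cdot> ?l) \<cdot> T b =
          (tz C ?N \<cdot> T ?z) \<cdot> T b"
        by (simp_all add: reassoc[OF z(4)] reassoc[OF z(5)] nats)
    qed simp_all
    moreover have "?s \<cdot> ?l =
        fsum C (T_bundle C ?P) (b1 \<cdot> ?l) (b2 \<cdot> ?l)"
    proof (rule pb_eqI[OF ATp])
      show "(?s \<cdot> ?l) \<cdot> T a =
        fsum C (T_bundle C ?P) (b1 \<cdot> ?l) (b2 \<cdot> ?l) \<cdot> T a"
        using fsum_comp[OF amT mTP mT, of "b1 \<cdot> ?l" "b2 \<cdot> ?l"] f1
          fsum_comp[OF lift_additive_T[OF Q] mg mT, of "b1 \<cdot> a" "b2 \<cdot> a"]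
        by (simp add: reassoc[OF s(4)])
    qed (use f1 in \<open>simp_all add: reassoc[OF s(5)]\<close>)
    ultimately show ?thesis by (simp add: additive_morphism_def hom_iff)
  qed
  have f: "additive_morphism C ?P (tangent_bundle C ?X) (bzero ?P) ?l"
  proof -
    note mt = tangent_bundle_magma
    have sq: "b \<cdot> ?z = ?l \<cdot> tp C ?X"
    proof (rule pb_eqI[OF Ap])
      have "?l \<cdot> (T a \<cdot> tp C (total C Q)) = b \<cdot> (f \<cdot> bzero Q)"
        by (simp add: reassoc[OF l(4)] reassoc2[OF a])
      then show "(b \<cdot> ?z) \<cdot> a = (?l \<cdot> tp C ?X) \<cdot> a"
        by (simp add: nat_p)
      have "?l \<cdot> (T b \<cdot> tp C ?N) = b"
        by (simp add: reassoc[OF l(5)])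
      then show "(b \<cdot> ?z) \<cdot> b = (?l \<cdot> tp C ?X) \<cdot> b"
        by (simp add: nat_p)
    qed simp_all
    have z0: "?z \<cdot> ?l = ?z \<cdot> tz C ?X"
      using additive_morphism_simps(8)[OF e] by (simp add: nats)
    have sq': "b1 \<cdot> (?l \<cdot> tp C ?X) = b2 \<cdot> (?l \<cdot> tp C ?X)" by (simp add: sq[symmetric])
    note f1 = fsum_simps[OF mt, of ?X "b1 \<cdot> ?l" "b2 \<cdot> ?l", simplified, OF sq']
    have s1: "?s \<cdot> ?l =
        fsum C (tangent_bundle C ?X) (b1 \<cdot> ?l) (b2 \<cdot> ?l)"
    proof (rule pb_eqI[OF ATp])
      show "(?s \<cdot> ?l) \<cdot> T a =
        fsum C (tangent_bundle C ?X) (b1 \<cdot> ?l) (b2 \<cdot> ?l) \<cdot> T a"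
        using fsum_comp[OF T_tangent_additive mt mt, of a "b1 \<cdot> ?l" "b2 \<cdot> ?l"] sq'
          fsum_comp[OF lift_additive_tangent[OF Q] mg mt, of "b1 \<cdot> a" "b2 \<cdot> a"]
        by (simp add: reassoc[OF s(4)])
      show "(?s \<cdot> ?l) \<cdot> T b =
        fsum C (tangent_bundle C ?X) (b1 \<cdot> ?l) (b2 \<cdot> ?l) \<cdot> T b"
        using fsum_comp[OF T_tangent_additive mt mt, of b "b1 \<cdot> ?l" "b2 \<cdot> ?l"] sq'
          fsum_zero_right[OF tangent_bundle_additive, of ?N "b1 \<cdot> (b \<cdot> tz C ?N)"]
        by (simp add: reassoc[OF s(5)])
    qed (use f1 in simp_all)
    show ?thesis
      by (simp add: additive_morphism_def hom_iff sq z0 s1)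
  qed
  have g: "?l \<cdot> tl C ?X = ?l \<cdot> T ?l"
  proof (rule pb_eqI[OF tpb_pullback[OF tpb_T[OF tpb_T[OF A]]]])
    have lT: "T ?l \<cdot> T (T a) = T a \<cdot> T (blift Q)" "T ?l \<cdot> T (T b) = T b \<cdot> T (tz C ?N)"
      by (simp_all add: T_comp[symmetric] del: T_comp)
    have "?l \<cdot> (T a \<cdot> tl C (total C Q)) = a \<cdot> (blift Q \<cdot> tl C (total C Q))"
      "?l \<cdot> (T b \<cdot> tl C ?N) = b \<cdot> (tz C ?N \<cdot> T (tz C ?N))"
      by (simp_all add: reassoc[OF l(4)] reassoc[OF l(5)])
    then show "(?l \<cdot> tl C ?X) \<cdot> T (T a) = (?l \<cdot> T ?l) \<cdot> T (T a)"
      "(?l \<cdot> tl C ?X) \<cdot> T (T b) = (?l \<cdot> T ?l) \<cdot> T (T b)"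
      by (simp_all add: nat_l lT reassoc[OF l(4)] reassoc[OF l(5)])
  qed simp_all
  have h: "tangent_pullback C (T b) (tz C ?N) (xi C ?P) (b1 \<cdot> b)"
  proof -
    let ?w = "pair C (bp1 Q) (bp2 Q) (b1 \<cdot> a) (b2 \<cdot> a)"
    note w = pair_props[OF fibred_magma_pullback[OF mg], of "b1 \<cdot> a" "b2 \<cdot> a", simplified]
    note [simp] = w(1-3)
    have "tangent_pullback C (bproj Q) (a \<cdot> bproj Q) (b2 \<cdot> a) b1"
      unfolding a by (rule tpb_paste[OF A tpb_sym[OF B]])
    \<comment> \<open>the induced map \<open>P\<^sub>2 \<rightarrow> E\<^sub>2\<close> is a pullback of \<open>a\<close>\<close>
    from tpb_cancel[OF tpb_sym[OF pb] this, of ?w]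
    have "tangent_pullback C (bp1 Q) a ?w b1" by (simp add: w)
    from tpb_paste[OF differential_universal[OF Q] tpb_paste'[OF A this]]
    have 1: "tangent_pullback C (T (bproj Q)) (tz C ?N \<cdot> T f) (?w \<cdot> xi C Q) (b1 \<cdot> b)"
      by (simp add: nats)
    have lz: "b1 \<cdot> (?l \<cdot> T b) = b2 \<cdot> (tz C ?X \<cdot> T b)"
      by (simp add: nats)
    note x = fsum_simps[OF mTP, of "b1 \<cdot> ?l" "b2 \<cdot> tz C ?X", simplified]
    have Tw: "T ?w \<cdot> T (bp2 Q) = T b2 \<cdot> T a"
      by (simp add: T_comp[symmetric] w del: T_comp)
    have "xi C ?P \<cdot> T a = ?w \<cdot> xi C Q"
      using fsum_comp[OF amT mTP mT, of "b1 \<cdot> ?l" "b2 \<cdot> tz C ?X"]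
        comp_fsum[OF mT, of "bp1 Q \<cdot> blift Q" "bp2 Q \<cdot> tz C (total C Q)" ?w]
      by (simp add: xi_def reassoc[OF w(4)] reassoc[OF w(5)] nats Tw fibred_magma_simps[OF mT, simplified])
    moreover have "xi C ?P \<cdot> T b = (b1 \<cdot> b) \<cdot> tz C ?N" "xi C ?P \<in> arr C"
      "src C (xi C ?P) = src C b1" "tgt C (xi C ?P) = tobj C ?X"
      using x lz by (simp_all add: xi_def)
    ultimately show ?thesis
      by (intro tpb_cancel[OF tpb_T[OF A] 1]) (simp_all add: xi_simps[OF Q])
  qed
  have "differential_bundle C ?P"
    unfolding differential_bundle_def
    using display_fold_pullbacks[OF db] B adP e f g h by (simp add: hom_iff)
  then show ?thesis using db by (simp add: display_bundle_def)
qed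

end

section \<open>Vertical vectors of a differential bundle\<close>

lemma (in tangent_cat) T_fsum:
  assumes "fibred_magma C Q" "tangent_pullback C (bproj Q) (bproj Q) (bp1 Q) (bp2 Q)"
    and "x \<in> arr C" "y \<in> arr C" "src C y = src C x" "tgt C x = total C Q" "tgt C y = total C Q"
    and "x \<cdot> bproj Q = y \<cdot> bproj Q"
  shows "T (fsum C Q x y) = fsum C (T_bundle C Q) (T x) (T y)"
  unfolding T_bundle_image by (rule T.S_fsum[OF assms])

locale dbundle = tangent_cat +
  fixes Q :: "'b bundle_data"
  assumes display: "display_bundle C Q"
begin

abbreviation q where "q \<equiv> bproj Q"
abbreviation l where "l \<equiv> blift Q"
abbreviation E where "E \<equiv> total C Q"
abbreviation M where "M \<equiv> base C Q"
abbreviation TQ where "TQ \<equiv> T_bundle C Q"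
abbreviation TTQ where "TTQ \<equiv> T_bundle C (T_bundle C Q)"

abbreviation linear_over_p where
  "linear_over_p K \<equiv> linear C (bproj TQ) (blift TQ) q l (tp C M) K"
abbreviation linear_over_q where
  "linear_over_q K \<equiv> linear C (tp C E) (tl C E) q l q K"

abbreviation pairE where "pairE \<equiv> pair C (bp1 Q) (bp2 Q)"

lemma diff: "differential_bundle C Q" and disp: "tangent_display C q"
  using display by (simp_all add: display_bundle_def)

lemma diffT: "differential_bundle C TQ"
  using T_bundle_display[OF display] by (simp add: display_bundle_def)

lemmas mg = differential_magma[OF diff] and mgT = differential_T_magma[OF diff]
  and mgTT = differential_T_magma[OF diffT] and adQ = differential_additive[OF diff]
  and adT = differential_additive[OF diffT] and pbQ = differential_tpb[OF diff]

lemmas bundle_simps [simp] = fibred_magma_simps[OF mg] fibred_magma_simps(13,14)[OF mgT, simplified]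
  additive_bundle_zero[OF adQ] differential_simps[OF diff] T_bundle_base[OF mg] T_bundle_base[OF mgT]
  xi_simps[OF diff]

lemmas bundle_simps_comp [simp] =
  reassoc2[OF differential_simps(4)[OF diff]] reassoc2[OF differential_simps(5)[OF diff]]
  reassoc2[OF differential_simps(6)[OF diff]] reassoc2[OF differential_simps(7)[OF diff]]
  reassoc[OF additive_bundle_zero(4)[OF adQ]]

text \<open>\<open>(k, e)\<close> is a generalised element of \<open>E\<^sub>2\<close>, \<open>vert k e\<close> is its image \<open>\<langle>k, e\<rangle> \<xi>\<close> in \<open>T E\<close>: the vector at \<open>e\<close> in
  the direction \<open>k\<close> of the fibre.  Likewise \<open>Tvert x y\<close> is the image of an element \<open>(x, y)\<close> of \<open>T E\<^sub>2\<close>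
  under \<open>T \<xi>\<close>.  Computing with these elements replaces computing with \<open>\<xi>\<close> and its pairings.\<close>

definition fib_pair :: "'b \<Rightarrow> 'b \<Rightarrow> bool" where
  "fib_pair k e \<longleftrightarrow> k \<in> arr C \<and> e \<in> arr C \<and> src C e = src C k \<and> tgt C k = E \<and> tgt C e = E \<and>
     k \<cdot> q = e \<cdot> q"

definition vert :: "'b \<Rightarrow> 'b \<Rightarrow> 'b" where
  "vert k e = fsum C TQ (k \<cdot> l) (e \<cdot> tz C E)"

definition Tvert :: "'b \<Rightarrow> 'b \<Rightarrow> 'b" where
  "Tvert x y = fsum C TTQ (x \<cdot> T l) (y \<cdot> T (tz C E))"

lemma q_z: "x \<in> arr C \<Longrightarrow> tgt C x = E \<Longrightarrow> x \<cdot> (tz C E \<cdot> T q) = (x \<cdot> q) \<cdot> tz C M"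
  by (simp add: nats)

lemma lift_Tz: "l \<cdot> T (tz C E) = tz C E \<cdot> (T l \<cdot> tc C E)"
proof -
  have "l \<cdot> T (tz C E) = l \<cdot> (tz C (tobj C E) \<cdot> tc C E)" by simp
  then show ?thesis by (simp add: nat_z' del: law_zc laws_comp)
qed

lemma p_additive: "additive_morphism C TQ Q (tp C M) (tp C E)"
  by (rule additive_morphismI[where k = "tp C (fibre2 C Q)"])
    (use mg mgT in \<open>simp_all add: nats\<close>)

lemma tl_additive: "additive_morphism C TQ TTQ (tl C M) (tl C E)"
  by (rule additive_morphismI[where k = "tl C (fibre2 C Q)"])
    (use mgTT mgT in \<open>simp_all add: nats\<close>)

lemma fib_pairD:
  assumes "fib_pair k e"
  shows "k \<in> arr C" "e \<in> arr C" "src C e = src C k" "tgt C k = E" "tgt C e = E" "k \<cdot> q = e \<cdot> q"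
    "k \<cdot> (tz C E \<cdot> T q) = e \<cdot> (tz C E \<cdot> T q)"
  using assms q_z[of k] q_z[of e] by (auto simp: fib_pair_def)

lemma fib_pair_comp:
  assumes k: "fib_pair k e" and u: "u \<in> arr C" "tgt C u = src C k"
  shows "fib_pair (u \<cdot> k) (u \<cdot> e)"
  using fib_pairD[OF k] u by (simp add: fib_pair_def)

lemma vert_simps:
  assumes k: "fib_pair k e"
  shows "vert k e \<in> arr C" "src C (vert k e) = src C k" "tgt C (vert k e) = tobj C E"
    "vert k e \<cdot> T q = (k \<cdot> q) \<cdot> tz C M" "vert k e \<cdot> tp C E = e"
proof -
  note [simp] = fib_pairD(1-5)[OF k]
  note f = fsum_simps[OF mgT, of "k \<cdot> l" "e \<cdot> tz C E", simplified, OF fib_pairD(7)[OF k]]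
  show "vert k e \<in> arr C" "src C (vert k e) = src C k" "tgt C (vert k e) = tobj C E"
    using f by (simp_all add: vert_def)
  show "vert k e \<cdot> T q = (k \<cdot> q) \<cdot> tz C M"
    using f by (simp add: vert_def q_z reassoc2[OF fib_pairD(6)[OF k]])
  have "vert k e \<cdot> tp C E = fsum C Q (k \<cdot> (q \<cdot> bzero Q)) e"
    using fsum_comp[OF p_additive mgT mg, of "k \<cdot> l" "e \<cdot> tz C E"] fib_pairD(7)[OF k]
    by (simp add: vert_def)
  also have "k \<cdot> (q \<cdot> bzero Q) = e \<cdot> (q \<cdot> bzero Q)"
    by (rule reassoc2[OF fib_pairD(6)[OF k]]) simp_all
  finally show "vert k e \<cdot> tp C E = e"
    using fsum_zero_left[OF adQ, of e] by simp
qed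

lemma comp_vert:
  assumes k: "fib_pair k e" and [simp]: "u \<in> arr C" "tgt C u = src C k"
  shows "u \<cdot> vert k e = vert (u \<cdot> k) (u \<cdot> e)"
proof -
  note [simp] = fib_pairD(1-5)[OF k]
  show ?thesis
    using comp_fsum[OF mgT, of "k \<cdot> l" "e \<cdot> tz C E" u] fib_pairD(7)[OF k] by (simp add: vert_def)
qed

lemma fib_pair_projections: "fib_pair (bp1 Q) (bp2 Q)"
  by (simp add: fib_pair_def)

lemma xi_vert: "xi C Q = vert (bp1 Q) (bp2 Q)"
  by (simp add: xi_def vert_def)

lemma fib_pair_props:
  assumes k: "fib_pair k e"
  shows "pairE k e \<in> arr C" "src C (pairE k e) = src C k"
    "tgt C (pairE k e) = fibre2 C Q"
    "pairE k e \<cdot> bp1 Q = k" "pairE k e \<cdot> bp2 Q = e"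
  using pair_props[OF fibred_magma_pullback[OF mg], of k e] fib_pairD[OF k] by simp_all

lemma pair_xi: "fib_pair k e \<Longrightarrow> pairE k e \<cdot> xi C Q = vert k e"
  by (simp add: xi_vert comp_vert fib_pair_projections fib_pair_props)

text \<open>Together with \<open>vert_ex\<close> this restates the universal property of \<open>\<xi>\<close>: the vertical vectors are exactly the
  \<open>vert k e\<close>, with unique \<open>k\<close> and \<open>e\<close>.\<close>

lemma vert_inj:
  assumes k: "fib_pair k e" and k': "fib_pair k' e'" and eq: "vert k e = vert k' e'"
  shows "k = k'" "e = e'"
proof -
  show e: "e = e'" using vert_simps(5)[OF k] vert_simps(5)[OF k'] eq by simp
  have s: "src C k = src C k'" using vert_simps(2)[OF k] vert_simps(2)[OF k'] eq by simp
  have k1: "fib_pair k e'" and eq1: "vert k e' = vert k' e'" using k eq unfolding e by simp_all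
  note [simp] = fib_pair_props[OF k1] fib_pair_props[OF k'] fib_pairD(1-5)[OF k1] fib_pairD(1-5)[OF k']
  let ?u = "pairE k e'" and ?u' = "pairE k' e'"
  have "?u = ?u'"
    by (rule pb_eqI[OF tpb_pullback[OF differential_universal[OF diff]]])
      (simp_all add: pair_xi[OF k1] pair_xi[OF k'] eq1 s reassoc[OF fib_pair_props(4)[OF k1]]
        reassoc[OF fib_pair_props(4)[OF k']] fib_pairD(6)[OF k1] fib_pairD(6)[OF k'])
  then have "?u \<cdot> bp1 Q = ?u' \<cdot> bp1 Q" by (simp only:)
  then show "k = k'" unfolding fib_pair_props(4)[OF k1] fib_pair_props(4)[OF k'] .
qed

lemma vert_zero_right:
  assumes [simp]: "k \<in> arr C" "tgt C k = E"
  shows "fib_pair k (k \<cdot> (q \<cdot> bzero Q))" "vert k (k \<cdot> (q \<cdot> bzero Q)) = k \<cdot> l"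
  using fsum_zero_right[OF adT, of "k \<cdot> l"] by (simp_all add: fib_pair_def vert_def nats)

lemma vert_zero_left:
  assumes [simp]: "e \<in> arr C" "tgt C e = E"
  shows "fib_pair (e \<cdot> (q \<cdot> bzero Q)) e" "vert (e \<cdot> (q \<cdot> bzero Q)) e = e \<cdot> tz C E"
  using fsum_zero_left[OF adT, of "e \<cdot> tz C E"] by (simp_all add: fib_pair_def vert_def nats)

lemma vert_ex:
  assumes [simp]: "f \<in> arr C" "tgt C f = tobj C E" "n \<in> arr C" "tgt C n = M" "src C n = src C f"
    and f: "f \<cdot> T q = n \<cdot> tz C M"
  obtains k where "fib_pair k (f \<cdot> tp C E)" "f = vert k (f \<cdot> tp C E)" "k \<cdot> q = n"
proof -
  let ?u = "pair C (xi C Q) (bp1 Q \<cdot> q) f n"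
  note u = pair_props[OF tpb_pullback[OF differential_universal[OF diff]], of f n, simplified, OF f]
  have fib_pair: "fib_pair (?u \<cdot> bp1 Q) (?u \<cdot> bp2 Q)"
    using u(1-3) by (simp add: fib_pair_def)
  have v: "vert (?u \<cdot> bp1 Q) (?u \<cdot> bp2 Q) = f"
    using u by (simp add: xi_vert comp_vert[OF fib_pair_projections])
  have p: "?u \<cdot> bp2 Q = f \<cdot> tp C E" using vert_simps(5)[OF fib_pair] v by simp
  show thesis
    using that[of "?u \<cdot> bp1 Q"] fib_pair v p u by simp
qed

lemma brace_vert:
  assumes k: "fib_pair k e"
  shows "brace C Q (vert k e) = k"
proof -
  note [simp] = fib_pairD(1-5)[OF k] fib_pair_props[OF k] vert_simps[OF k]
  let ?P = "\<lambda>u. u \<in> hom C (src C (vert k e)) (fibre2 C Q) \<and> u \<cdot> xi C Q = vert k e \<and>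
        u \<cdot> bp1 Q \<cdot> q = vert k e \<cdot> T q \<cdot> tp C M"
  have "(THE u. ?P u) = pairE k e"
  proof (rule the_equality)
    show "?P (pairE k e)" by (simp add: hom_iff pair_xi[OF k])
    fix u assume u: "?P u"
    then have [simp]: "u \<in> arr C" "src C u = src C k" "tgt C u = fibre2 C Q" by (simp_all add: hom_iff)
    have "vert (u \<cdot> bp1 Q) (u \<cdot> bp2 Q) = vert k e"
      using u by (simp add: xi_vert comp_vert[OF fib_pair_projections])
    from vert_inj[OF fib_pair_comp[OF fib_pair_projections] k this]
    show "u = pairE k e"
      by (intro pair_eqI[OF fibred_magma_pullback[OF mg], symmetric]) simp_all
  qed
  then show ?thesis by (simp add: brace_def)
qed

text \<open>The lift is the vertical vector \<open>\<langle>k, 0\<rangle> \<xi>\<close> at the zero of the fibre, so it is monic because \<open>\<xi>\<close> is.\<close>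

lemma lift_mono:
  assumes x: "x \<in> arr C" "tgt C x = E" and y: "y \<in> arr C" "tgt C y = E" and "x \<cdot> l = y \<cdot> l"
  shows "x = y"
  using vert_inj(1)[OF vert_zero_right(1)[OF x] vert_zero_right(1)[OF y]]
    vert_zero_right(2)[OF x] vert_zero_right(2)[OF y] assms(5) by simp

text \<open>For the zero, compose \<open>0 g l = 0 g z\<close> with \<open>p\<close>.  For the sum, both sides agree after the lift of \<open>Q\<close>,
  because lifts carry the sum of the bundle to the sum of the
  tangent bundle, and the latter is preserved by \<open>T g\<close>.\<close>

lemma linear_additive:
  assumes lin: "linear C (bproj Q') (blift Q') q l f g"
    and Q': "fibred_magma C Q'"
    and z: "bzero Q' \<in> arr C" "src C (bzero Q') = base C Q'" "tgt C (bzero Q') = total C Q'"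
      "bzero Q' \<cdot> bproj Q' = ident C (base C Q')"
    and l': "additive_morphism C Q' (tangent_bundle C (total C Q')) (bzero Q') (blift Q')"
  shows "additive_morphism C Q' Q f g"
proof -
  note [simp] = fibred_magma_simps[OF Q'] z additive_morphism_simps(1-6)[OF l', simplified]
  have [simp]: "f \<in> arr C" "src C f = base C Q'" "tgt C f = M"
    "g \<in> arr C" "src C g = total C Q'" "tgt C g = E" and
    gq: "g \<cdot> q = bproj Q' \<cdot> f" and gl: "g \<cdot> l = blift Q' \<cdot> T g"
    using lin by (simp_all add: linear_def hom_iff)
  note a = additive_morphism_simps(7-9)[OF l', simplified]
  \<comment> \<open>the lift of \<open>Q'\<close> agrees with the zero of the tangent bundle on zero vectors\<close>
  have "bzero Q' \<cdot> (g \<cdot> l) = bzero Q' \<cdot> (g \<cdot> tz C E)"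
    by (simp add: gl reassoc2[OF a(2)] nat_z)
  then have "(bzero Q' \<cdot> (g \<cdot> l)) \<cdot> tp C E = (bzero Q' \<cdot> (g \<cdot> tz C E)) \<cdot> tp C E" by simp
  then have zg: "bzero Q' \<cdot> g = f \<cdot> bzero Q"
    by (simp add: reassoc2[OF gq] reassoc[OF z(4)])
  have bq: "bp1 Q' \<cdot> (g \<cdot> q) = bp2 Q' \<cdot> (g \<cdot> q)"
    by (simp add: gq reassoc[OF fibred_magma_simps(14)[OF Q']])
  note fs = fsum_simps[OF mg, of "bp1 Q' \<cdot> g" "bp2 Q' \<cdot> g", simplified, OF bq]
  have b: "bp1 Q' \<cdot> (blift Q' \<cdot> tp C (total C Q')) = bp2 Q' \<cdot> (blift Q' \<cdot> tp C (total C Q'))"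
    by (simp add: a(1) reassoc[OF fibred_magma_simps(14)[OF Q']])
  have "bsum Q' \<cdot> g = fsum C Q (bp1 Q' \<cdot> g) (bp2 Q' \<cdot> g)"
  proof (rule lift_mono)
    have "bsum Q' \<cdot> (g \<cdot> l) = fsum C (tangent_bundle C (total C Q')) (bp1 Q' \<cdot> blift Q') (bp2 Q' \<cdot> blift Q') \<cdot> T g"
      by (simp add: gl reassoc[OF a(3)])
    also have "\<dots> = fsum C (tangent_bundle C E) (bp1 Q' \<cdot> (g \<cdot> l)) (bp2 Q' \<cdot> (g \<cdot> l))"
      using fsum_comp[OF T_tangent_additive[of g] tangent_bundle_magma tangent_bundle_magma,
          of "bp1 Q' \<cdot> blift Q'" "bp2 Q' \<cdot> blift Q'"] b by (simp add: gl)
    also have "\<dots> = fsum C Q (bp1 Q' \<cdot> g) (bp2 Q' \<cdot> g) \<cdot> l"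
      using fsum_comp[OF lift_additive_tangent[OF diff] mg tangent_bundle_magma,
          of "bp1 Q' \<cdot> g" "bp2 Q' \<cdot> g"] bq by simp
    finally show "(bsum Q' \<cdot> g) \<cdot> l = fsum C Q (bp1 Q' \<cdot> g) (bp2 Q' \<cdot> g) \<cdot> l" by simp
  qed (use fs in simp_all)
  then show ?thesis
    by (simp add: additive_morphism_def hom_iff gq zg)
qed

lemma Txi: "T (xi C Q) = Tvert (T (bp1 Q)) (T (bp2 Q))"
  unfolding xi_def Tvert_def
  using T_fsum[OF mgT, of "bp1 Q \<cdot> l" "bp2 Q \<cdot> tz C E"] tpb_T[OF pbQ]
    fib_pairD(7)[OF fib_pair_projections]
  by simp

definition Tfib_pair :: "'b \<Rightarrow> 'b \<Rightarrow> bool" where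
  "Tfib_pair x y \<longleftrightarrow> x \<in> arr C \<and> y \<in> arr C \<and> src C y = src C x \<and> tgt C x = tobj C E \<and>
     tgt C y = tobj C E \<and> x \<cdot> T q = y \<cdot> T q"

lemma T_vert:
  assumes k: "fib_pair k e"
  shows "T (vert k e) = Tvert (T k) (T e)"
  unfolding vert_def Tvert_def
  using T_fsum[OF mgT, of "k \<cdot> l" "e \<cdot> tz C E"] tpb_T[OF pbQ]
    fib_pairD[OF k]
  by simp

lemma TTq_lift: "T l \<cdot> T (T q) = T (tz C E) \<cdot> T (T q)"
  by (simp add: T_comp[symmetric] del: T_comp)

lemma TTq_z: "T (tz C E) \<cdot> T (T q) = T q \<cdot> T (tz C M)"
  by (simp add: T_comp[symmetric] nats del: T_comp)

lemma Tfib_pairD: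
  assumes "Tfib_pair x y"
  shows "x \<in> arr C" "y \<in> arr C" "src C y = src C x" "tgt C x = tobj C E" "tgt C y = tobj C E"
    "x \<cdot> T q = y \<cdot> T q" "x \<cdot> (T l \<cdot> T (T q)) = y \<cdot> (T (tz C E) \<cdot> T (T q))"
proof -
  show *: "x \<in> arr C" "y \<in> arr C" "src C y = src C x" "tgt C x = tobj C E" "tgt C y = tobj C E"
    "x \<cdot> T q = y \<cdot> T q"
    using assms by (simp_all add: Tfib_pair_def)
  show "x \<cdot> (T l \<cdot> T (T q)) = y \<cdot> (T (tz C E) \<cdot> T (T q))"
    unfolding TTq_lift TTq_z by (rule reassoc2[OF *(6)]) (use * in simp_all)
qed

lemma comp_Tvert:
  assumes k: "Tfib_pair x y" and [simp]: "u \<in> arr C" "tgt C u = src C x"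
  shows "u \<cdot> Tvert x y = Tvert (u \<cdot> x) (u \<cdot> y)"
  using comp_fsum[OF mgTT, of "x \<cdot> T l" "y \<cdot> T (tz C E)" u] Tfib_pairD[OF k] by (simp add: Tvert_def)

lemma Tfib_pair_projections: "Tfib_pair (T (bp1 Q)) (T (bp2 Q))"
  by (simp add: Tfib_pair_def)

lemma Tfib_pair_comp:
  assumes k: "Tfib_pair x y" and u: "u \<in> arr C" "tgt C u = src C x"
  shows "Tfib_pair (u \<cdot> x) (u \<cdot> y)"
  using Tfib_pairD[OF k] u by (simp add: Tfib_pair_def)

lemma Tvert_simps:
  assumes k: "Tfib_pair x y"
  shows "Tvert x y \<in> arr C" "src C (Tvert x y) = src C x" "tgt C (Tvert x y) = tobj C (tobj C E)"
  using fsum_simps[OF mgTT, of "x \<cdot> T l" "y \<cdot> T (tz C E)"] Tfib_pairD[OF k] by (simp_all add: Tvert_def)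

lemma Tvert_inj:
  assumes k: "Tfib_pair x y" and k': "Tfib_pair x' y'" and eq: "Tvert x y = Tvert x' y'" and y: "y = y'"
  shows "x = x'"
proof -
  have s: "src C x = src C x'" using Tvert_simps(2)[OF k] Tvert_simps(2)[OF k'] eq by simp
  let ?u = "pair C (T (bp1 Q)) (T (bp2 Q)) x y" and ?u' = "pair C (T (bp1 Q)) (T (bp2 Q)) x' y'"
  note pbT = tpb_pullback[OF tpb_T[OF pbQ]]
  have u: "?u \<in> arr C" "src C ?u = src C x" "tgt C ?u = tobj C (fibre2 C Q)"
      "?u \<cdot> T (bp1 Q) = x" "?u \<cdot> T (bp2 Q) = y"
    using pair_props[OF pbT, of x y] Tfib_pairD[OF k] by simp_all
  have u': "?u' \<in> arr C" "src C ?u' = src C x'" "tgt C ?u' = tobj C (fibre2 C Q)"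
      "?u' \<cdot> T (bp1 Q) = x'" "?u' \<cdot> T (bp2 Q) = y'"
    using pair_props[OF pbT, of x' y'] Tfib_pairD[OF k'] by simp_all
  have "?u = ?u'"
  proof (rule pb_eqI[OF tpb_pullback[OF tpb_T[OF differential_universal[OF diff]]]])
    show "?u \<cdot> T (xi C Q) = ?u' \<cdot> T (xi C Q)"
      using u u' eq by (simp add: Txi comp_Tvert[OF Tfib_pair_projections])
    have "x \<cdot> T q = x' \<cdot> T q" using Tfib_pairD(6)[OF k] Tfib_pairD(6)[OF k'] y by simp
    then show "?u \<cdot> T (bp1 Q \<cdot> q) = ?u' \<cdot> T (bp1 Q \<cdot> q)"
      using u u' reassoc[OF u(4), of "T q"] reassoc[OF u'(4), of "T q"] by simp
  qed (use u u' s in simp_all)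
  then have "?u \<cdot> T (bp1 Q) = ?u' \<cdot> T (bp1 Q)" by (simp only:)
  then show ?thesis unfolding u(4) u'(4) .
qed

text \<open>The two linear structures of \<open>T E\<close> on vertical vectors: the lift of \<open>T q\<close> acts on both components by
  the lift of \<open>q\<close>, whereas \<open>l\<^sub>E\<close> keeps the base point \<open>e\<close> at rest.\<close>

lemma vert_lift:
  assumes k: "fib_pair k e"
  shows "vert k e \<cdot> (T l \<cdot> tc C E) = Tvert (k \<cdot> l) (e \<cdot> l)" "Tfib_pair (k \<cdot> l) (e \<cdot> l)"
proof -
  note [simp] = fib_pairD(1-5)[OF k]
  show "Tfib_pair (k \<cdot> l) (e \<cdot> l)" using fib_pairD(7)[OF k] by (simp add: Tfib_pair_def)
  have "vert k e \<cdot> (T l \<cdot> tc C E) = fsum C TTQ (k \<cdot> (l \<cdot> (T l \<cdot> tc C E))) (e \<cdot> (tz C E \<cdot> (T l \<cdot> tc C E)))"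
    using fsum_comp[OF lift_additive_T[OF diffT] mgT mgTT, of "k \<cdot> l" "e \<cdot> tz C E"] fib_pairD(7)[OF k]
    by (simp add: vert_def)
  then show "vert k e \<cdot> (T l \<cdot> tc C E) = Tvert (k \<cdot> l) (e \<cdot> l)"
    using reassoc[OF differential_simps(7)[OF diff], of "tc C E"]
    by (simp add: Tvert_def lift_Tz)
qed

lemma vert_tl:
  assumes k: "fib_pair k e"
  shows "vert k e \<cdot> tl C E = Tvert (k \<cdot> l) (e \<cdot> tz C E)" "Tfib_pair (k \<cdot> l) (e \<cdot> tz C E)"
proof -
  note [simp] = fib_pairD(1-5)[OF k]
  show "Tfib_pair (k \<cdot> l) (e \<cdot> tz C E)" using fib_pairD(7)[OF k] by (simp add: Tfib_pair_def)
  show "vert k e \<cdot> tl C E = Tvert (k \<cdot> l) (e \<cdot> tz C E)"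
    using fsum_comp[OF tl_additive mgT mgTT, of "k \<cdot> l" "e \<cdot> tz C E"] fib_pairD(7)[OF k]
    by (simp add: vert_def Tvert_def)
qed

end

section \<open>Linear Ehresmann and Koszul connections\<close>

locale conn = dbundle +
  fixes \<iota> tV qF tF :: 'b
  assumes vp: "vertical_pullback C q \<iota> tV" and fpb: "finsler_pullback C q qF tF"
begin

abbreviation V where "V \<equiv> src C \<iota>"
abbreviation F where "F \<equiv> src C qF"
abbreviation \<pi> where "\<pi> \<equiv> hdescent C q qF tF"

lemma vpb: "tangent_pullback C (T q) (tz C M) \<iota> tV"
  using vp by (simp add: vertical_pullback_def)

lemma fpbk: "tangent_pullback C q (tp C M) qF tF"
  using fpb by (simp add: finsler_pullback_def)

lemma iota_simps [simp]:
  "\<iota> \<in> arr C" "tgt C \<iota> = tobj C E" "tV \<in> arr C" "src C tV = V" "tgt C tV = M" "V \<in> obj C"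
  using tpb_simps[OF vpb] by simp_all

lemma finsler_simps [simp]:
  "qF \<in> arr C" "tgt C qF = E" "tF \<in> arr C" "src C tF = F" "tgt C tF = tobj C M" "F \<in> obj C"
  using tpb_simps[OF fpbk] by simp_all

lemma iota_Tq: "\<iota> \<cdot> T q = tV \<cdot> tz C M"
  using tpb_comm[OF vpb] .

lemma finsler_comm: "qF \<cdot> q = tF \<cdot> tp C M"
  using tpb_comm[OF fpbk] .

text \<open>\<open>\<iota>\<close> is a pullback of \<open>z\<close>, and \<open>z\<close> and \<open>T z\<close> are split by \<open>p\<close> and \<open>T p\<close>.  So \<open>\<iota>\<close> and \<open>T \<iota>\<close> are monic, and
  equations between maps to \<open>V q\<close> or \<open>T (V q)\<close> can be tested in \<open>T E\<close> or \<open>T (T E)\<close>.\<close>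

lemma iota_mono:
  assumes [simp]: "x \<in> arr C" "y \<in> arr C" "src C x = src C y" "tgt C x = V" "tgt C y = V"
    and eq: "x \<cdot> \<iota> = y \<cdot> \<iota>"
  shows "x = y"
proof (rule pb_eqI[OF tpb_pullback[OF vpb]])
  have "x \<cdot> (\<iota> \<cdot> T q) = y \<cdot> (\<iota> \<cdot> T q)" by (rule reassoc2[OF eq]) simp_all
  then have e: "x \<cdot> tV \<cdot> tz C M = y \<cdot> tV \<cdot> tz C M" by (simp add: iota_Tq)
  have "(x \<cdot> tV) \<cdot> (tz C M \<cdot> tp C M) = (y \<cdot> tV) \<cdot> (tz C M \<cdot> tp C M)"
    by (rule reassoc2[OF e]) simp_all
  then show "x \<cdot> tV = y \<cdot> tV" by simp
qed (use eq in simp_all)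

lemma Tiota_mono:
  assumes [simp]: "x \<in> arr C" "y \<in> arr C" "src C x = src C y" "tgt C x = tobj C V" "tgt C y = tobj C V"
    and eq: "x \<cdot> T \<iota> = y \<cdot> T \<iota>"
  shows "x = y"
proof (rule pb_eqI[OF tpb_pullback[OF tpb_T[OF vpb]]])
  have i: "T \<iota> \<cdot> T (T q) = T tV \<cdot> T (tz C M)"
    by (simp add: T_comp[symmetric] iota_Tq del: T_comp)
  have "x \<cdot> (T \<iota> \<cdot> T (T q)) = y \<cdot> (T \<iota> \<cdot> T (T q))" by (rule reassoc2[OF eq]) simp_all
  then have e: "x \<cdot> T tV \<cdot> T (tz C M) = y \<cdot> T tV \<cdot> T (tz C M)" by (simp add: i)
  have "(x \<cdot> T tV) \<cdot> (T (tz C M) \<cdot> T (tp C M)) = (y \<cdot> T tV) \<cdot> (T (tz C M) \<cdot> T (tp C M))"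
    by (rule reassoc2[OF e]) simp_all
  moreover have "T (tz C M) \<cdot> T (tp C M) = ident C (tobj C M)"
    by (simp add: T_comp[symmetric] del: T_comp)
  ultimately show "x \<cdot> T tV = y \<cdot> T tV" by simp
qed (use eq in simp_all)

lemma vproj_eq [simp]: "vproj C q \<iota> = \<iota> \<cdot> tp C E"
  by (simp add: vproj_def)

lemma vzero_simps [simp]:
  "vzero C q \<iota> \<in> arr C" "src C (vzero C q \<iota>) = E" "tgt C (vzero C q \<iota>) = V"
  "vzero C q \<iota> \<cdot> \<iota> = tz C E"
proof -
  let ?P = "\<lambda>h. h \<in> hom C (src C q) V \<and> h \<cdot> \<iota> = tz C (src C q)"
  have "tz C E \<cdot> T q = q \<cdot> tz C M" by (simp add: nats)
  note h = pair_props[OF tpb_pullback[OF vpb], of "tz C E" q, simplified, OF this]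
  have "?P (THE h. ?P h)"
  proof (rule theI)
    show "?P (pair C \<iota> tV (tz C E) q)" using h by (simp add: hom_iff)
    fix k assume k: "?P k"
    then have k: "k \<in> arr C" "src C k = E" "tgt C k = V" "k \<cdot> \<iota> = tz C E" by (simp_all add: hom_iff)
    show "k = pair C \<iota> tV (tz C E) q"
      by (rule iota_mono) (use h k in simp_all)
  qed
  then show "vzero C q \<iota> \<in> arr C" "src C (vzero C q \<iota>) = E" "tgt C (vzero C q \<iota>) = V"
    "vzero C q \<iota> \<cdot> \<iota> = tz C E"
    by (simp_all add: vzero_def hom_iff)
qed

lemma vlift_simps [simp]:
  "vlift C q \<iota> \<in> arr C" "src C (vlift C q \<iota>) = V" "tgt C (vlift C q \<iota>) = tobj C V"
  "vlift C q \<iota> \<cdot> T \<iota> = \<iota> \<cdot> tl C E"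
proof -
  let ?P = "\<lambda>h. h \<in> hom C V (tobj C V) \<and> h \<cdot> T \<iota> = \<iota> \<cdot> tl C (src C q)"
  have "\<iota> \<cdot> (T q \<cdot> tl C M) = tV \<cdot> (tz C M \<cdot> T (tz C M))"
    by (simp add: reassoc[OF iota_Tq])
  then have "\<iota> \<cdot> (tl C E \<cdot> T (T q)) = tV \<cdot> (tz C M \<cdot> T (tz C M))" by (simp add: nat_l)
  note h = pair_props[OF tpb_pullback[OF tpb_T[OF vpb]], of "\<iota> \<cdot> tl C E" "tV \<cdot> tz C M", simplified, OF this]
  have "?P (THE h. ?P h)"
  proof (rule theI)
    show "?P (pair C (T \<iota>) (T tV) (\<iota> \<cdot> tl C E) (tV \<cdot> tz C M))" using h by (simp add: hom_iff)
    fix k assume "?P k"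
    then have k: "k \<in> arr C" "src C k = V" "tgt C k = tobj C V" "k \<cdot> T \<iota> = \<iota> \<cdot> tl C E"
      by (simp_all add: hom_iff)
    show "k = pair C (T \<iota>) (T tV) (\<iota> \<cdot> tl C E) (tV \<cdot> tz C M)"
      by (rule Tiota_mono) (use h k in simp_all)
  qed
  then show "vlift C q \<iota> \<in> arr C" "src C (vlift C q \<iota>) = V" "tgt C (vlift C q \<iota>) = tobj C V"
    "vlift C q \<iota> \<cdot> T \<iota> = \<iota> \<cdot> tl C E"
    by (simp_all add: vlift_def hom_iff)
qed

lemma hdescent_simps [simp]:
  "\<pi> \<in> arr C" "src C \<pi> = tobj C E" "tgt C \<pi> = F" "\<pi> \<cdot> qF = tp C E" "\<pi> \<cdot> tF = T q"
  using pair_props[OF tpb_pullback[OF fpbk], of "tp C E" "T q"] by (simp_all add: hdescent_def nat_p)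

lemma iota_vert:
  obtains w where "fib_pair w (\<iota> \<cdot> tp C E)" "\<iota> = vert w (\<iota> \<cdot> tp C E)"
  using vert_ex[of \<iota> tV] iota_Tq by (metis iota_simps bundle_simps(16))

lemma lift_factors:
  obtains l' where "l' \<in> arr C" "src C l' = E" "tgt C l' = V" "l' \<cdot> \<iota> = l"
proof -
  have "tz C E \<cdot> T q = q \<cdot> tz C M" by (simp add: nats)
  from pair_props[OF tpb_pullback[OF vpb], of l q, simplified, OF this] that show thesis
    by (metis bundle_simps)
qed

end

text \<open>\<open>R\<close> and \<open>K\<close> determine each other, because \<open>\<iota>\<close> and \<open>\<xi>\<close> are monic.\<close>

locale conn_R = conn +
  fixes R K :: 'b
  assumes R_hom [simp]: "R \<in> arr C" "src C R = tobj C E" "tgt C R = V"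
    and RK: "R \<cdot> \<iota> = vert K (tp C E)" and Kfp: "fib_pair K (tp C E)"
begin

lemma K_simps [simp]: "K \<in> arr C" "src C K = tobj C E" "tgt C K = E" "K \<cdot> q = tp C E \<cdot> q"
  using fib_pairD[OF Kfp] by simp_all

lemma TK_Tq: "T K \<cdot> T q = T (tp C E) \<cdot> T q"
  by (simp add: T_comp[symmetric] del: T_comp)

lemma K_brace: "brace C Q (R \<cdot> \<iota>) = K"
  unfolding RK by (rule brace_vert[OF Kfp])

lemma R_vproj: "R \<cdot> (\<iota> \<cdot> tp C E) = tp C E"
  using reassoc[OF RK, of "tp C E"] vert_simps(5)[OF Kfp] by simp

lemma R_tV: "R \<cdot> tV = T q \<cdot> tp C M"
proof -
  have "R \<cdot> (\<iota> \<cdot> (T q \<cdot> tp C M)) = R \<cdot> (\<iota> \<cdot> (tp C E \<cdot> q))" by (simp add: nat_p)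
  also have "\<dots> = tp C E \<cdot> q" using reassoc[of R "\<iota> \<cdot> tp C E", OF R_vproj, of q] by simp
  also have "R \<cdot> (\<iota> \<cdot> (T q \<cdot> tp C M)) = R \<cdot> tV"
    by (simp add: reassoc[OF iota_Tq])
  finally show ?thesis by (simp add: nat_p)
qed

text \<open>Linearity of \<open>R\<close> is an equation between maps to \<open>T (V q)\<close>, hence between vertical elements of \<open>T (T E)\<close>.
  It splits into components: the one at the base point always holds, the other one is linearity of \<open>K\<close>.\<close>

lemma linear_over_E_iff:
  "linear C (tp C E) (tl C E) (vproj C q \<iota>) (vlift C q \<iota>) (ident C E) R \<longleftrightarrow>
   linear_over_q K"
proof -
  have k: "Tfib_pair (tl C E \<cdot> T K) (tl C E \<cdot> T (tp C E))" "Tfib_pair (T K) (T (tp C E))"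
    unfolding Tfib_pair_def by (simp_all add: TK_Tq)
  have TR: "T R \<cdot> T \<iota> = Tvert (T K) (T (tp C E))"
    by (simp add: T_comp[symmetric] RK T_vert[OF Kfp] del: T_comp)
  have "R \<cdot> vlift C q \<iota> = tl C E \<cdot> T R \<longleftrightarrow> (R \<cdot> vlift C q \<iota>) \<cdot> T \<iota> = (tl C E \<cdot> T R) \<cdot> T \<iota>"
    by (rule iffI, erule arg_cong[where f = "\<lambda>x. x \<cdot> T \<iota>"], rule Tiota_mono) simp_all
  also have "\<dots> \<longleftrightarrow> vert K (tp C E) \<cdot> tl C E = Tvert (tl C E \<cdot> T K) (tl C E \<cdot> T (tp C E))"
    by (simp add: reassoc[OF RK] TR comp_Tvert[OF k(2)] del: law_lTp)
  also have "\<dots> \<longleftrightarrow> K \<cdot> l = tl C E \<cdot> T K"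
  proof
    assume a: "vert K (tp C E) \<cdot> tl C E = Tvert (tl C E \<cdot> T K) (tl C E \<cdot> T (tp C E))"
    show "K \<cdot> l = tl C E \<cdot> T K"
      by (rule Tvert_inj[OF vert_tl(2)[OF Kfp] k(1) a[unfolded vert_tl(1)[OF Kfp]]]) simp
  next
    assume b: "K \<cdot> l = tl C E \<cdot> T K"
    show "vert K (tp C E) \<cdot> tl C E = Tvert (tl C E \<cdot> T K) (tl C E \<cdot> T (tp C E))"
      unfolding vert_tl(1)[OF Kfp] b by simp
  qed
  finally show ?thesis
    by (simp add: linear_def hom_iff R_vproj)
qed

lemma linear_over_TM_iff:
  "linear C (bproj TQ) (blift TQ) tV (pb_lift C (blift TQ) \<iota> tV) (tp C M) R \<longleftrightarrow>
   linear_over_p K"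
proof -
  have "tangent_pullback C (bproj TQ) (tz C M) \<iota> tV" using vpb by simp
  note pl = pb_lift_simps[OF diffT this, simplified]
  have k: "Tfib_pair (T l \<cdot> (tc C E \<cdot> T K)) (T l \<cdot> (tc C E \<cdot> T (tp C E)))" "Tfib_pair (T K) (T (tp C E))"
    unfolding Tfib_pair_def by (simp_all add: TK_Tq)
  have TR: "T R \<cdot> T \<iota> = Tvert (T K) (T (tp C E))"
    by (simp add: T_comp[symmetric] RK T_vert[OF Kfp] del: T_comp)
  let ?L = "pb_lift C (T l \<cdot> tc C E) \<iota> tV"
  have "R \<cdot> ?L = T l \<cdot> (tc C E \<cdot> T R) \<longleftrightarrow> (R \<cdot> ?L) \<cdot> T \<iota> = (T l \<cdot> (tc C E \<cdot> T R)) \<cdot> T \<iota>"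
    by (rule iffI, erule arg_cong[where f = "\<lambda>x. x \<cdot> T \<iota>"], rule Tiota_mono) (simp_all add: pl)
  also have "\<dots> \<longleftrightarrow> vert K (tp C E) \<cdot> (T l \<cdot> tc C E) =
      Tvert (T l \<cdot> (tc C E \<cdot> T K)) (T l \<cdot> (tc C E \<cdot> T (tp C E)))"
    using pl by (simp add: reassoc[OF RK] TR comp_Tvert[OF k(2)] comp_Tvert[OF Tfib_pair_comp[OF k(2)]] Tfib_pair_comp[OF k(2)] del: law_cTp laws_comp)
  also have "\<dots> \<longleftrightarrow> K \<cdot> l = T l \<cdot> (tc C E \<cdot> T K)"
  proof
    have pl: "tp C E \<cdot> l = T l \<cdot> (tc C E \<cdot> T (tp C E))" by (simp add: nat_p)
    { assume a: "vert K (tp C E) \<cdot> (T l \<cdot> tc C E) =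
        Tvert (T l \<cdot> (tc C E \<cdot> T K)) (T l \<cdot> (tc C E \<cdot> T (tp C E)))"
      show "K \<cdot> l = T l \<cdot> (tc C E \<cdot> T K)"
        by (rule Tvert_inj[OF vert_lift(2)[OF Kfp] k(1) a[unfolded vert_lift(1)[OF Kfp]] pl])
    next
      assume b: "K \<cdot> l = T l \<cdot> (tc C E \<cdot> T K)"
      show "vert K (tp C E) \<cdot> (T l \<cdot> tc C E) =
        Tvert (T l \<cdot> (tc C E \<cdot> T K)) (T l \<cdot> (tc C E \<cdot> T (tp C E)))"
        unfolding vert_lift(1)[OF Kfp] b pl .. }
  qed
  finally show ?thesis
    using pl by (simp add: linear_def hom_iff R_tV nat_p)
qed

text \<open>The lift is vertical, so \<open>R \<iota>\<close> fixes it: \<open>\<langle>l K, q z\<rangle> \<xi> = l = \<langle>id, q z\<rangle> \<xi>\<close>.\<close>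

lemma split_imp_koszul:
  assumes "\<iota> \<cdot> R = ident C V"
  shows "l \<cdot> K = ident C E"
proof -
  obtain l' where l' [simp]: "l' \<in> arr C" "src C l' = E" "tgt C l' = V" "l' \<cdot> \<iota> = l"
    using lift_factors by blast
  have "l \<cdot> (R \<cdot> \<iota>) = l' \<cdot> ((\<iota> \<cdot> R) \<cdot> \<iota>)" using reassoc[OF l'(4), of "R \<cdot> \<iota>"] by simp
  also have "\<dots> = l" unfolding assms by simp
  finally have *: "vert (l \<cdot> K) (l \<cdot> tp C E) = l"
    by (simp add: RK comp_vert[OF Kfp])
  have "vert (ident C E) (ident C E \<cdot> (q \<cdot> bzero Q)) = l"
    using vert_zero_right(2)[of "ident C E"] by simp
  with * have "vert (l \<cdot> K) (l \<cdot> tp C E) = vert (ident C E) (ident C E \<cdot> (q \<cdot> bzero Q))" by simp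
  from vert_inj(1)[OF fib_pair_comp[OF Kfp] vert_zero_right(1) this] show ?thesis by simp
qed

lemma K_additive:
  assumes "linear_over_p K"
  shows "additive_morphism C TQ Q (tp C M) K"
  by (rule linear_additive[OF assms mgT])
    (use lift_additive_tangent[OF diffT] additive_bundle_zero[OF adT] in simp_all)

lemma tangent_lift_additive:
  assumes [simp]: "A \<in> obj C"
  shows "additive_morphism C (tangent_bundle C A) (tangent_bundle C (tobj C A)) (tz C A) (tl C A)"
  using additive_morphism_comp[OF law_add_l law_add_c, of A] tangent_bundle_magma[of A]
    T_bundle_magma[OF tangent_bundle_magma[of A]] tangent_bundle_magma[of "tobj C A"] tangent_bundle_tpb[of A]
  by (simp add: T_bundle_base[OF tangent_bundle_magma[of A]])

lemma K_additive_E: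
  assumes "linear_over_q K"
  shows "additive_morphism C (tangent_bundle C E) Q q K"
  by (rule linear_additive) (use assms tangent_bundle_magma tangent_lift_additive in simp_all)

text \<open>\<open>K\<close> is additive for both additions of \<open>T E\<close>.  Hence it sends \<open>\<langle>k, e\<rangle> \<xi>\<close>, the sum over \<open>T M\<close> of \<open>k l\<close> and
  \<open>0\<^sub>e\<close>, to \<open>k l K + 0 = k\<close>.\<close>

lemma K_vert:
  assumes 1: "linear_over_p K"
    and 2: "linear_over_q K" and lK: "l \<cdot> K = ident C E"
    and k: "fib_pair k e"
  shows "vert k e \<cdot> K = k"
proof -
  note [simp] = fib_pairD(1-5)[OF k]
  have zK: "tz C E \<cdot> K = q \<cdot> bzero Q"
    using additive_morphism_simps(8)[OF K_additive_E[OF 2]] by simp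
  have "vert k e \<cdot> K = fsum C Q k (e \<cdot> (q \<cdot> bzero Q))"
    using fsum_comp[OF K_additive[OF 1] mgT mg, of "k \<cdot> l" "e \<cdot> tz C E"] fib_pairD(7)[OF k]
    by (simp add: vert_def lK zK)
  also have "e \<cdot> (q \<cdot> bzero Q) = k \<cdot> (q \<cdot> bzero Q)"
    by (rule reassoc2[OF fib_pairD(6)[OF k], symmetric]) simp_all
  finally show ?thesis using fsum_zero_right[OF adQ, of k] by simp
qed

lemma koszul_imp_split:
  assumes "linear_over_p K"
    and "linear_over_q K" and "l \<cdot> K = ident C E"
  shows "\<iota> \<cdot> R = ident C V"
proof (rule iota_mono)
  obtain w where w: "fib_pair w (\<iota> \<cdot> tp C E)" "\<iota> = vert w (\<iota> \<cdot> tp C E)"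
    using iota_vert by blast
  have "\<iota> \<cdot> (R \<cdot> \<iota>) = vert (\<iota> \<cdot> K) (\<iota> \<cdot> tp C E)"
    by (simp add: RK comp_vert[OF Kfp])
  also have "\<iota> \<cdot> K = vert w (\<iota> \<cdot> tp C E) \<cdot> K" using w(2) by (rule arg_cong)
  also have "\<dots> = w" by (rule K_vert[OF assms w(1)])
  finally show "(\<iota> \<cdot> R) \<cdot> \<iota> = ident C V \<cdot> \<iota>" using w(2) by simp
qed simp_all

end

locale conn_RH = conn_R +
  fixes H :: 'b
  assumes H_hom [simp]: "H \<in> arr C" "src C H = F" "tgt C H = tobj C E"
begin

lemma HR_iff:
  assumes p: "H \<cdot> tp C E = qF"
  shows "H \<cdot> R = qF \<cdot> vzero C q \<iota> \<longleftrightarrow> H \<cdot> K = qF \<cdot> (q \<cdot> bzero Q)"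
proof -
  have "H \<cdot> R = qF \<cdot> vzero C q \<iota> \<longleftrightarrow> (H \<cdot> R) \<cdot> \<iota> = (qF \<cdot> vzero C q \<iota>) \<cdot> \<iota>"
    by (rule iffI, erule arg_cong[where f = "\<lambda>x. x \<cdot> \<iota>"], rule iota_mono) simp_all
  also have "\<dots> \<longleftrightarrow> vert (H \<cdot> K) (H \<cdot> tp C E) = qF \<cdot> tz C E"
    by (simp add: RK comp_vert[OF Kfp])
  also have "\<dots> \<longleftrightarrow> vert (H \<cdot> K) (H \<cdot> tp C E) = vert (qF \<cdot> (q \<cdot> bzero Q)) qF"
    by (simp add: vert_zero_left)
  also have "\<dots> \<longleftrightarrow> H \<cdot> K = qF \<cdot> (q \<cdot> bzero Q)"
    using vert_inj(1)[OF fib_pair_comp[OF Kfp] vert_zero_left(1), of H qF] p by auto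
  finally show ?thesis .
qed

lemma sum_iff:
  assumes p: "H \<cdot> tp C E = qF"
  shows "(\<exists>u \<in> hom C (tobj C E) (tw C E). u \<cdot> tw1 C E = R \<cdot> \<iota> \<and> u \<cdot> tw2 C E = \<pi> \<cdot> H \<and>
      u \<cdot> ts C E = ident C (tobj C E)) \<longleftrightarrow>
    fsum C (tangent_bundle C E) (vert K (tp C E)) (\<pi> \<cdot> H) = ident C (tobj C E)"
proof -
  note pt = tpb_pullback[OF tangent_bundle_tpb[of E]]
  let ?u = "pair C (tw1 C E) (tw2 C E) (vert K (tp C E)) (\<pi> \<cdot> H)"
  note u = pair_props[OF pt, of "vert K (tp C E)" "\<pi> \<cdot> H"]
  have u: "?u \<in> hom C (tobj C E) (tw C E)"
    "?u \<cdot> tw1 C E = vert K (tp C E)"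
    "?u \<cdot> tw2 C E = \<pi> \<cdot> H"
    using u vert_simps[OF Kfp] p by (simp_all add: hom_iff)
  show ?thesis
  proof
    assume "\<exists>u \<in> hom C (tobj C E) (tw C E). u \<cdot> tw1 C E = R \<cdot> \<iota> \<and> u \<cdot> tw2 C E = \<pi> \<cdot> H \<and>
      u \<cdot> ts C E = ident C (tobj C E)"
    then obtain v where v: "v \<in> arr C" "src C v = tobj C E" "tgt C v = tw C E"
      "v \<cdot> tw1 C E = vert K (tp C E)" "v \<cdot> tw2 C E = \<pi> \<cdot> H" "v \<cdot> ts C E = ident C (tobj C E)"
      by (auto simp: hom_iff RK)
    have "?u = v"
      by (rule pair_eqI[OF pt[simplified]]) (use v vert_simps[OF Kfp] in simp_all)
    then show "fsum C (tangent_bundle C E) (vert K (tp C E)) (\<pi> \<cdot> H) = ident C (tobj C E)"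
      using v(6) by (simp add: fsum_def)
  next
    assume "fsum C (tangent_bundle C E) (vert K (tp C E)) (\<pi> \<cdot> H) = ident C (tobj C E)"
    then show "\<exists>u \<in> hom C (tobj C E) (tw C E). u \<cdot> tw1 C E = R \<cdot> \<iota> \<and> u \<cdot> tw2 C E = \<pi> \<cdot> H \<and>
      u \<cdot> ts C E = ident C (tobj C E)"
      using u by (intro bexI[OF _ u(1)]) (simp add: fsum_def RK)
  qed
qed

lemma koszul_iff:
  "koszul_connection C Q qF tF K H \<longleftrightarrow>
      (l \<cdot> K = ident C E \<and> linear_over_p K \<and>
        linear_over_q K) \<and>
      (H \<cdot> \<pi> = ident C F \<and> linear C qF (flift C q qF tF) (tp C E) (tl C E) (ident C E) H \<and>
        linear C tF (pb_lift C l qF tF) (bproj TQ) (blift TQ) (ident C (tobj C M)) H) \<and>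
      H \<cdot> K = qF \<cdot> (q \<cdot> bzero Q) \<and>
      fsum C (tangent_bundle C E) (vert K (tp C E)) (\<pi> \<cdot> H) = ident C (tobj C E)"
  unfolding koszul_connection_def vertical_koszul_def horizontal_koszul_def pair_xi[OF Kfp]
  using fpb by (simp add: hom_iff)

text \<open>The axioms correspond one by one, where \<open>\<iota> R = id\<close> is derived from \<open>l K = id\<close> by means of the linearity
  of \<open>K\<close>.\<close>

theorem linear_ehresmann_iff_koszul:
  "linear_ehresmann_connection C Q \<iota> tV qF tF R H \<longleftrightarrow> koszul_connection C Q qF tF K H"
proof -
  have p: "linear C qF (flift C q qF tF) (tp C E) (tl C E) (ident C E) H \<Longrightarrow> H \<cdot> tp C E = qF"
    by (simp add: linear_def)
  have L: "linear_ehresmann_connection C Q \<iota> tV qF tF R H \<longleftrightarrow>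
      (\<iota> \<cdot> R = ident C V \<and> linear_over_q K) \<and>
      (H \<cdot> \<pi> = ident C F \<and> linear C qF (flift C q qF tF) (tp C E) (tl C E) (ident C E) H) \<and>
      H \<cdot> R = qF \<cdot> vzero C q \<iota> \<and>
      (\<exists>u \<in> hom C (tobj C E) (tw C E). u \<cdot> tw1 C E = R \<cdot> \<iota> \<and> u \<cdot> tw2 C E = \<pi> \<cdot> H \<and>
        u \<cdot> ts C E = ident C (tobj C E)) \<and>
      linear_over_p K \<and>
      linear C tF (pb_lift C l qF tF) (bproj TQ) (blift TQ) (ident C (tobj C M)) H"
    unfolding linear_ehresmann_connection_def ehresmann_connection_def vertical_connection_def
      horizontal_connection_def linear_over_TM_iff
    unfolding bundle_simps linear_over_E_iff
    using vp fpb by (simp add: hom_iff)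
  show ?thesis
    unfolding L koszul_iff using p split_imp_koszul koszul_imp_split HR_iff sum_iff by blast
qed

end

section \<open>Fibre products of tangent bundles\<close>

context tangent_cat
begin

lemma tw_pb: "A \<in> obj C \<Longrightarrow> is_pullback C (tp C A) (tp C A) (tw1 C A) (tw2 C A)"
  using tpb_pullback[OF tangent_bundle_tpb] .

lemma Ttw_pb: "A \<in> obj C \<Longrightarrow> is_pullback C (T (tp C A)) (T (tp C A)) (T (tw1 C A)) (T (tw2 C A))"
  using tpb_pullback[OF tpb_T[OF tangent_bundle_tpb]] .

lemma tw_comm [simp]: "A \<in> obj C \<Longrightarrow> tw2 C A \<cdot> tp C A = tw1 C A \<cdot> tp C A"
  using pb_comm[OF tw_pb] by simp

lemma tw_comm' [simp]: "A \<in> obj C \<Longrightarrow> w \<in> arr C \<Longrightarrow> src C w = A \<Longrightarrow>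
    tw2 C A \<cdot> (tp C A \<cdot> w) = tw1 C A \<cdot> (tp C A \<cdot> w)"
  by (rule reassoc2) simp_all

lemma Ttw_comm [simp]: "A \<in> obj C \<Longrightarrow> T (tw2 C A) \<cdot> T (tp C A) = T (tw1 C A) \<cdot> T (tp C A)"
  by (simp add: T_comp[symmetric] del: T_comp)

lemma T2_tw:
  assumes "f \<in> arr C" "tgt C f = B"
  shows "T2_arr C f \<cdot> tw1 C B = tw1 C (src C f) \<cdot> T f" "T2_arr C f \<cdot> tw2 C B = tw2 C (src C f) \<cdot> T f"
  using T2_simps(4,5)[of f] assms by auto

lemma T2_tw':
  assumes "f \<in> arr C" "tgt C f = B" "w \<in> arr C" "src C w = tobj C B"
  shows "T2_arr C f \<cdot> (tw1 C B \<cdot> w) = tw1 C (src C f) \<cdot> (T f \<cdot> w)"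
    "T2_arr C f \<cdot> (tw2 C B \<cdot> w) = tw2 C (src C f) \<cdot> (T f \<cdot> w)"
  using assms by (auto intro: reassoc2[OF T2_tw(1)] reassoc2[OF T2_tw(2)])

text \<open>Limits commute with limits: \<open>T\<^sub>2\<close> is a fibre product of copies of \<open>T\<close>, formed over the identity functor.
  A compatible pair of maps into \<open>T\<^sub>2 A\<close> and \<open>T\<^sub>2 B\<close> has two components, each of which is a compatible pair of
  maps into \<open>T A\<close> and \<open>T B\<close>.\<close>

lemma T2_tpb:
  assumes pb: "tangent_pullback C f g a b"
  shows "tangent_pullback C (T2_arr C f) (T2_arr C g) (T2_arr C a) (T2_arr C b)"
  unfolding tangent_pullback_def
proof
  fix m
  note [simp] = tpb_simps[OF pb]
  note P0 = tpb_pullback[OF tpb_Tm[OF pb, of m]]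
  note P1 = tpb_pullback[OF tpb_Tm[OF tpb_T[OF pb], of m]]
  note W = tpb_pullback[OF tpb_Tm[OF tangent_bundle_tpb, of _ m]]
  have wc [simp]: "Tm m (tw2 C A) \<cdot> Tm m (tp C A) = Tm m (tw1 C A) \<cdot> Tm m (tp C A)" if "A \<in> obj C" for A
    using that by (simp add: Tm_comp[symmetric] del: Tm_comp)
  have t: "Tm m (T2_arr C k) \<cdot> Tm m (tw1 C (tgt C k)) = Tm m (tw1 C (src C k)) \<cdot> Tm m (T k)"
    "Tm m (T2_arr C k) \<cdot> Tm m (tw2 C (tgt C k)) = Tm m (tw2 C (src C k)) \<cdot> Tm m (T k)"
    "Tm m (T k) \<cdot> Tm m (tp C (tgt C k)) = Tm m (tp C (src C k)) \<cdot> Tm m k"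
    if "k \<in> arr C" for k
    using that by (simp_all add: Tm_comp[symmetric] nat_p T2_tw del: Tm_comp)
  note ta = t[of a, simplified] and tb = t[of b, simplified] and tf = t[of f, simplified] and tg = t[of g, simplified]
  let ?tf = "Tm m (T2_arr C f)" and ?tg = "Tm m (T2_arr C g)"
    and ?ta = "Tm m (T2_arr C a)" and ?tb = "Tm m (T2_arr C b)"
  let ?P = "src C a" and ?A = "src C f" and ?B = "src C g" and ?D = "tgt C f"
  show "is_pullback C ?tf ?tg ?ta ?tb"
  proof (rule pullbackI)
    show "?ta \<cdot> ?tf = ?tb \<cdot> ?tg"
    proof (rule pb_eqI[OF W[of ?D]])
      have "Tm m (T a) \<cdot> Tm m (T f) = Tm m (T b) \<cdot> Tm m (T g)"
        using pb_comm[OF P1] .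
      then show "(?ta \<cdot> ?tf) \<cdot> Tm m (tw1 C ?D) =
          (?tb \<cdot> ?tg) \<cdot> Tm m (tw1 C ?D)"
        "(?ta \<cdot> ?tf) \<cdot> Tm m (tw2 C ?D) =
          (?tb \<cdot> ?tg) \<cdot> Tm m (tw2 C ?D)"
        by (simp_all add: tf tg reassoc2[OF ta(1)] reassoc2[OF ta(2)] reassoc2[OF tb(1)] reassoc2[OF tb(2)])
    qed simp_all
  next
    fix x y assume xy: "x \<in> arr C" "y \<in> arr C" "src C y = src C x" "tgt C x = src C ?tf"
      "tgt C y = src C ?tg" and eq: "x \<cdot> ?tf = y \<cdot> ?tg"
    note [simp] = xy[simplified]
    have "x \<cdot> (?tf \<cdot> Tm m (tw1 C ?D)) = y \<cdot> (?tg \<cdot> Tm m (tw1 C ?D))"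
      "x \<cdot> (?tf \<cdot> Tm m (tw2 C ?D)) = y \<cdot> (?tg \<cdot> Tm m (tw2 C ?D))"
      by (rule reassoc2[OF eq]; simp)+
    then have e: "(x \<cdot> Tm m (tw1 C ?A)) \<cdot> Tm m (T f) = (y \<cdot> Tm m (tw1 C ?B)) \<cdot> Tm m (T g)"
      "(x \<cdot> Tm m (tw2 C ?A)) \<cdot> Tm m (T f) = (y \<cdot> Tm m (tw2 C ?B)) \<cdot> Tm m (T g)"
      by (simp_all add: tf tg)
    let ?h1 = "pair C (Tm m (T a)) (Tm m (T b)) (x \<cdot> Tm m (tw1 C ?A)) (y \<cdot> Tm m (tw1 C ?B))"
    let ?h2 = "pair C (Tm m (T a)) (Tm m (T b)) (x \<cdot> Tm m (tw2 C ?A)) (y \<cdot> Tm m (tw2 C ?B))"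
    note h1 = pair_props[OF P1 _ _ _ _ _ e(1), simplified]
    note h2 = pair_props[OF P1 _ _ _ _ _ e(2), simplified]
    note [simp] = h1(1-3) h2(1-3)
    have c: "?h1 \<cdot> Tm m (tp C ?P) = ?h2 \<cdot> Tm m (tp C ?P)"
    proof (rule pb_eqI[OF P0])
      have "?h1 \<cdot> (Tm m (T a) \<cdot> Tm m (tp C ?A)) = ?h2 \<cdot> (Tm m (T a) \<cdot> Tm m (tp C ?A))"
        by (simp add: reassoc[OF h1(4)] reassoc[OF h2(4)] del: funpow.simps)
      then show "(?h1 \<cdot> Tm m (tp C ?P)) \<cdot> Tm m a = (?h2 \<cdot> Tm m (tp C ?P)) \<cdot> Tm m a"
        by (simp add: ta)
      have "?h1 \<cdot> (Tm m (T b) \<cdot> Tm m (tp C ?B)) = ?h2 \<cdot> (Tm m (T b) \<cdot> Tm m (tp C ?B))"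
        by (simp add: reassoc[OF h1(5)] reassoc[OF h2(5)])
      then show "(?h1 \<cdot> Tm m (tp C ?P)) \<cdot> Tm m b = (?h2 \<cdot> Tm m (tp C ?P)) \<cdot> Tm m b"
        by (simp add: tb)
    qed simp_all
    let ?h = "pair C (Tm m (tw1 C ?P)) (Tm m (tw2 C ?P)) ?h1 ?h2"
    note h = pair_props[OF W[of ?P], of ?h1 ?h2, simplified, OF c]
    note [simp] = h(1-3)
    have "?h \<cdot> ?ta = x"
      by (rule pb_eqI[OF W[of ?A]])
        (simp_all add: ta reassoc[OF h(4)] reassoc[OF h(5)] h1(4) h2(4))
    moreover have "?h \<cdot> ?tb = y"
      by (rule pb_eqI[OF W[of ?B]])
        (simp_all add: tb reassoc[OF h(4)] reassoc[OF h(5)] h1(5) h2(5))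
    ultimately show "\<exists>h\<in>arr C. src C h = src C x \<and> tgt C h = src C ?ta \<and>
        h \<cdot> ?ta = x \<and> h \<cdot> ?tb = y"
      by (intro bexI[of _ ?h]) simp_all
  next
    fix h k assume hk: "h \<in> arr C" "k \<in> arr C" "src C h = src C k" "tgt C h = src C ?ta"
      "tgt C k = src C ?ta" and e: "h \<cdot> ?ta = k \<cdot> ?ta"
        "h \<cdot> ?tb = k \<cdot> ?tb"
    note [simp] = hk[simplified]
    have 1: "h \<cdot> (?ta \<cdot> Tm m (tw1 C ?A)) = k \<cdot> (?ta \<cdot> Tm m (tw1 C ?A))"
      "h \<cdot> (?ta \<cdot> Tm m (tw2 C ?A)) = k \<cdot> (?ta \<cdot> Tm m (tw2 C ?A))"
      by (rule reassoc2[OF e(1)]; simp)+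
    have 2: "h \<cdot> (?tb \<cdot> Tm m (tw1 C ?B)) = k \<cdot> (?tb \<cdot> Tm m (tw1 C ?B))"
      "h \<cdot> (?tb \<cdot> Tm m (tw2 C ?B)) = k \<cdot> (?tb \<cdot> Tm m (tw2 C ?B))"
      by (rule reassoc2[OF e(2)]; simp)+
    have h1: "h \<cdot> Tm m (tw1 C ?P) = k \<cdot> Tm m (tw1 C ?P)"
      by (rule pb_eqI[OF P1]) (use 1(1) 2(1) in \<open>simp_all add: ta tb\<close>)
    have h2: "h \<cdot> Tm m (tw2 C ?P) = k \<cdot> Tm m (tw2 C ?P)"
      by (rule pb_eqI[OF P1]) (use 1(2) 2(2) in \<open>simp_all add: ta tb\<close>)
    show "h = k"
      by (rule pb_eqI[OF W[of ?P]]) (use h1 h2 in simp_all)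
  qed simp_all
qed

text \<open>The isomorphism \<open>T\<^sub>2 T \<rightarrow> T T\<^sub>2\<close> that flips each of the two components, and its inverse.\<close>

definition T2\<alpha> :: "'o \<Rightarrow> 'm" where
  "T2\<alpha> A = pair C (T (tw1 C A)) (T (tw2 C A))
     (tw1 C (tobj C A) \<cdot> tc C A) (tw2 C (tobj C A) \<cdot> tc C A)"

definition T2\<beta> :: "'o \<Rightarrow> 'm" where
  "T2\<beta> A = pair C (tw1 C (tobj C A)) (tw2 C (tobj C A))
     (T (tw1 C A) \<cdot> tc C A) (T (tw2 C A) \<cdot> tc C A)"

lemma T2\<alpha>_simps [simp]:
  assumes [simp]: "A \<in> obj C"
  shows "T2\<alpha> A \<in> arr C" "src C (T2\<alpha> A) = tw C (tobj C A)" "tgt C (T2\<alpha> A) = tobj C (tw C A)"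
    "T2\<alpha> A \<cdot> T (tw1 C A) = tw1 C (tobj C A) \<cdot> tc C A"
    "T2\<alpha> A \<cdot> T (tw2 C A) = tw2 C (tobj C A) \<cdot> tc C A"
  using pair_props[OF Ttw_pb[of A], of "tw1 C (tobj C A) \<cdot> tc C A" "tw2 C (tobj C A) \<cdot> tc C A"]
  by (simp_all add: T2\<alpha>_def)

lemma T2\<beta>_simps [simp]:
  assumes [simp]: "A \<in> obj C"
  shows "T2\<beta> A \<in> arr C" "src C (T2\<beta> A) = tobj C (tw C A)" "tgt C (T2\<beta> A) = tw C (tobj C A)"
    "T2\<beta> A \<cdot> tw1 C (tobj C A) = T (tw1 C A) \<cdot> tc C A"
    "T2\<beta> A \<cdot> tw2 C (tobj C A) = T (tw2 C A) \<cdot> tc C A"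
  using pair_props[OF tw_pb[of "tobj C A"], of "T (tw1 C A) \<cdot> tc C A" "T (tw2 C A) \<cdot> tc C A"]
  by (simp_all add: T2\<beta>_def)

lemmas T2\<alpha>_tw' = reassoc2[OF T2\<alpha>_simps(4)] reassoc2[OF T2\<alpha>_simps(5)]
lemmas T2\<beta>_tw' = reassoc2[OF T2\<beta>_simps(4)] reassoc2[OF T2\<beta>_simps(5)]

end

sublocale tangent_cat \<subseteq> T2: pullback_functor C "T2_arr C" "tw C"
proof unfold_locales
  fix f g assume [simp]: "f \<in> arr C" "g \<in> arr C" "tgt C f = src C g"
  show "T2_arr C (f \<cdot> g) = T2_arr C f \<cdot> T2_arr C g"
    by (rule pb_eqI[OF tw_pb[of "tgt C g"]]) (simp_all add: T2_tw T2_tw')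
next
  fix A assume [simp]: "A \<in> obj C"
  show "T2_arr C (ident C A) = ident C (tw C A)"
    by (rule pb_eqI[OF tw_pb[of A]]) (simp_all add: T2_tw)
qed (simp_all add: T2_tpb)

sublocale tangent_cat \<subseteq> T2: bundle_functor C "T2_arr C" "tw C" T2\<alpha> T2\<beta>
proof unfold_locales
  fix A assume [simp]: "A \<in> obj C"
  show "T2\<alpha> A \<cdot> T2\<beta> A = ident C (tw C (tobj C A))"
    by (rule pb_eqI[OF tw_pb[of "tobj C A"]]) (simp_all add: T2\<alpha>_tw')
  show "T2\<beta> A \<cdot> T2\<alpha> A = ident C (tobj C (tw C A))"
    by (rule pb_eqI[OF Ttw_pb[of A]]) (simp_all add: T2\<beta>_tw')
  show \<alpha>z: "T2_arr C (tz C A) \<cdot> T2\<alpha> A = tz C (tw C A)"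
    by (rule pb_eqI[OF Ttw_pb[of A]]) (simp_all add: T2_tw T2_tw' nat_z)
  have T\<alpha>: "T (T2\<alpha> A) \<cdot> T (T (tw1 C A)) = T (tw1 C (tobj C A)) \<cdot> T (tc C A)"
    "T (T2\<alpha> A) \<cdot> T (T (tw2 C A)) = T (tw2 C (tobj C A)) \<cdot> T (tc C A)"
    by (simp_all add: T_comp[symmetric] del: T_comp)
  have l: "T (tl C A) \<cdot> (tc C (tobj C A) \<cdot> T (tc C A)) = tc C A \<cdot> tl C (tobj C A)"
    by (rule T.\<alpha>_l[symmetric]) simp
  show "T2\<alpha> A \<cdot> tl C (tw C A) = T2_arr C (tl C A) \<cdot> (T2\<alpha> (tobj C A) \<cdot> T (T2\<alpha> A))"
  proof (rule pb_eqI[OF tpb_pullback[OF tpb_T[OF tpb_T[OF tangent_bundle_tpb[of A]]]]])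
    have "T2\<alpha> A \<cdot> (T (tw1 C A) \<cdot> tl C (tobj C A)) =
        T2_arr C (tl C A) \<cdot> (T2\<alpha> (tobj C A) \<cdot> (T (T2\<alpha> A) \<cdot> T (T (tw1 C A))))"
      "T2\<alpha> A \<cdot> (T (tw2 C A) \<cdot> tl C (tobj C A)) =
        T2_arr C (tl C A) \<cdot> (T2\<alpha> (tobj C A) \<cdot> (T (T2\<alpha> A) \<cdot> T (T (tw2 C A))))"
      by (simp_all add: T\<alpha> T2\<alpha>_tw' T2_tw' l)
    then show "(T2\<alpha> A \<cdot> tl C (tw C A)) \<cdot> T (T (tw1 C A)) =
        (T2_arr C (tl C A) \<cdot> (T2\<alpha> (tobj C A) \<cdot> T (T2\<alpha> A))) \<cdot> T (T (tw1 C A))"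
      "(T2\<alpha> A \<cdot> tl C (tw C A)) \<cdot> T (T (tw2 C A)) =
        (T2_arr C (tl C A) \<cdot> (T2\<alpha> (tobj C A) \<cdot> T (T2\<alpha> A))) \<cdot> T (T (tw2 C A))"
      by (simp_all add: nat_l)
  qed simp_all
  fix L
  note mt = tangent_bundle_magma
  have sq: "T2\<alpha> A \<cdot> tp C (tw C A) = T2_arr C (tp C A)"
  proof (rule pb_eqI[OF tw_pb[of A]])
    have "T2\<alpha> A \<cdot> (T (tw1 C A) \<cdot> tp C (tobj C A)) = T2_arr C (tp C A) \<cdot> tw1 C A"
      "T2\<alpha> A \<cdot> (T (tw2 C A) \<cdot> tp C (tobj C A)) = T2_arr C (tp C A) \<cdot> tw2 C A"
      by (simp_all add: T2\<alpha>_tw' T2_tw)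
    then show "(T2\<alpha> A \<cdot> tp C (tw C A)) \<cdot> tw1 C A = T2_arr C (tp C A) \<cdot> tw1 C A"
      "(T2\<alpha> A \<cdot> tp C (tw C A)) \<cdot> tw2 C A = T2_arr C (tp C A) \<cdot> tw2 C A"
      by (simp_all add: nat_p)
  qed simp_all
  have sc: "T (ts C A) \<cdot> tc C A = fsum C (tangent_bundle C (tobj C A)) (T (tw1 C A) \<cdot> tc C A) (T (tw2 C A) \<cdot> tc C A)"
    using additive_morphism_simps(9)[OF law_add_c[of A]] by simp
  have c2: "T2_arr C (tw1 C A) \<cdot> T2_arr C (tp C A) = T2_arr C (tw2 C A) \<cdot> T2_arr C (tp C A)"
    by (simp add: T2.S_comp[symmetric] del: T2.S_comp)
  note f1 = fsum_simps[OF mt, of "tw C A" "T2_arr C (tw1 C A) \<cdot> T2\<alpha> A" "T2_arr C (tw2 C A) \<cdot> T2\<alpha> A", simplified, unfolded sq, OF c2]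
  have s: "T2_arr C (ts C A) \<cdot> T2\<alpha> A =
      fsum C (tangent_bundle C (tw C A)) (T2_arr C (tw1 C A) \<cdot> T2\<alpha> A) (T2_arr C (tw2 C A) \<cdot> T2\<alpha> A)"
  proof (rule pb_eqI[OF Ttw_pb[of A]])
    show "(T2_arr C (ts C A) \<cdot> T2\<alpha> A) \<cdot> T (tw1 C A) =
        fsum C (tangent_bundle C (tw C A)) (T2_arr C (tw1 C A) \<cdot> T2\<alpha> A) (T2_arr C (tw2 C A) \<cdot> T2\<alpha> A) \<cdot> T (tw1 C A)"
      using fsum_comp[OF T_tangent_additive[of "tw1 C A"] mt mt,
          of "T2_arr C (tw1 C A) \<cdot> T2\<alpha> A" "T2_arr C (tw2 C A) \<cdot> T2\<alpha> A"]
        comp_fsum[OF mt[of "tobj C A"], of "T (tw1 C A) \<cdot> tc C A" "T (tw2 C A) \<cdot> tc C A" "tw1 C (tw C A)"] c2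
      by (simp add: sq sc T2_tw T2_tw')
    show "(T2_arr C (ts C A) \<cdot> T2\<alpha> A) \<cdot> T (tw2 C A) =
        fsum C (tangent_bundle C (tw C A)) (T2_arr C (tw1 C A) \<cdot> T2\<alpha> A) (T2_arr C (tw2 C A) \<cdot> T2\<alpha> A) \<cdot> T (tw2 C A)"
      using fsum_comp[OF T_tangent_additive[of "tw2 C A"] mt mt,
          of "T2_arr C (tw1 C A) \<cdot> T2\<alpha> A" "T2_arr C (tw2 C A) \<cdot> T2\<alpha> A"]
        comp_fsum[OF mt[of "tobj C A"], of "T (tw1 C A) \<cdot> tc C A" "T (tw2 C A) \<cdot> tc C A" "tw2 C (tw C A)"] c2
      by (simp add: sq sc T2_tw T2_tw')
  qed (use f1 in simp_all)
  show "additive_morphism C (T2.image_bundle L (tangent_bundle C A)) (tangent_bundle C (tw C A))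
      (ident C (tw C A)) (T2\<alpha> A)"
    using mt[of A] by (simp add: additive_morphism_def hom_iff T2.image_base sq \<alpha>z s)
next
  fix f assume [simp]: "f \<in> arr C"
  have T2f: "T (T2_arr C f) \<cdot> T (tw1 C (tgt C f)) = T (tw1 C (src C f)) \<cdot> T (T f)"
    "T (T2_arr C f) \<cdot> T (tw2 C (tgt C f)) = T (tw2 C (src C f)) \<cdot> T (T f)"
    by (simp_all add: T_comp[symmetric] del: T_comp)
  show "T2_arr C (T f) \<cdot> T2\<alpha> (tgt C f) = T2\<alpha> (src C f) \<cdot> T (T2_arr C f)"
    by (rule pb_eqI[OF Ttw_pb[of "tgt C f"]])
      (simp_all add: T2_tw' T2\<alpha>_tw' T2f nats)
qed simp_all

context tangent_cat
begin

text \<open>Unlike \<open>T\<close>, the functor \<open>T\<^sub>2\<close> does not evidently preserve tangent display maps, although it preserves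
  tangent pullbacks.  Hence the hypothesis on \<open>T\<^sub>2 q\<close>.\<close>

lemma T2_bundle_display:
  assumes Q: "display_bundle C Q" and d: "tangent_display C (T2_arr C (bproj Q))"
  shows "display_bundle C (T2_bundle C Q)"
proof -
  have Q: "differential_bundle C Q" "tangent_display C (bproj Q)"
    using Q by (simp_all add: display_bundle_def)
  note [simp] = fibred_magma_simps[OF differential_magma[OF Q(1)]] differential_simps[OF Q(1)]
  have "pair C (T (tw1 C (total C Q))) (T (tw2 C (total C Q)))
        (tw1 C (total C Q) \<cdot> blift (T_bundle C Q)) (tw2 C (total C Q) \<cdot> blift (T_bundle C Q)) =
      T2_arr C (blift Q) \<cdot> T2\<alpha> (total C Q)"
    by (rule pair_eqI[OF Ttw_pb]) (simp_all add: T2_tw')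
  then have "T2_bundle C Q = T2.S_bundle Q"
    by (simp add: T2_bundle_def T2.S_bundle_def T2.image_bundle_def)
  then have "differential_bundle C (T2_bundle C Q)"
    using T2.S_bundle_differential[OF Q d] by (simp only:)
  then show ?thesis
    using d by (simp add: display_bundle_def T2_bundle_def)
qed

end

section \<open>The splitting of the tangent bundle by a Koszul connection\<close>

context conn_RH
begin

text \<open>The element of \<open>T E\<close> with components \<open>k\<close> and \<open>n\<close> is \<open>\<langle>k, e\<rangle> \<xi> + n H\<close>, where \<open>e\<close> is the base point of \<open>n\<close>; so
  \<open>T E\<close> is the fibre product of \<open>E\<close> and \<open>F q\<close> over \<open>M\<close>.  It is compared with the pullback that exists
  because \<open>q\<close> is a tangent display map; thereby preservation by \<open>T\<close> is inherited.\<close>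

lemma koszul_decomposition:
  assumes kz: "koszul_connection C Q qF tF K H"
  shows "tangent_pullback C q (qF \<cdot> q) K \<pi>"
proof -
  have lin: "linear_over_p K" "linear_over_q K"
    and lK: "l \<cdot> K = ident C E" and H\<pi>: "H \<cdot> \<pi> = ident C F" and HK: "H \<cdot> K = qF \<cdot> (q \<cdot> bzero Q)"
    and linH: "linear C qF (flift C q qF tF) (tp C E) (tl C E) (ident C E) H"
    and sum: "fsum C (tangent_bundle C E) (vert K (tp C E)) (\<pi> \<cdot> H) = ident C (tobj C E)"
    using kz unfolding koszul_iff by blast+
  have Hp: "H \<cdot> tp C E = qF" using linH by (simp add: linear_def)
  note mtE = tangent_bundle_magma[of E, simplified]
  obtain a b where ab: "tangent_pullback C q (qF \<cdot> q) a b"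
    by (rule displayD[OF disp, of "qF \<cdot> q" 0]) simp_all
  note [simp] = tpb_simps[OF ab, simplified]
  have aq: "a \<cdot> q = b \<cdot> (qF \<cdot> q)" using tpb_comm[OF ab] .
  have k: "fib_pair a (b \<cdot> qF)" by (simp add: fib_pair_def aq)
  note [simp] = vert_simps(1-3)[OF k]
  \<comment> \<open>the inverse of the comparison map from \<open>T E\<close> to the chosen pullback\<close>
  define v where "v = fsum C (tangent_bundle C E) (vert a (b \<cdot> qF)) (b \<cdot> H)"
  have vp: "vert a (b \<cdot> qF) \<cdot> tp C E = b \<cdot> (H \<cdot> tp C E)"
    using vert_simps(5)[OF k] Hp by simp
  have v [simp]: "v \<in> arr C" "src C v = src C a" "tgt C v = tobj C E" and vq: "v \<cdot> tp C E = b \<cdot> qF"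
    using fsum_simps[OF mtE, of "vert a (b \<cdot> qF)" "b \<cdot> H"] vp Hp unfolding v_def by simp_all
  have Kadd: "v \<cdot> K = fsum C Q (vert a (b \<cdot> qF) \<cdot> K) (b \<cdot> H \<cdot> K)"
    unfolding v_def
    by (rule fsum_comp[OF K_additive_E[OF lin(2)] mtE mg]) (use vp in simp_all)
  have vK: "v \<cdot> K = a"
  proof -
    have "b \<cdot> (qF \<cdot> (q \<cdot> bzero Q)) = a \<cdot> (q \<cdot> bzero Q)"
      using reassoc2[OF aq[symmetric]] reassoc[OF aq, of "bzero Q"] by simp
    then show ?thesis
      using Kadd K_vert[OF lin lK k] HK fsum_zero_right[OF adQ, of a] by simp
  qed
  have Hq: "H \<cdot> T q = tF"
  proof -
    have "H \<cdot> (\<pi> \<cdot> tF) = tF" using reassoc[OF H\<pi>, of tF] by (simp del: hdescent_simps(5))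
    then show ?thesis by simp
  qed
  have v\<pi>: "v \<cdot> \<pi> = b"
  proof (rule pb_eqI[OF tpb_pullback[OF fpbk]])
    show "(v \<cdot> \<pi>) \<cdot> qF = b \<cdot> qF" by (simp add: vq)
    have "v \<cdot> T q = fsum C (tangent_bundle C M) (vert a (b \<cdot> qF) \<cdot> T q) (b \<cdot> H \<cdot> T q)"
      unfolding v_def
      by (rule fsum_comp[OF T_tangent_additive[of q, simplified] mtE tangent_bundle_magma])
        (use vp in simp_all)
    also have "vert a (b \<cdot> qF) \<cdot> T q = (b \<cdot> tF) \<cdot> (tp C M \<cdot> tz C M)"
      unfolding vert_simps(4)[OF k] aq by (simp add: reassoc2[OF finsler_comm])
    also have "b \<cdot> H \<cdot> T q = b \<cdot> tF" by (simp add: Hq)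
    finally show "(v \<cdot> \<pi>) \<cdot> tF = b \<cdot> tF"
      using fsum_zero_left[OF tangent_bundle_additive, of M "b \<cdot> tF"] by simp
  qed simp_all
  have "K \<cdot> q = \<pi> \<cdot> (qF \<cdot> q)" using reassoc[of \<pi> qF "tp C E" q] by simp
  note \<theta> = pair_props[OF tpb_pullback[OF ab], of K \<pi>, simplified, OF this[simplified]]
  let ?\<theta> = "pair C a b K \<pi>"
  have \<theta> [simp]: "?\<theta> \<in> arr C" "src C ?\<theta> = tobj C E" "tgt C ?\<theta> = src C a" "?\<theta> \<cdot> a = K" "?\<theta> \<cdot> b = \<pi>"
    using \<theta> by simp_all
  have "v \<cdot> ?\<theta> = ident C (src C a)"
    by (rule pb_eqI[OF tpb_pullback[OF ab]]) (simp_all add: vK v\<pi>)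
  moreover have "?\<theta> \<cdot> v = ident C (tobj C E)"
  proof -
    have "?\<theta> \<cdot> v = fsum C (tangent_bundle C E) (?\<theta> \<cdot> vert a (b \<cdot> qF)) (?\<theta> \<cdot> (b \<cdot> H))"
      unfolding v_def by (rule comp_fsum[OF mtE]) (use vp in simp_all)
    also have "?\<theta> \<cdot> (b \<cdot> H) = \<pi> \<cdot> H" by (simp add: reassoc[OF \<theta>(5)])
    also have "?\<theta> \<cdot> vert a (b \<cdot> qF) = vert K (tp C E)"
      by (simp add: comp_vert[OF k] reassoc[OF \<theta>(5)])
    finally show ?thesis using sum by simp
  qed
  ultimately have "tangent_pullback C b (ident C F) ?\<theta> \<pi>"
    by (intro tpb_iso[where a' = v and g' = "ident C F"]) simp_all
  from tpb_paste[OF ab this] show ?thesis by simp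
qed

text \<open>By the splitting, \<open>\<pi> : T E \<rightarrow> F q\<close> is a pullback of \<open>q\<close>.  Let \<open>G\<close> be the pullback of \<open>T q\<close> along the first
  projection \<open>T\<^sub>2 M \<rightarrow> T M\<close>.  It consists of a vector on \<open>E\<close> and a second vector on \<open>M\<close>, so \<open>T\<^sub>2 E \<rightarrow> G\<close>
  applies \<open>\<pi>\<close> to the second component: it is a pullback of \<open>\<pi>\<close>.  Thus \<open>T\<^sub>2 q : T\<^sub>2 E \<rightarrow> G \<rightarrow> T\<^sub>2 M\<close> is a composite of
  tangent display maps.\<close>

lemma T2_display:
  assumes kz: "koszul_connection C Q qF tF K H"
  shows "tangent_display C (T2_arr C q)"
proof -
  have d\<pi>: "tangent_display C \<pi>"
    by (rule display_pullback[OF disp koszul_decomposition[OF kz]])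
  obtain g1 g2 where g: "tangent_pullback C (T q) (tw1 C M) g1 g2"
    by (rule displayD[OF display_T[OF disp], of "tw1 C M" 0]) simp_all
  note [simp] = tpb_simps[OF g, simplified]
  have gc: "g1 \<cdot> T q = g2 \<cdot> tw1 C M" using tpb_comm[OF g] .
  note twM = tangent_bundle_tpb[of M, simplified] and twE = tangent_bundle_tpb[of E, simplified]
  \<comment> \<open>\<open>G\<close> as the pullback of \<open>p\<^sub>M\<close> along \<open>p\<^sub>E q\<close>, and then as the pullback of \<open>q\<^sup>F\<close> along \<open>p\<^sub>E\<close>\<close>
  have 1: "tangent_pullback C (tp C M) (tp C E \<cdot> q) (g2 \<cdot> tw2 C M) g1"
    using tpb_paste[OF tpb_sym[OF twM] tpb_sym[OF g]] by (simp add: nat_p)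
  have "(g1 \<cdot> tp C E) \<cdot> q = (g2 \<cdot> tw2 C M) \<cdot> tp C M"
    using reassoc2[OF gc, of "tp C M"] by (simp add: nat_p)
  note c = pair_props[OF tpb_pullback[OF fpbk] _ _ _ _ _ this, simplified]
  let ?c = "pair C qF tF (g1 \<cdot> tp C E) (g2 \<cdot> tw2 C M)"
  have c [simp]: "?c \<in> arr C" "src C ?c = src C g1" "tgt C ?c = F" "?c \<cdot> qF = g1 \<cdot> tp C E"
    "?c \<cdot> tF = g2 \<cdot> tw2 C M"
    using c by simp_all
  have 2: "tangent_pullback C qF (tp C E) ?c g1"
    by (rule tpb_cancel[OF tpb_sym[OF fpbk] 1]) simp_all
  have "tw1 C E \<cdot> T q = T2_arr C q \<cdot> tw1 C M" by (simp add: T2_tw)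
  note d = pair_props[OF tpb_pullback[OF g] _ _ _ _ _ this, simplified]
  let ?d = "pair C g1 g2 (tw1 C E) (T2_arr C q)"
  have d [simp]: "?d \<in> arr C" "src C ?d = tw C E" "tgt C ?d = src C g1" "?d \<cdot> g1 = tw1 C E"
    "?d \<cdot> g2 = T2_arr C q"
    using d by simp_all
  have dc: "?d \<cdot> ?c = tw2 C E \<cdot> \<pi>"
    by (rule pb_eqI[OF tpb_pullback[OF fpbk]])
      (simp_all add: reassoc[OF d(4)] reassoc[OF d(5)] T2_tw)
  have "tangent_pullback C (tp C E) (\<pi> \<cdot> qF) (tw1 C E) (tw2 C E)" using twE by simp
  from tpb_cancel[OF tpb_sym[OF 2] this, of ?d] dc
  have "tangent_pullback C \<pi> ?c (tw2 C E) ?d" by (simp add: tpb_sym)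
  then have "tangent_display C ?d" by (rule display_pullback[OF d\<pi>])
  from display_comp[OF this display_pullback[OF display_T[OF disp] g]] show ?thesis by simp
qed

end

section \<open>The tangent category of display differential bundles\<close>

lemma DB_sel [simp]:
  "obj (DB C) = {Q. display_bundle C Q}" "src (DB C) = mdom" "tgt (DB C) = mcod"
  "ident (DB C) Q = BMor Q Q (ident C (base C Q)) (ident C (total C Q))"
  "comp (DB C) \<phi> \<psi> = BMor (mdom \<phi>) (mcod \<psi>) (comp C (mbase \<phi>) (mbase \<psi>)) (comp C (mtotal \<phi>) (mtotal \<psi>))"
  "tobj (DB C) = T_bundle C"
  "tarr (DB C) \<phi> = BMor (T_bundle C (mdom \<phi>)) (T_bundle C (mcod \<phi>)) (tarr C (mbase \<phi>)) (tarr C (mtotal \<phi>))"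
  "tp (DB C) Q = BMor (T_bundle C Q) Q (tp C (base C Q)) (tp C (total C Q))"
  "tz (DB C) Q = BMor Q (T_bundle C Q) (tz C (base C Q)) (tz C (total C Q))"
  "tl (DB C) Q = BMor (T_bundle C Q) (T_bundle C (T_bundle C Q)) (tl C (base C Q)) (tl C (total C Q))"
  "tw (DB C) = T2_bundle C"
  "tw1 (DB C) Q = BMor (T2_bundle C Q) (T_bundle C Q) (tw1 C (base C Q)) (tw1 C (total C Q))"
  "tw2 (DB C) Q = BMor (T2_bundle C Q) (T_bundle C Q) (tw2 C (base C Q)) (tw2 C (total C Q))"
  "ts (DB C) Q = BMor (T2_bundle C Q) (T_bundle C Q) (ts C (base C Q)) (ts C (total C Q))"
  by (simp_all add: DB_def)

lemma DB_arr: "\<phi> \<in> arr (DB C) \<longleftrightarrow> display_bundle C (mdom \<phi>) \<and> display_bundle C (mcod \<phi>) \<and>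
    linear C (bproj (mdom \<phi>)) (blift (mdom \<phi>)) (bproj (mcod \<phi>)) (blift (mcod \<phi>)) (mbase \<phi>) (mtotal \<phi>)"
  by (simp add: DB_def)

context tangent_cat
begin

lemma display_simps:
  assumes "display_bundle C Q"
  shows "bproj Q \<in> arr C" "src C (bproj Q) = total C Q" "tgt C (bproj Q) = base C Q"
    "total C Q \<in> obj C" "base C Q \<in> obj C"
    "blift Q \<in> arr C" "src C (blift Q) = total C Q" "tgt C (blift Q) = tobj C (total C Q)"
    "base C (T_bundle C Q) = tobj C (base C Q)" "total C (T_bundle C Q) = tobj C (total C Q)"
  using assms fibred_magma_simps[OF differential_magma, of Q] differential_simps[of Q]
    T_bundle_base[OF differential_magma, of Q]
  by (simp_all add: display_bundle_def)

lemma DB_arrD: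
  assumes "\<phi> \<in> arr (DB C)"
  shows "mbase \<phi> \<in> arr C" "src C (mbase \<phi>) = base C (mdom \<phi>)" "tgt C (mbase \<phi>) = base C (mcod \<phi>)"
    "mtotal \<phi> \<in> arr C" "src C (mtotal \<phi>) = total C (mdom \<phi>)" "tgt C (mtotal \<phi>) = total C (mcod \<phi>)"
    "mtotal \<phi> \<cdot> bproj (mcod \<phi>) = bproj (mdom \<phi>) \<cdot> mbase \<phi>"
    "mtotal \<phi> \<cdot> blift (mcod \<phi>) = blift (mdom \<phi>) \<cdot> T (mtotal \<phi>)"
    "display_bundle C (mdom \<phi>)" "display_bundle C (mcod \<phi>)"
  using assms display_simps[of "mdom \<phi>"] display_simps[of "mcod \<phi>"]
  by (simp_all add: DB_arr linear_def hom_iff)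

lemma DB_arrI:
  assumes "display_bundle C Q" "display_bundle C Q'"
    and "f \<in> arr C" "src C f = base C Q" "tgt C f = base C Q'"
    and "g \<in> arr C" "src C g = total C Q" "tgt C g = total C Q'"
    and "g \<cdot> bproj Q' = bproj Q \<cdot> f" "g \<cdot> blift Q' = blift Q \<cdot> T g"
  shows "BMor Q Q' f g \<in> arr (DB C)"
  using assms display_simps[OF assms(1)] display_simps[OF assms(2)]
  by (simp add: DB_arr linear_def hom_iff)

lemma DB_comp:
  assumes f: "\<phi> \<in> arr (DB C)" and g: "\<psi> \<in> arr (DB C)" and c: "mcod \<phi> = mdom \<psi>"
  shows "comp (DB C) \<phi> \<psi> \<in> arr (DB C)"
proof -
  note a = DB_arrD[OF f] and b = DB_arrD[OF g, folded c]
  note [simp] = display_simps[OF a(9)] display_simps[OF b(9)] display_simps[OF b(10)] a(1-6) b(1-6)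
  show ?thesis
    unfolding DB_sel
    by (rule DB_arrI) (simp_all add: a(9) b(10) b(7,8) reassoc2[OF a(7)] reassoc2[OF a(8)])
qed

lemma DB_ident: "display_bundle C Q \<Longrightarrow> ident (DB C) Q \<in> arr (DB C)"
  unfolding DB_sel by (rule DB_arrI) (simp_all add: display_simps)

lemma DB_category: "category (DB C)"
  unfolding category_def
proof (intro conjI ballI impI)
  fix f g assume "f \<in> arr (DB C)" "g \<in> arr (DB C)" "tgt (DB C) f = src (DB C) g"
  then show "comp (DB C) f g \<in> hom (DB C) (src (DB C) f) (tgt (DB C) g)"
    using DB_comp[of f g] by (simp add: hom_def)
next
  fix f assume f: "f \<in> arr (DB C)"
  show "src (DB C) f \<in> obj (DB C)" "tgt (DB C) f \<in> obj (DB C)"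
    "comp (DB C) (ident (DB C) (src (DB C) f)) f = f" "comp (DB C) f (ident (DB C) (tgt (DB C) f)) = f"
    using DB_arrD[OF f] by simp_all
next
  fix f g h assume f: "f \<in> arr (DB C)" and g: "g \<in> arr (DB C)" and h: "h \<in> arr (DB C)"
    and "tgt (DB C) f = src (DB C) g \<and> tgt (DB C) g = src (DB C) h"
  then show "comp (DB C) (comp (DB C) f g) h = comp (DB C) f (comp (DB C) g h)"
    using DB_arrD[OF f] DB_arrD[OF g] DB_arrD[OF h] by simp
qed (use DB_ident in \<open>simp_all add: hom_def\<close>)

end

sublocale tangent_cat \<subseteq> DB: cat "DB C"
  by unfold_locales (rule DB_category)

context tangent_cat
begin

lemma DB_tarr:
  assumes f: "\<phi> \<in> arr (DB C)"
  shows "tarr (DB C) \<phi> \<in> arr (DB C)"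
proof -
  note a = DB_arrD[OF f]
  note [simp] = display_simps[OF a(9)] display_simps[OF a(10)] a(1-6)
  have "T (mtotal \<phi>) \<cdot> T (blift (mcod \<phi>)) = T (blift (mdom \<phi>)) \<cdot> T (T (mtotal \<phi>))"
    by (simp add: T_comp[symmetric] a(8) del: T_comp)
  from reassoc2[OF this]
  have "T (mtotal \<phi>) \<cdot> (T (blift (mcod \<phi>)) \<cdot> tc C (total C (mcod \<phi>))) =
      T (blift (mdom \<phi>)) \<cdot> (tc C (total C (mdom \<phi>)) \<cdot> T (T (mtotal \<phi>)))"
    by (simp add: nat_c)
  moreover have "T (mtotal \<phi>) \<cdot> T (bproj (mcod \<phi>)) = T (bproj (mdom \<phi>)) \<cdot> T (mbase \<phi>)"
    by (simp add: T_comp[symmetric] a(7) del: T_comp)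
  ultimately show ?thesis
    unfolding DB_sel by (intro DB_arrI T_bundle_display) (simp_all add: a(9,10))
qed

lemma DB_Tm:
  "(tarr (DB C) ^^ m) \<phi> =
    BMor ((T_bundle C ^^ m) (mdom \<phi>)) ((T_bundle C ^^ m) (mcod \<phi>)) (Tm m (mbase \<phi>)) (Tm m (mtotal \<phi>))"
  by (induction m) simp_all

lemma DB_Tm_arr: "\<phi> \<in> arr (DB C) \<Longrightarrow> (tarr (DB C) ^^ m) \<phi> \<in> arr (DB C)"
  by (induction m) (simp_all add: DB_tarr del: DB_sel)

text \<open>Pullbacks are formed on bases and on total spaces separately.  The mediating pair is a morphism
  over the bases by the pullback of bases, and it is linear by the pullback of the \<open>T\<close>-images of the total
  spaces.\<close>

lemma DB_pullbackI:
  assumes f: "\<phi> \<in> arr (DB C)" and g: "\<gamma> \<in> arr (DB C)" and a: "\<alpha> \<in> arr (DB C)" and b: "\<beta> \<in> arr (DB C)"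
    and c: "mcod \<gamma> = mcod \<phi>" "mdom \<beta> = mdom \<alpha>" "mcod \<alpha> = mdom \<phi>" "mcod \<beta> = mdom \<gamma>"
    and B: "is_pullback C (mbase \<phi>) (mbase \<gamma>) (mbase \<alpha>) (mbase \<beta>)"
    and E: "is_pullback C (mtotal \<phi>) (mtotal \<gamma>) (mtotal \<alpha>) (mtotal \<beta>)"
    and TE: "is_pullback C (T (mtotal \<phi>)) (T (mtotal \<gamma>)) (T (mtotal \<alpha>)) (T (mtotal \<beta>))"
  shows "is_pullback (DB C) \<phi> \<gamma> \<alpha> \<beta>"
proof (rule DB.pullbackI)
  show "comp (DB C) \<alpha> \<phi> = comp (DB C) \<beta> \<gamma>"
    using pb_comm[OF B] pb_comm[OF E] by (simp add: c)
next
  fix x y assume x: "x \<in> arr (DB C)" and y: "y \<in> arr (DB C)" and "src (DB C) y = src (DB C) x"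
    "tgt (DB C) x = src (DB C) \<phi>" "tgt (DB C) y = src (DB C) \<gamma>" and e: "comp (DB C) x \<phi> = comp (DB C) y \<gamma>"
  then have xy: "mdom y = mdom x" "mcod x = mdom \<phi>" "mcod y = mdom \<gamma>" by simp_all
  note fD = DB_arrD[OF f] and gD = DB_arrD[OF g, unfolded c] and aD = DB_arrD[OF a, unfolded c]
    and bD = DB_arrD[OF b, unfolded c] and xD = DB_arrD[OF x, unfolded xy] and yD = DB_arrD[OF y, unfolded xy]
  note [simp] = fD(1-6) gD(1-6) aD(1-6) bD(1-6) xD(1-6) yD(1-6) display_simps[OF xD(9)]
    display_simps[OF aD(9)] display_simps[OF aD(10)] display_simps[OF bD(10)]
  have e1: "mbase x \<cdot> mbase \<phi> = mbase y \<cdot> mbase \<gamma>" and e2: "mtotal x \<cdot> mtotal \<phi> = mtotal y \<cdot> mtotal \<gamma>"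
    using e by simp_all
  let ?hb = "pair C (mbase \<alpha>) (mbase \<beta>) (mbase x) (mbase y)"
  let ?ht = "pair C (mtotal \<alpha>) (mtotal \<beta>) (mtotal x) (mtotal y)"
  note hb = pair_props[OF B _ _ _ _ _ e1, simplified] and ht = pair_props[OF E _ _ _ _ _ e2, simplified]
  note [simp] = hb(1-3) ht(1-3)
  have Tht: "T ?ht \<cdot> T (mtotal \<alpha>) = T (mtotal x)" "T ?ht \<cdot> T (mtotal \<beta>) = T (mtotal y)"
    by (simp_all add: T_comp[symmetric] ht(4,5) del: T_comp)
  have h: "BMor (mdom x) (mdom \<alpha>) ?hb ?ht \<in> arr (DB C)"
  proof (rule DB_arrI[OF xD(9) aD(9)])
    show "?ht \<cdot> bproj (mdom \<alpha>) = bproj (mdom x) \<cdot> ?hb"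
      by (rule pb_eqI[OF B])
        (simp_all add: hb(4,5) aD(7)[symmetric] bD(7)[symmetric] reassoc[OF ht(4)] reassoc[OF ht(5)] xD(7) yD(7))
    show "?ht \<cdot> blift (mdom \<alpha>) = blift (mdom x) \<cdot> T ?ht"
      by (rule pb_eqI[OF TE])
        (simp_all add: aD(8)[symmetric] bD(8)[symmetric] reassoc[OF ht(4)] reassoc[OF ht(5)] xD(8) yD(8) Tht)
  qed simp_all
  show "\<exists>h\<in>arr (DB C). src (DB C) h = src (DB C) x \<and> tgt (DB C) h = src (DB C) \<alpha> \<and>
      comp (DB C) h \<alpha> = x \<and> comp (DB C) h \<beta> = y"
    by (rule bexI[OF _ h]) (simp add: hb(4,5) ht(4,5) c xy[symmetric])
next
  fix h k assume h: "h \<in> arr (DB C)" and k: "k \<in> arr (DB C)" and "src (DB C) h = src (DB C) k"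
    "tgt (DB C) h = src (DB C) \<alpha>" "tgt (DB C) k = src (DB C) \<alpha>"
    and e: "comp (DB C) h \<alpha> = comp (DB C) k \<alpha>" "comp (DB C) h \<beta> = comp (DB C) k \<beta>"
  then have hk: "mdom h = mdom k" "mcod h = mdom \<alpha>" "mcod k = mdom \<alpha>" by simp_all
  note hD = DB_arrD(1-6)[OF h, unfolded hk] and kD = DB_arrD(1-6)[OF k, unfolded hk]
    and aD = DB_arrD(1-6)[OF a]
  have "mbase h = mbase k" by (rule pb_eqI[OF B]) (use e hD kD aD in simp_all)
  moreover have "mtotal h = mtotal k" by (rule pb_eqI[OF E]) (use e hD kD aD in simp_all)
  ultimately show "h = k" using hk by simp
qed (use f g a b c in simp_all)

lemma DB_tangent_pullbackI:
  assumes f: "\<phi> \<in> arr (DB C)" and g: "\<gamma> \<in> arr (DB C)" and a: "\<alpha> \<in> arr (DB C)" and b: "\<beta> \<in> arr (DB C)"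
    and c: "mcod \<gamma> = mcod \<phi>" "mdom \<beta> = mdom \<alpha>" "mcod \<alpha> = mdom \<phi>" "mcod \<beta> = mdom \<gamma>"
    and B: "tangent_pullback C (mbase \<phi>) (mbase \<gamma>) (mbase \<alpha>) (mbase \<beta>)"
    and E: "tangent_pullback C (mtotal \<phi>) (mtotal \<gamma>) (mtotal \<alpha>) (mtotal \<beta>)"
  shows "tangent_pullback (DB C) \<phi> \<gamma> \<alpha> \<beta>"
  unfolding tangent_pullback_def
proof
  fix m
  show "is_pullback (DB C) ((tarr (DB C) ^^ m) \<phi>) ((tarr (DB C) ^^ m) \<gamma>)
      ((tarr (DB C) ^^ m) \<alpha>) ((tarr (DB C) ^^ m) \<beta>)"
    by (rule DB_pullbackI[OF DB_Tm_arr[OF f] DB_Tm_arr[OF g] DB_Tm_arr[OF a] DB_Tm_arr[OF b]])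
      (use tpb_pullback[OF tpb_Tm[OF B]] tpb_pullback[OF tpb_Tm[OF E]] tpb_pullback[OF tpb_T[OF tpb_Tm[OF E]]]
       in \<open>simp_all add: DB_Tm c\<close>)
qed

lemma DB_str:
  assumes Q: "display_bundle C Q"
  shows "tp (DB C) Q \<in> arr (DB C)" "tz (DB C) Q \<in> arr (DB C)" "tl (DB C) Q \<in> arr (DB C)"
proof -
  interpret dbundle C Q by unfold_locales (rule Q)
  note TQ = T_bundle_display[OF Q]
  show "tp (DB C) Q \<in> arr (DB C)"
    unfolding DB_sel by (rule DB_arrI[OF TQ Q]) (simp_all add: nats)
  show "tz (DB C) Q \<in> arr (DB C)"
    unfolding DB_sel by (rule DB_arrI[OF Q TQ]) (simp_all add: lift_Tz, simp add: nats)
  have "tl C E \<cdot> (T (T l) \<cdot> (T (tc C E) \<cdot> tc C (tobj C E))) = T l \<cdot> (tc C E \<cdot> T (tl C E))"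
    using law_lcc[of E] nat_l'[of l "tobj C E" "T (tc C E) \<cdot> tc C (tobj C E)"] by simp
  then show "tl (DB C) Q \<in> arr (DB C)"
    unfolding DB_sel by (intro DB_arrI[OF TQ T_bundle_display[OF TQ]]) (simp_all, simp_all add: nats)
qed

end

section \<open>Ehresmann connections in the tangent category of differential bundles\<close>

lemma tangent_pullback_at:
  assumes "tangent_pullback D f g a b"
  shows "is_pullback D f g a b" "is_pullback D (tarr D f) (tarr D g) (tarr D a) (tarr D b)"
  using assms[unfolded tangent_pullback_def, rule_format, of 0]
    assms[unfolded tangent_pullback_def, rule_format, of 1] by simp_all

locale conn_DB = conn +
  fixes v1 v2 f1 f2 :: 'b
  assumes vv: "tangent_pullback C tV tV v1 v2" and ff: "tangent_pullback C tF tF f1 f2"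
begin

abbreviation ZB where "ZB \<equiv> zero_bundle C M"
abbreviation VB where "VB \<equiv> TV_bundle C Q \<iota> tV v1 v2"
abbreviation FB where "FB \<equiv> TF_bundle C Q qF tF f1 f2"
abbreviation qD where "qD \<equiv> BMor Q ZB (ident C M) q"
abbreviation \<iota>D where "\<iota>D \<equiv> BMor VB TQ (tz C M) \<iota>"
abbreviation tVD where "tVD \<equiv> BMor VB ZB (ident C M) tV"
abbreviation qFD where "qFD \<equiv> BMor FB Q (tp C M) qF"
abbreviation tFD where "tFD \<equiv> BMor FB (T_bundle C ZB) (ident C (tobj C M)) tF"

lemma VB_sel [simp]: "bproj VB = tV" "blift VB = pb_lift C (T l \<cdot> tc C E) \<iota> tV"
  and FB_sel [simp]: "bproj FB = tF" "blift FB = pb_lift C l qF tF"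
  by (simp_all add: TV_bundle_def TF_bundle_def)

lemma dT: "display_bundle C TQ" and dZ: "display_bundle C ZB" and dTZ: "display_bundle C (T_bundle C ZB)"
  and dV: "display_bundle C VB" and dF: "display_bundle C FB"
proof -
  show T: "display_bundle C TQ" and Z: "display_bundle C ZB"
    by (simp_all add: T_bundle_display display zero_bundle_display)
  show "display_bundle C (T_bundle C ZB)" by (rule T_bundle_display[OF Z])
  show "display_bundle C VB"
    unfolding TV_bundle_def by (rule pb_bundle_display[OF T _ vv]) (simp add: vpb)
  show "display_bundle C FB"
    unfolding TF_bundle_def by (rule pb_bundle_display[OF display fpbk ff])
qed

lemma base_simps [simp]: "base C ZB = M" "total C ZB = M" "base C VB = M" "total C VB = V"
  "base C FB = tobj C M" "total C FB = F"
  by (simp_all add: base_def[of C ZB] total_def[of C ZB] base_def[of C VB] total_def[of C VB]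
      base_def[of C FB] total_def[of C FB])

lemma TZ_simps [simp]: "base C (T_bundle C ZB) = tobj C M" "total C (T_bundle C ZB) = tobj C M"
  using display_simps(9,10)[OF dZ] by simp_all

lemma VB_lift [simp]: "pb_lift C (T l \<cdot> tc C E) \<iota> tV \<in> arr C" "src C (pb_lift C (T l \<cdot> tc C E) \<iota> tV) = V"
    "tgt C (pb_lift C (T l \<cdot> tc C E) \<iota> tV) = tobj C V"
    "pb_lift C (T l \<cdot> tc C E) \<iota> tV \<cdot> T \<iota> = \<iota> \<cdot> (T l \<cdot> tc C E)"
    "pb_lift C (T l \<cdot> tc C E) \<iota> tV \<cdot> T tV = tV \<cdot> tz C M"
  using pb_lift_simps[OF diffT, of "tz C M" \<iota> tV] vpb by simp_all

lemma FB_lift [simp]: "pb_lift C l qF tF \<in> arr C" "src C (pb_lift C l qF tF) = F"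
    "tgt C (pb_lift C l qF tF) = tobj C F"
    "pb_lift C l qF tF \<cdot> T qF = qF \<cdot> l" "pb_lift C l qF tF \<cdot> T tF = tF \<cdot> tz C (tobj C M)"
  using pb_lift_simps[OF diff, of "tp C M" qF tF] fpbk by simp_all

lemma DB_morphisms:
  "qD \<in> arr (DB C)" "\<iota>D \<in> arr (DB C)" "tVD \<in> arr (DB C)" "qFD \<in> arr (DB C)" "tFD \<in> arr (DB C)"
  by (rule DB_arrI[OF display dZ] DB_arrI[OF dV dT] DB_arrI[OF dV dZ] DB_arrI[OF dF display]
      DB_arrI[OF dF dTZ]; simp add: iota_Tq finsler_comm nats)+

text \<open>The zero and the projection of the trivial bundle are those of \<open>M\<close>, so on bases the squares are
  pullbacks of identities.\<close>

lemma DB_vertical: "vertical_pullback (DB C) qD \<iota>D tVD"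
  unfolding vertical_pullback_def
proof (rule DB_tangent_pullbackI[OF DB_tarr[OF DB_morphisms(1)] _ DB_morphisms(2,3)])
  show "tz (DB C) (tgt (DB C) qD) \<in> arr (DB C)" using DB_str(2)[OF dZ] by simp
qed (use vpb tpb_of_ident[of "tz C M"] in simp_all)

lemma DB_finsler: "finsler_pullback (DB C) qD qFD tFD"
  unfolding finsler_pullback_def
proof (rule DB_tangent_pullbackI[OF DB_morphisms(1) _ DB_morphisms(4,5)])
  show "tp (DB C) (tgt (DB C) qD) \<in> arr (DB C)" using DB_str(1)[OF dZ] by simp
qed (use fpbk tpb_of_ident[of "tp C M"] in simp_all)

lemmas DB_vpb = DB_vertical[unfolded vertical_pullback_def]
lemmas DB_fpb = DB_finsler[unfolded finsler_pullback_def]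

lemmas DB_V = tangent_pullback_at(1)[OF DB_vpb] and DB_TV = tangent_pullback_at(2)[OF DB_vpb]
  and DB_F = tangent_pullback_at(1)[OF DB_fpb] and DB_TF = tangent_pullback_at(2)[OF DB_fpb]

lemma bmor_eqI: "mdom \<phi> = A \<Longrightarrow> mcod \<phi> = B \<Longrightarrow> mbase \<phi> = f \<Longrightarrow> mtotal \<phi> = g \<Longrightarrow> \<phi> = BMor A B f g"
  by (cases \<phi>) simp

text \<open>Descent, zero and lifts are each characterised by equations.  On total spaces these are the equations
  of \<open>C\<close>, on bases they leave just one solution.\<close>

lemma DB_hdescent: "hdescent (DB C) qD qFD tFD = BMor TQ FB (ident C (tobj C M)) \<pi>"
    and DB_hdescent_arr: "BMor TQ FB (ident C (tobj C M)) \<pi> \<in> arr (DB C)"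
proof -
  let ?D = "hdescent (DB C) qD qFD tFD"
  have 1: "tp (DB C) Q \<in> arr (DB C)" and 2: "tarr (DB C) qD \<in> arr (DB C)"
    by (rule DB_str(1)[OF display] DB_tarr[OF DB_morphisms(1)])+
  have D: "?D \<in> arr (DB C)" "mdom ?D = TQ" "mcod ?D = FB"
    "comp (DB C) ?D qFD = tp (DB C) Q" "comp (DB C) ?D tFD = tarr (DB C) qD"
    using DB.pair_props[OF DB_F 1 2] by (simp_all add: hdescent_def nat_p)
  note d = DB_arrD[OF D(1), unfolded D(2,3)]
  have e: "mbase ?D \<cdot> ident C (tobj C M) = ident C (tobj C M)" "mtotal ?D \<cdot> qF = tp C E"
    "mtotal ?D \<cdot> tF = T q"
    using D(4,5) by simp_all
  have b: "mbase ?D = ident C (tobj C M)" using e(1) d(1-3) by simp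
  have t: "mtotal ?D = \<pi>"
    by (rule pb_eqI[OF tpb_pullback[OF fpbk]]) (use e d in simp_all)
  show eq: "?D = BMor TQ FB (ident C (tobj C M)) \<pi>"
    by (rule bmor_eqI[OF D(2,3) b t])
  show "BMor TQ FB (ident C (tobj C M)) \<pi> \<in> arr (DB C)" using D(1) unfolding eq .
qed

lemma DB_vzero: "vzero (DB C) qD \<iota>D = BMor Q VB (ident C M) (vzero C q \<iota>)"
proof -
  have 1: "tz (DB C) Q \<in> arr (DB C)" and 2: "qD \<in> arr (DB C)"
    by (rule DB_str(2)[OF display] DB_morphisms(1))+
  let ?P = "\<lambda>h. h \<in> hom (DB C) (src (DB C) qD) (src (DB C) \<iota>D) \<and>
    comp (DB C) h \<iota>D = tz (DB C) (src (DB C) qD)"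
  let ?D = "pair (DB C) \<iota>D tVD (tz (DB C) Q) qD"
  have D: "?P ?D"
    using DB.pair_props[OF DB_V 1 2] by (simp add: DB.hom_iff nats)
  have U: "h = BMor Q VB (ident C M) (vzero C q \<iota>)" if "?P h" for h
  proof -
    have h: "h \<in> arr (DB C)" "mdom h = Q" "mcod h = VB"
      and e: "mbase h \<cdot> tz C M = tz C M" "mtotal h \<cdot> \<iota> = tz C E"
      using that by (simp_all add: DB.hom_iff)
    note d = DB_arrD[OF h(1), unfolded h(2,3)]
    have "mbase h \<cdot> (tz C M \<cdot> tp C M) = tz C M \<cdot> tp C M"
      using reassoc[OF e(1), of "tp C M"] d(1-3) by (simp del: law_zp)
    then have b: "mbase h = ident C M" using d(1-3) by simp
    have "mtotal h = vzero C q \<iota>"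
      by (rule iota_mono) (use e d in simp_all)
    with b show ?thesis by (intro bmor_eqI h(2,3))
  qed
  show ?thesis
    unfolding vzero_def[of "DB C"]
    by (rule the_equality[of ?P, OF D[unfolded U[OF D]] U])
qed

lemma DB_vlift: "vlift (DB C) qD \<iota>D = BMor VB (T_bundle C VB) (tz C M) (vlift C q \<iota>)"
proof -
  have 1: "comp (DB C) \<iota>D (tl (DB C) Q) \<in> arr (DB C)" and 2: "comp (DB C) tVD (tz (DB C) ZB) \<in> arr (DB C)"
    by (rule DB_comp[OF DB_morphisms(2) DB_str(3)[OF display]] DB_comp[OF DB_morphisms(3) DB_str(2)[OF dZ]], simp)+
  have TV: "base C (T_bundle C VB) = tobj C M" "total C (T_bundle C VB) = tobj C V"
    using display_simps[OF dV] by simp_all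
  let ?P = "\<lambda>h. h \<in> hom (DB C) (src (DB C) \<iota>D) (tobj (DB C) (src (DB C) \<iota>D)) \<and>
    comp (DB C) h (tarr (DB C) \<iota>D) = comp (DB C) \<iota>D (tl (DB C) (src (DB C) qD))"
  let ?D = "pair (DB C) (tarr (DB C) \<iota>D) (tarr (DB C) tVD) (comp (DB C) \<iota>D (tl (DB C) Q))
    (comp (DB C) tVD (tz (DB C) ZB))"
  have "\<iota> \<cdot> (T q \<cdot> tl C M) = tV \<cdot> (tz C M \<cdot> T (tz C M))"
    by (simp add: reassoc[OF iota_Tq])
  then have lq: "\<iota> \<cdot> (tl C E \<cdot> T (T q)) = tV \<cdot> (tz C M \<cdot> T (tz C M))" by (simp add: nat_l)
  have D: "?P ?D"
    using DB.pair_props[OF DB_TV 1 2] by (simp add: DB.hom_iff lq)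
  have U: "h = BMor VB (T_bundle C VB) (tz C M) (vlift C q \<iota>)" if "?P h" for h
  proof -
    have h: "h \<in> arr (DB C)" "mdom h = VB" "mcod h = T_bundle C VB"
      and e: "mbase h \<cdot> T (tz C M) = tz C M \<cdot> tl C M" "mtotal h \<cdot> T \<iota> = \<iota> \<cdot> tl C E"
      using that by (simp_all add: DB.hom_iff)
    note d = DB_arrD[OF h(1), unfolded h(2,3) TV base_simps]
    have Tz: "T (tz C M) \<cdot> T (tp C M) = ident C (tobj C M)"
      by (simp add: T_comp[symmetric] del: T_comp)
    have "mbase h \<cdot> (T (tz C M) \<cdot> T (tp C M)) = (tz C M \<cdot> tl C M) \<cdot> T (tp C M)"
      by (rule reassoc[OF e(1)]) (use d(1-3) in simp_all)
    then have b: "mbase h = tz C M" using d(1-3) by (simp add: Tz)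
    have "mtotal h = vlift C q \<iota>"
      by (rule Tiota_mono) (use e d in simp_all)
    with b show ?thesis by (intro bmor_eqI h(2,3))
  qed
  show ?thesis
    unfolding vlift_def[of "DB C"]
    by (rule the_equality[of ?P, OF D[unfolded U[OF D]] U])
qed

lemma flift_simps [simp]: "flift C q qF tF \<in> arr C" "src C (flift C q qF tF) = F"
  "tgt C (flift C q qF tF) = tobj C F" "flift C q qF tF \<cdot> T qF = qF \<cdot> tz C E"
  "flift C q qF tF \<cdot> T tF = tF \<cdot> tl C M"
proof -
  have "qF \<cdot> (q \<cdot> tz C M) = tF \<cdot> (tp C M \<cdot> tz C M)" by (simp add: reassoc2[OF finsler_comm])
  then have "qF \<cdot> (tz C E \<cdot> T q) = tF \<cdot> (tp C M \<cdot> tz C M)" by (simp add: nat_z)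
  from pair_props[OF tpb_pullback[OF tpb_T[OF fpbk]], of "qF \<cdot> tz C E" "tF \<cdot> tl C M", simplified, OF this]
  show "flift C q qF tF \<in> arr C" "src C (flift C q qF tF) = F"
    "tgt C (flift C q qF tF) = tobj C F" "flift C q qF tF \<cdot> T qF = qF \<cdot> tz C E"
    "flift C q qF tF \<cdot> T tF = tF \<cdot> tl C M"
    by (simp_all add: flift_def)
qed

lemma DB_flift: "flift (DB C) qD qFD tFD = BMor FB (T_bundle C FB) (tl C M) (flift C q qF tF)"
proof -
  have 1: "comp (DB C) qFD (tz (DB C) Q) \<in> arr (DB C)" and 2: "comp (DB C) tFD (tl (DB C) ZB) \<in> arr (DB C)"
    by (rule DB_comp[OF DB_morphisms(4) DB_str(2)[OF display]] DB_comp[OF DB_morphisms(5) DB_str(3)[OF dZ]], simp)+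
  have TF: "base C (T_bundle C FB) = tobj C (tobj C M)" "total C (T_bundle C FB) = tobj C F"
    using display_simps[OF dF] by simp_all
  let ?D = "flift (DB C) qD qFD tFD"
  have "qF \<cdot> (q \<cdot> tz C M) = tF \<cdot> (tp C M \<cdot> tz C M)" by (simp add: reassoc2[OF finsler_comm])
  then have lq: "qF \<cdot> (tz C E \<cdot> T q) = tF \<cdot> (tp C M \<cdot> tz C M)" by (simp add: nat_z)
  have D: "?D \<in> arr (DB C)" "mdom ?D = FB" "mcod ?D = T_bundle C FB"
    "comp (DB C) ?D (tarr (DB C) qFD) = comp (DB C) qFD (tz (DB C) Q)"
    "comp (DB C) ?D (tarr (DB C) tFD) = comp (DB C) tFD (tl (DB C) ZB)"
    using DB.pair_props[OF DB_TF 1 2] by (simp_all add: flift_def lq)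
  note d = DB_arrD[OF D(1), unfolded D(2,3) TF base_simps]
  have e: "mbase ?D \<cdot> ident C (tobj C (tobj C M)) = tl C M" "mtotal ?D \<cdot> T qF = qF \<cdot> tz C E"
    "mtotal ?D \<cdot> T tF = tF \<cdot> tl C M"
    using D(4,5) by simp_all
  have b: "mbase ?D = tl C M" using e(1) d(1-3) by simp
  have t: "mtotal ?D = flift C q qF tF"
    by (rule pb_eqI[OF tpb_pullback[OF tpb_T[OF fpbk]]]) (use e d in simp_all)
  show ?thesis by (rule bmor_eqI[OF D(2,3) b t])
qed

text \<open>On bases, the axiom that \<open>\<rho>\<close> lies over \<open>Q\<close> reads \<open>\<rho> z p = p\<close>, where \<open>z p = id\<close>; and the axiom that \<open>\<eta>\<close> is a
  section of the descent reads \<open>\<eta> id = id\<close>.\<close>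

lemma DB_ehresmann_base:
  assumes "DB_ehresmann_connection C Q \<iota> tV v1 v2 qF tF f1 f2 \<rho> \<eta>"
  shows "mbase \<rho> = tp C M" "mbase \<eta> = ident C (tobj C M)"
proof -
  have a: "vertical_connection (DB C) qD \<iota>D tVD \<rho>" "horizontal_connection (DB C) qD qFD tFD \<eta>"
    using assms by (simp_all add: DB_ehresmann_connection_def ehresmann_connection_def Let_def)
  have \<rho>: "\<rho> \<in> arr (DB C)" "mdom \<rho> = TQ" "mcod \<rho> = VB"
    and l: "comp (DB C) (tp (DB C) Q) (ident (DB C) Q) = comp (DB C) \<rho> (vproj (DB C) qD \<iota>D)"
    using a(1) by (simp_all add: vertical_connection_def linear_def DB.hom_iff del: DB_sel(4,5))
  note r = DB_arrD[OF \<rho>(1), unfolded \<rho>(2,3)]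
  show "mbase \<rho> = tp C M"
    using l r(1-3) by (simp add: vproj_def)
  have \<eta>: "\<eta> \<in> arr (DB C)" "mdom \<eta> = FB" "mcod \<eta> = TQ"
    and h: "comp (DB C) \<eta> (hdescent (DB C) qD qFD tFD) = ident (DB C) FB"
    using a(2) by (simp_all add: horizontal_connection_def DB.hom_iff)
  note e = DB_arrD[OF \<eta>(1), unfolded \<eta>(2,3)]
  show "mbase \<eta> = ident C (tobj C M)"
    using h e(1-3) by (simp add: DB_hdescent)
qed

end

context conn_DB
begin

abbreviation linR where
  "linR R \<equiv> linear C (bproj TQ) (blift TQ) tV (pb_lift C (blift TQ) \<iota> tV) (tp C M) R"
abbreviation linH where
  "linH H \<equiv> linear C tF (pb_lift C l qF tF) (bproj TQ) (blift TQ) (ident C (tobj C M)) H"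

lemma linR_iff: "BMor TQ VB (tp C M) R \<in> arr (DB C) \<longleftrightarrow> linR R"
  by (simp add: DB_arr dT dV)

lemma linH_iff: "BMor FB TQ (ident C (tobj C M)) H \<in> arr (DB C) \<longleftrightarrow> linH H"
  by (simp add: DB_arr dT dF)

lemma DB_vertical_iff:
  assumes [simp]: "R \<in> arr C" "src C R = tobj C E" "tgt C R = V"
  shows "vertical_connection (DB C) qD \<iota>D tVD (BMor TQ VB (tp C M) R) \<longleftrightarrow>
    vertical_connection C q \<iota> tV R \<and> linR R"
proof -
  have i: "BMor Q Q (ident C M) (ident C E) \<in> arr (DB C)"
    using DB_ident[OF display] by simp
  show ?thesis
    unfolding vertical_connection_def linear_def[of "DB C"] linR_iff[symmetric]
    using vp DB_vertical i
    by (auto simp add: DB.hom_iff hom_iff vproj_def[of "DB C"] DB_vlift linear_def[of C "tp C E"] simp del: DB_arr)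
qed

lemma DB_horizontal_iff:
  assumes [simp]: "H \<in> arr C" "src C H = F" "tgt C H = tobj C E"
  shows "horizontal_connection (DB C) qD qFD tFD (BMor FB TQ (ident C (tobj C M)) H) \<longleftrightarrow>
    horizontal_connection C q qF tF H \<and> linH H"
proof -
  have i: "BMor Q Q (ident C M) (ident C E) \<in> arr (DB C)"
    using DB_ident[OF display] by simp
  show ?thesis
    unfolding horizontal_connection_def linear_def[of "DB C"] linH_iff[symmetric]
    using fpb DB_finsler i
    by (auto simp add: DB.hom_iff hom_iff DB_hdescent DB_flift linear_def[of C qF])
qed

lemma vertical_part_exists:
  assumes R: "R \<in> hom C (tobj C E) V" and H: "H \<in> hom C F (tobj C E)"
    and p: "R \<cdot> vproj C q \<iota> = tp C E"
  obtains K where "conn_RH C Q \<iota> tV qF tF R K H"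
proof -
  have [simp]: "R \<in> arr C" "src C R = tobj C E" "tgt C R = V" using R by (simp_all add: hom_iff)
  have "(R \<cdot> \<iota>) \<cdot> T q = (R \<cdot> tV) \<cdot> tz C M" by (simp add: iota_Tq)
  from vert_ex[OF _ _ _ _ _ this] p obtain K where "fib_pair K (tp C E)" "R \<cdot> \<iota> = vert K (tp C E)"
    by auto
  with H show thesis
    by (intro that[of K]) (unfold_locales, simp_all add: hom_iff)
qed

lemma linear_ehresmann_vproj:
  assumes "linear_ehresmann_connection C Q \<iota> tV qF tF R H"
  shows "R \<cdot> vproj C q \<iota> = tp C E"
proof -
  have "linear C (tp C E) (tl C E) (vproj C q \<iota>) (vlift C q \<iota>) (ident C E) R"
    using assms by (simp add: linear_ehresmann_connection_def ehresmann_connection_def vertical_connection_def)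
  then show ?thesis by (simp add: linear_def)
qed

lemma T2_proj [simp]: "bproj (T2_bundle C Q) = T2_arr C q"
  by (simp add: T2_bundle_def)

lemma T2_base [simp]: "base C (T2_bundle C Q) = tw C M" "total C (T2_bundle C Q) = tw C E"
  by (simp_all add: base_def[of C "T2_bundle C Q"] total_def[of C "T2_bundle C Q"])

lemma T2_lift:
  "blift (T2_bundle C Q) \<cdot> T (tw1 C E) = tw1 C E \<cdot> (T l \<cdot> tc C E)"
  "blift (T2_bundle C Q) \<cdot> T (tw2 C E) = tw2 C E \<cdot> (T l \<cdot> tc C E)"
proof -
  have "(tw1 C E \<cdot> (T l \<cdot> tc C E)) \<cdot> T (tp C E) = (tw2 C E \<cdot> (T l \<cdot> tc C E)) \<cdot> T (tp C E)"
    by (simp add: nat_p)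
  from pair_props[OF Ttw_pb _ _ _ _ _ this]
  show "blift (T2_bundle C Q) \<cdot> T (tw1 C E) = tw1 C E \<cdot> (T l \<cdot> tc C E)"
    "blift (T2_bundle C Q) \<cdot> T (tw2 C E) = tw2 C E \<cdot> (T l \<cdot> tc C E)"
    by (simp_all add: T2_bundle_def)
qed

text \<open>On bases, \<open>\<langle>p z, id\<rangle>\<close> takes the place of \<open>\<langle>R \<iota>, \<pi> H\<rangle>\<close>.  The pairing on total spaces is linear because \<open>R\<close>, \<open>\<iota>\<close>,
  \<open>\<pi>\<close> and \<open>H\<close> are.\<close>

lemma DB_sum:
  assumes R: "BMor TQ VB (tp C M) R \<in> arr (DB C)" and H: "BMor FB TQ (ident C (tobj C M)) H \<in> arr (DB C)"
    and d2: "display_bundle C (T2_bundle C Q)"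
    and u: "u \<in> hom C (tobj C E) (tw C E)" "u \<cdot> tw1 C E = R \<cdot> \<iota>" "u \<cdot> tw2 C E = \<pi> \<cdot> H"
  obtains u' where "BMor TQ (T2_bundle C Q) u' u \<in> arr (DB C)" "u' \<cdot> tw1 C M = tp C M \<cdot> tz C M"
    "u' \<cdot> tw2 C M = ident C (tobj C M)" "u' \<cdot> ts C M = ident C (tobj C M)"
proof -
  have [simp]: "u \<in> arr C" "src C u = tobj C E" "tgt C u = tw C E" using u(1) by (simp_all add: hom_iff)
  note r = DB_arrD[OF R, simplified] and h = DB_arrD[OF H, simplified]
  note \<pi>a = DB_arrD[OF DB_hdescent_arr, simplified]
  note [simp] = r(1-6) h(1-6)
  let ?u = "pair C (tw1 C M) (tw2 C M) (tp C M \<cdot> tz C M) (ident C (tobj C M))"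
  note v = pair_props[OF tw_pb[of M], of "tp C M \<cdot> tz C M" "ident C (tobj C M)", simplified]
  have s: "?u \<cdot> ts C M = ident C (tobj C M)"
    using fsum_zero_left[OF tangent_bundle_additive, of M "ident C (tobj C M)"] by (simp add: fsum_def)
  have Hq: "H \<cdot> T q = tF" using h by simp
  have Tu: "T u \<cdot> T (tw1 C E) = T R \<cdot> T \<iota>" "T u \<cdot> T (tw2 C E) = T \<pi> \<cdot> T H"
    by (simp_all add: T_comp[symmetric] u(2,3) del: T_comp)
  note dl = display_simps[OF d2]
  have "BMor TQ (T2_bundle C Q) ?u u \<in> arr (DB C)"
  proof (rule DB_arrI[OF dT d2])
    show "u \<cdot> bproj (T2_bundle C Q) = bproj TQ \<cdot> ?u"
      by (rule pb_eqI[OF tw_pb[of M]])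
        (use v r in \<open>simp_all add: T2_tw reassoc[OF u(2)] reassoc[OF u(3)] iota_Tq Hq reassoc2[OF r(7)]\<close>)
    show "u \<cdot> blift (T2_bundle C Q) = blift TQ \<cdot> T u"
    proof (rule pb_eqI[OF Ttw_pb[of E]])
      have "R \<cdot> (\<iota> \<cdot> (T l \<cdot> tc C E)) = R \<cdot> (pb_lift C (T l \<cdot> tc C E) \<iota> tV \<cdot> T \<iota>)" by simp
      also have "\<dots> = (T l \<cdot> (tc C E \<cdot> T R)) \<cdot> T \<iota>"
        using reassoc[OF r(8), of "T \<iota>"] by (simp del: VB_lift(4))
      finally show "(u \<cdot> blift (T2_bundle C Q)) \<cdot> T (tw1 C E) = (blift TQ \<cdot> T u) \<cdot> T (tw1 C E)"
        using dl by (simp add: T2_lift reassoc[OF u(2)] Tu)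
      have "\<pi> \<cdot> (H \<cdot> (T l \<cdot> tc C E)) = (\<pi> \<cdot> pb_lift C l qF tF) \<cdot> T H"
        using h(8) by simp
      also have "\<dots> = (T l \<cdot> (tc C E \<cdot> T \<pi>)) \<cdot> T H"
        unfolding \<pi>a(8) by simp
      finally show "(u \<cdot> blift (T2_bundle C Q)) \<cdot> T (tw2 C E) = (blift TQ \<cdot> T u) \<cdot> T (tw2 C E)"
        using dl by (simp add: T2_lift reassoc[OF u(3)] Tu)
    qed (use dl in simp_all)
  qed (use v in simp_all)
  with v s show thesis by (intro that[of ?u]) simp_all
qed

text \<open>The axioms in the two tangent categories agree on total spaces.  Beyond that, a connection in \<open>DB C\<close>
  asserts that its components are linear morphisms of bundles, and that the pairing
  is a morphism to \<open>T\<^sub>2 Q\<close>.  For the latter \<open>T\<^sub>2 Q\<close> must be an object of \<open>DB C\<close>, which is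
  known through the Koszul connection that belongs to \<open>(R, H)\<close>.\<close>

theorem linear_ehresmann_iff_DB:
  assumes R: "R \<in> hom C (tobj C E) V" and H: "H \<in> hom C F (tobj C E)"
  shows "linear_ehresmann_connection C Q \<iota> tV qF tF R H \<longleftrightarrow>
    DB_ehresmann_connection C Q \<iota> tV v1 v2 qF tF f1 f2
      (BMor TQ VB (tp C M) R) (BMor FB TQ (ident C (tobj C M)) H)"
proof -
  have [simp]: "R \<in> arr C" "src C R = tobj C E" "tgt C R = V" "H \<in> arr C" "src C H = F" "tgt C H = tobj C E"
    using R H by (simp_all add: hom_iff)
  let ?\<rho> = "BMor TQ VB (tp C M) R" and ?\<eta> = "BMor FB TQ (ident C (tobj C M)) H"
  let ?sum = "\<exists>u \<in> hom C (tobj C E) (tw C E). u \<cdot> tw1 C E = R \<cdot> \<iota> \<and> u \<cdot> tw2 C E = \<pi> \<cdot> H \<and>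
        u \<cdot> ts C E = ident C (tobj C E)"
  let ?SUM = "\<exists>u\<in>hom (DB C) TQ (T2_bundle C Q).
        comp (DB C) u (tw1 (DB C) Q) = comp (DB C) ?\<rho> \<iota>D \<and>
        comp (DB C) u (tw2 (DB C) Q) = comp (DB C) (hdescent (DB C) qD qFD tFD) ?\<eta> \<and>
        comp (DB C) u (ts (DB C) Q) = ident (DB C) TQ"
  have 1: "linear_ehresmann_connection C Q \<iota> tV qF tF R H \<longleftrightarrow>
      (vertical_connection C q \<iota> tV R \<and> linR R) \<and> (horizontal_connection C q qF tF H \<and> linH H) \<and>
      H \<cdot> R = qF \<cdot> vzero C q \<iota> \<and> ?sum"
    unfolding linear_ehresmann_connection_def ehresmann_connection_def bundle_simps by auto
  have 3: "DB_ehresmann_connection C Q \<iota> tV v1 v2 qF tF f1 f2 ?\<rho> ?\<eta> \<longleftrightarrow>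
      vertical_connection (DB C) qD \<iota>D tVD ?\<rho> \<and> horizontal_connection (DB C) qD qFD tFD ?\<eta> \<and>
      H \<cdot> R = qF \<cdot> vzero C q \<iota> \<and> ?SUM"
    unfolding DB_ehresmann_connection_def Let_def ehresmann_connection_def
    by (simp add: DB_vzero)
  have total_sum: "?SUM \<Longrightarrow> ?sum"
  proof -
    assume ?SUM
    then obtain u where u: "u \<in> hom (DB C) TQ (T2_bundle C Q)"
        "comp (DB C) u (tw1 (DB C) Q) = comp (DB C) ?\<rho> \<iota>D"
        "comp (DB C) u (tw2 (DB C) Q) = comp (DB C) (hdescent (DB C) qD qFD tFD) ?\<eta>"
        "comp (DB C) u (ts (DB C) Q) = ident (DB C) TQ"
      by blast
    then have ua: "u \<in> arr (DB C)" "mdom u = TQ" "mcod u = T2_bundle C Q" by (simp_all add: DB.hom_iff)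
    show ?sum
      using DB_arrD(4-6)[OF ua(1), unfolded ua(2,3) T2_base] u(2-4)
      by (intro bexI[of _ "mtotal u"]) (simp_all add: DB_hdescent hom_iff)
  qed
  show ?thesis
  proof
    assume L: "linear_ehresmann_connection C Q \<iota> tV qF tF R H"
    then have L1: "vertical_connection C q \<iota> tV R" "linR R" "horizontal_connection C q qF tF H" "linH H"
      "H \<cdot> R = qF \<cdot> vzero C q \<iota>" ?sum
      unfolding 1 by blast+
    \<comment> \<open>the vertical part of \<open>R\<close> makes \<open>T\<^sub>2 Q\<close> available as an object\<close>
    obtain K where "conn_RH C Q \<iota> tV qF tF R K H"
      using vertical_part_exists[OF R H linear_ehresmann_vproj[OF L]] .
    then interpret conn_RH C Q \<iota> tV qF tF R K H .
    have "display_bundle C (T2_bundle C Q)"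
      using T2_bundle_display[OF display T2_display] L linear_ehresmann_iff_koszul by blast
    moreover obtain u where u: "u \<in> hom C (tobj C E) (tw C E)" "u \<cdot> tw1 C E = R \<cdot> \<iota>"
        "u \<cdot> tw2 C E = \<pi> \<cdot> H" "u \<cdot> ts C E = ident C (tobj C E)"
      using L1(6) by blast
    ultimately obtain u' where u': "BMor TQ (T2_bundle C Q) u' u \<in> arr (DB C)"
        "u' \<cdot> tw1 C M = tp C M \<cdot> tz C M" "u' \<cdot> tw2 C M = ident C (tobj C M)"
        "u' \<cdot> ts C M = ident C (tobj C M)"
      using DB_sum[OF L1(2)[folded linR_iff] L1(4)[folded linH_iff]] by blast
    have ?SUM
      by (rule bexI[of _ "BMor TQ (T2_bundle C Q) u' u"])
        (use u u' in \<open>simp_all add: DB_hdescent DB.hom_iff\<close>)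
    then show "DB_ehresmann_connection C Q \<iota> tV v1 v2 qF tF f1 f2 ?\<rho> ?\<eta>"
      unfolding 3 using L1 by (simp add: DB_vertical_iff DB_horizontal_iff)
  next
    assume "DB_ehresmann_connection C Q \<iota> tV v1 v2 qF tF f1 f2 ?\<rho> ?\<eta>"
    then show "linear_ehresmann_connection C Q \<iota> tV qF tF R H"
      unfolding 1 3 using total_sum by (simp only: DB_vertical_iff DB_horizontal_iff assms(1) simp_thms
        \<open>R \<in> arr C\<close> \<open>src C R = tobj C E\<close> \<open>tgt C R = V\<close> \<open>H \<in> arr C\<close> \<open>src C H = F\<close> \<open>tgt C H = tobj C E\<close>)
  qed
qed

end

theorem theorem3p57:
  fixes C :: "('o, 'm) tcat" and Q :: "'m bundle_data"
    and \<iota> tV v1 v2 qF tF f1 f2 R H :: 'm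
  assumes "tangent_category C"
    and "display_bundle C Q"
    and "vertical_pullback C (bproj Q) \<iota> tV"
    and "finsler_pullback C (bproj Q) qF tF"
    and "tangent_pullback C tV tV v1 v2"
    and "tangent_pullback C tF tF f1 f2"
    and "R \<in> hom C (tobj C (total C Q)) (src C \<iota>)"
    and "H \<in> hom C (src C qF) (tobj C (total C Q))"
  shows "(R \<cdot>\<^bsub>C\<^esub> vproj C (bproj Q) \<iota> = tp C (total C Q) \<longrightarrow>
            (linear_ehresmann_connection C Q \<iota> tV qF tF R H \<longleftrightarrow>
             koszul_connection C Q qF tF (brace C Q (R \<cdot>\<^bsub>C\<^esub> \<iota>)) H)) \<and>
         (linear_ehresmann_connection C Q \<iota> tV qF tF R H \<longrightarrow>
             koszul_connection C Q qF tF (brace C Q (R \<cdot>\<^bsub>C\<^esub> \<iota>)) H) \<and>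
         (linear_ehresmann_connection C Q \<iota> tV qF tF R H \<longleftrightarrow>
            DB_ehresmann_connection C Q \<iota> tV v1 v2 qF tF f1 f2
              (BMor (T_bundle C Q) (TV_bundle C Q \<iota> tV v1 v2) (tp C (base C Q)) R)
              (BMor (TF_bundle C Q qF tF f1 f2) (T_bundle C Q) (ident C (tobj C (base C Q))) H)) \<and>
         (\<forall>\<rho> \<eta>. DB_ehresmann_connection C Q \<iota> tV v1 v2 qF tF f1 f2 \<rho> \<eta> \<longrightarrow>
            mbase \<rho> = tp C (base C Q) \<and> mbase \<eta> = ident C (tobj C (base C Q)))"
proof -
  interpret conn_DB C Q \<iota> tV qF tF v1 v2 f1 f2
    using assms(1-6) by unfold_locales
  have lin_koszul: "linear_ehresmann_connection C Q \<iota> tV qF tF R H \<longleftrightarrow>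
      koszul_connection C Q qF tF (brace C Q (R \<cdot>\<^bsub>C\<^esub> \<iota>)) H"
    if p: "R \<cdot>\<^bsub>C\<^esub> vproj C (bproj Q) \<iota> = tp C (total C Q)"
  proof -
    obtain K where "conn_RH C Q \<iota> tV qF tF R K H"
      using vertical_part_exists[OF assms(7,8) p] .
    then interpret conn_RH C Q \<iota> tV qF tF R K H .
    show ?thesis
      unfolding K_brace by (rule linear_ehresmann_iff_koszul)
  qed
  moreover have "linear_ehresmann_connection C Q \<iota> tV qF tF R H \<longrightarrow>
      koszul_connection C Q qF tF (brace C Q (R \<cdot>\<^bsub>C\<^esub> \<iota>)) H"
    using lin_koszul linear_ehresmann_vproj by blast
  ultimately show ?thesis
    using linear_ehresmann_iff_DB[OF assms(7,8)] DB_ehresmann_base by blast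
qed

end
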